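(* Let $R$ be a regular local ring of dimension two with maximal ideal $\mathfrak m_R$, residue field $\mathfrak k=R/\mathfrak m_R$, coefficient set $CS$ and regular parameters $x,y$. Let $\nu$ be a rank 1 valuation of the quotient field of $R$ which dominates $R$, and suppose that $\nu(x)=\nu(\mathfrak m_R)$. Let $P_0=x,P_1=y,P_2,\ldots$, together with $\Omega$, $\overline n_i$, $d_i$, $n_i$, $\alpha_i$, be a sequence constructed from $\nu,x,y$ by the algorithm described in the context. Then a) The set $\{\mathrm{in}_\nu(x)\}\cup\{\mathrm{in}_\nu(P_i)\mid i\ge1,\ n_i>1\}$ minimally generates $\mathrm{gr}_\nu(R)$ as a $\mathfrak k$-algebra. b) The set $\{\nu(x)\}\cup\{\nu(P_i)\mid i\ge1,\ \overline n_i>1\}$ minimally generates the semigroup $S^R(\nu)$. c) $V_\nu/\mathfrak m_\nu=\mathfrak k(\alpha_i\mid d_i>1)$.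
   Context: $\mathbb N=\{0,1,2,\ldots\}$. $V_\nu$ is the valuation ring of $\nu$, with maximal ideal $\mathfrak m_\nu$; $\nu$ dominates $R$ if $R\subset V_\nu$ and $\mathfrak m_\nu\cap R=\mathfrak m_R$. $S^R(\nu)=\{\nu(f)\mid f\in R\setminus\{0\}\}$ (it contains $0$; generation means by nonnegative integer combinations). For an ideal $I$, $\nu(I)=\min\{\nu(f)\mid f\in I\setminus\{0\}\}$. For $\varphi$ in the value group $\Gamma_\nu$, put $\mathcal P_\varphi(R)=\{f\in R\mid\nu(f)\ge\varphi\}$, $\mathcal P^+_\varphi(R)=\{f\in R\mid\nu(f)>\varphi\}$, $\mathrm{gr}_\nu(R)=\bigoplus_{\varphi\in\Gamma_\nu}\mathcal P_\varphi(R)/\mathcal P^+_\varphi(R)$, and for $0\neq f\in R$ with $\nu(f)=\varphi$, $\mathrm{in}_\nu(f)=f+\mathcal P^+_\varphi(R)$. "Minimally generates" means that the set generates and no proper subset does. $[f]$ denotes the class of $f\in V_\nu$ in $V_\nu/\mathfrak m_\nu$. $G(z_1,\ldots,z_n)$ is the subgroup generated by $z_1,\ldots,z_n$. A coefficient set of $R$ is a subset $CS\subset R$ with $0,1\in CS$ mapping bijectively to $\mathfrak k$. The algorithm. Set $P_0=x$, $P_1=y$. Given $P_0,\ldots,P_i$ ($i\ge1$), let $\overline n_i=[G(\nu(P_0),\ldots,\nu(P_i)):G(\nu(P_0),\ldots,\nu(P_{i-1}))]$. If $\overline n_i=\infty$, stop: $\Omega=i$, and set $\alpha_i=1$, $d_i=1$,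 $n_i=\infty$. If $\overline n_i<\infty$, choose a monomial $U_i=P_0^{w_0(i)}\cdots P_{i-1}^{w_{i-1}(i)}$ with $w_j(i)\in\mathbb N$, $w_j(i)<n_j$ for $1\le j\le i-1$, and $\nu(U_i)=\overline n_i\nu(P_i)$; let $\alpha_i=[P_i^{\overline n_i}/U_i]$ and $d_i=[\mathfrak k(\alpha_1,\ldots,\alpha_i):\mathfrak k(\alpha_1,\ldots,\alpha_{i-1})]$. If $d_i=\infty$, stop: $\Omega=i$, $n_i=\infty$. Otherwise let $n_i=\overline n_id_i$, let $f_i(u)=u^{d_i}+b_{i,d_i-1}u^{d_i-1}+\cdots+b_{i,0}$ be the minimal polynomial of $\alpha_i$ over $\mathfrak k(\alpha_1,\ldots,\alpha_{i-1})$, and choose finitely many $a_{s,t}\in CS$ and exponents $j_k(s,t)\in\mathbb N$ ($0\le t<d_i$, $1\le s\le\lambda_t$, $0\le k\le i-1$) with $j_k(s,t)<n_k$ for $k\ge1$, $\nu(P_0^{j_0(s,t)}\cdots P_{i-1}^{j_{i-1}(s,t)}P_i^{t\overline n_i})=n_i\nu(P_i)$ for all $s,t$, and $b_{i,t}=\left[\sum_{s}a_{s,t}P_0^{j_0(s,t)}\cdots P_{i-1}^{j_{i-1}(s,t)}/U_i^{d_i-t}\right]$ for $0\le t\le d_i-1$; then set $$P_{i+1}=P_i^{n_i}+\sum_{t=0}^{d_i-1}\Big(\sum_{s=1}^{\lambda_t}a_{s,t}P_0^{j_0(s,t)}\cdots P_{i-1}^{j_{i-1}(s,t)}\Big)P_i^{t\overline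 n_i}.$$ Such choices are always possible. If the procedure never stops, $\Omega=\infty$. The sequence is $(P_i)_{0\le i\le\Omega}$ if $\Omega<\infty$ and $(P_i)_{i\ge0}$ if $\Omega=\infty$. *)

theory Defs
  imports "HOL-Algebra.Algebra" "HOL-Library.Extended_Nat"
begin

text \<open>
  Conventions. The quotient field is a field \<open>K\<close> of HOL-Algebra, and the ring \<open>R\<close> is a set
  \<open>R \<subseteq> carrier K\<close>, regarded as a ring with the operations of \<open>K\<close>. A valuation is a function
  \<open>\<nu> :: 'a \<Rightarrow> 'g\<close> into an arbitrary linearly ordered abelian group; its value at \<open>\<zero>\<close> is
  irrelevant, and \<open>\<nu>(\<zero>) = \<infinity>\<close> is rendered by treating \<open>\<zero>\<close> separately.
  Quantities that may be infinite (\<open>\<Omega>\<close>, indices, degrees) have type \<^typ>\<open>enat\<close>.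
\<close>

abbreviation with_carrier :: "('a, 'b) ring_scheme \<Rightarrow> 'a set \<Rightarrow> ('a, 'b) ring_scheme" where
  "with_carrier K R \<equiv> K\<lparr>carrier := R\<rparr>"

definition ecard :: "'a set \<Rightarrow> enat" where
  "ecard A = (if finite A then enat (card A) else \<infinity>)"


section \<open>Regular local rings\<close>

definition krull_dim :: "('a, 'b) ring_scheme \<Rightarrow> enat" where
  "krull_dim S = (SUP n \<in> {n. \<exists>Q :: nat \<Rightarrow> 'a set.
      (\<forall>i\<le>n. primeideal (Q i) S) \<and> (\<forall>i<n. Q i \<subset> Q (Suc i))}. enat n)"

definition local_ring :: "('a, 'b) ring_scheme \<Rightarrow> 'a set \<Rightarrow> bool" where
  "local_ring S m \<longleftrightarrow> cring S \<and> maximalideal m S \<and> (\<forall>J. maximalideal J S \<longrightarrow> J = m)"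

definition min_num_gens :: "('a, 'b) ring_scheme \<Rightarrow> 'a set \<Rightarrow> nat" where
  "min_num_gens S I =
     (LEAST n. \<exists>A \<subseteq> carrier S. finite A \<and> card A = n \<and> I = genideal S A)"

definition regular_local_ring :: "('a, 'b) ring_scheme \<Rightarrow> 'a set \<Rightarrow> bool" where
  "regular_local_ring S m \<longleftrightarrow>
     local_ring S m \<and> noetherian_ring S \<and> enat (min_num_gens S m) = krull_dim S"

definition coefficient_set :: "('a, 'b) ring_scheme \<Rightarrow> 'a set \<Rightarrow> 'a set \<Rightarrow> bool" where
  "coefficient_set S m CS \<longleftrightarrow>
     CS \<subseteq> carrier S \<and> \<zero>\<^bsub>S\<^esub> \<in> CS \<and> \<one>\<^bsub>S\<^esub> \<in> CS \<and>
     bij_betw (\<lambda>a. m +>\<^bsub>S\<^esub> a) CS (carrier (S Quot m))"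

definition quotient_field :: "('a, 'b) ring_scheme \<Rightarrow> 'a set \<Rightarrow> bool" where
  "quotient_field K R \<longleftrightarrow>
     field K \<and> subring R K \<and>
     (\<forall>z \<in> carrier K. \<exists>a \<in> R. \<exists>b \<in> R - {\<zero>\<^bsub>K\<^esub>}. z = a \<otimes>\<^bsub>K\<^esub> inv\<^bsub>K\<^esub> b)"


section \<open>Valuations\<close>

definition add_group :: "'g::ab_group_add monoid" where
  "add_group = \<lparr>carrier = UNIV, monoid.mult = (+), monoid.one = 0\<rparr>"

definition nmul :: "nat \<Rightarrow> 'g::ab_group_add \<Rightarrow> 'g" where
  "nmul n g = (\<Sum>k<n. g)"

definition group_index :: "('g, 'c) monoid_scheme \<Rightarrow> 'g set \<Rightarrow> enat" where
  "group_index G H = ecard (rcosets\<^bsub>G\<^esub> H)"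

definition valuation :: "('a, 'b) ring_scheme \<Rightarrow> ('a \<Rightarrow> 'g::linordered_ab_group_add) \<Rightarrow> bool" where
  "valuation K \<nu> \<longleftrightarrow>
     (\<forall>a \<in> carrier K - {\<zero>\<^bsub>K\<^esub>}. \<forall>b \<in> carrier K - {\<zero>\<^bsub>K\<^esub>}.
        \<nu> (a \<otimes>\<^bsub>K\<^esub> b) = \<nu> a + \<nu> b \<and>
        (a \<oplus>\<^bsub>K\<^esub> b \<noteq> \<zero>\<^bsub>K\<^esub> \<longrightarrow> min (\<nu> a) (\<nu> b) \<le> \<nu> (a \<oplus>\<^bsub>K\<^esub> b)))"

definition value_group :: "('a, 'b) ring_scheme \<Rightarrow> ('a \<Rightarrow> 'g) \<Rightarrow> 'g set" where
  "value_group K \<nu> = \<nu> ` (carrier K - {\<zero>\<^bsub>K\<^esub>})"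

definition isolated_subgroup :: "'g::linordered_ab_group_add set \<Rightarrow> 'g set \<Rightarrow> bool" where
  "isolated_subgroup \<Gamma> H \<longleftrightarrow>
     subgroup H add_group \<and> H \<subseteq> \<Gamma> \<and> (\<forall>h \<in> H. \<forall>g \<in> \<Gamma>. 0 \<le> g \<and> g \<le> h \<longrightarrow> g \<in> H)"

definition valuation_rank ::
  "('a, 'b) ring_scheme \<Rightarrow> ('a \<Rightarrow> 'g::linordered_ab_group_add) \<Rightarrow> enat" where
  "valuation_rank K \<nu> =
     ecard {H. isolated_subgroup (value_group K \<nu>) H \<and> H \<noteq> value_group K \<nu>}"

definition val_ring :: "('a, 'b) ring_scheme \<Rightarrow> ('a \<Rightarrow> 'g::linordered_ab_group_add) \<Rightarrow> 'a set" where
  "val_ring K \<nu> = {f \<in> carrier K. f = \<zero>\<^bsub>K\<^esub> \<or> 0 \<le> \<nu> f}"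

definition val_ideal :: "('a, 'b) ring_scheme \<Rightarrow> ('a \<Rightarrow> 'g::linordered_ab_group_add) \<Rightarrow> 'a set" where
  "val_ideal K \<nu> = {f \<in> carrier K. f = \<zero>\<^bsub>K\<^esub> \<or> 0 < \<nu> f}"

definition dominates ::
  "('a, 'b) ring_scheme \<Rightarrow> ('a \<Rightarrow> 'g::linordered_ab_group_add) \<Rightarrow> 'a set \<Rightarrow> 'a set \<Rightarrow> bool" where
  "dominates K \<nu> R m \<longleftrightarrow> R \<subseteq> val_ring K \<nu> \<and> val_ideal K \<nu> \<inter> R = m"

definition res_field ::
  "('a, 'b) ring_scheme \<Rightarrow> ('a \<Rightarrow> 'g::linordered_ab_group_add) \<Rightarrow> 'a set ring" where
  "res_field K \<nu> = with_carrier K (val_ring K \<nu>) Quot val_ideal K \<nu>"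

definition res :: "('a, 'b) ring_scheme \<Rightarrow> ('a \<Rightarrow> 'g::linordered_ab_group_add) \<Rightarrow> 'a \<Rightarrow> 'a set" where
  "res K \<nu> f = val_ideal K \<nu> +>\<^bsub>with_carrier K (val_ring K \<nu>)\<^esub> f"

text \<open>\<open>\<nu>(I)\<close>; for an ideal \<open>I \<noteq> 0\<close> of a noetherian ring dominated by \<open>\<nu>\<close> the minimum exists.\<close>

definition ideal_value ::
  "('a, 'b) ring_scheme \<Rightarrow> ('a \<Rightarrow> 'g::linordered_ab_group_add) \<Rightarrow> 'a set \<Rightarrow> 'g" where
  "ideal_value K \<nu> I = (LEAST v. v \<in> \<nu> ` (I - {\<zero>\<^bsub>K\<^esub>}))"

definition value_semigroup :: "('a, 'b) ring_scheme \<Rightarrow> ('a \<Rightarrow> 'g) \<Rightarrow> 'a set \<Rightarrow> 'g set" where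
  "value_semigroup K \<nu> R = \<nu> ` (R - {\<zero>\<^bsub>K\<^esub>})"

definition nat_combinations :: "'g::ab_group_add set \<Rightarrow> 'g set" where
  "nat_combinations G = {\<Sum>g\<in>T. nmul (c g) g | T c. finite T \<and> T \<subseteq> G}"

definition minimally_generates :: "('a set \<Rightarrow> 'a set) \<Rightarrow> 'a set \<Rightarrow> 'a set \<Rightarrow> bool" where
  "minimally_generates gen G A \<longleftrightarrow> gen G = A \<and> (\<forall>G'. G' \<subset> G \<longrightarrow> gen G' \<noteq> A)"


section \<open>The associated graded ring\<close>

definition P_ge ::
  "('a, 'b) ring_scheme \<Rightarrow> ('a \<Rightarrow> 'g::linordered_ab_group_add) \<Rightarrow> 'a set \<Rightarrow> 'g \<Rightarrow> 'a set" where
  "P_ge K \<nu> R \<phi> = {f \<in> R. f = \<zero>\<^bsub>K\<^esub> \<or> \<phi> \<le> \<nu> f}"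

definition P_gt ::
  "('a, 'b) ring_scheme \<Rightarrow> ('a \<Rightarrow> 'g::linordered_ab_group_add) \<Rightarrow> 'a set \<Rightarrow> 'g \<Rightarrow> 'a set" where
  "P_gt K \<nu> R \<phi> = {f \<in> R. f = \<zero>\<^bsub>K\<^esub> \<or> \<phi> < \<nu> f}"

text \<open>
  Both \<open>P_ge\<close> and \<open>P_gt\<close> are ideals of \<open>R\<close>, so \<open>P_ge / P_gt\<close> is a subgroup of
  \<open>R Quot P_gt\<close>, the group in which the degree \<open>\<phi>\<close> components are added.
\<close>

definition gr_quot ::
  "('a, 'b) ring_scheme \<Rightarrow> ('a \<Rightarrow> 'g::linordered_ab_group_add) \<Rightarrow> 'a set \<Rightarrow> 'g \<Rightarrow> 'a set ring" where
  "gr_quot K \<nu> R \<phi> = with_carrier K R Quot P_gt K \<nu> R \<phi>"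

definition gr_component ::
  "('a, 'b) ring_scheme \<Rightarrow> ('a \<Rightarrow> 'g::linordered_ab_group_add) \<Rightarrow> 'a set \<Rightarrow> 'g \<Rightarrow> 'a set set" where
  "gr_component K \<nu> R \<phi> =
     (\<lambda>f. P_gt K \<nu> R \<phi> +>\<^bsub>with_carrier K R\<^esub> f) ` P_ge K \<nu> R \<phi>"

definition gr_hom ::
  "('a, 'b) ring_scheme \<Rightarrow> ('a \<Rightarrow> 'g::linordered_ab_group_add) \<Rightarrow> 'a set \<Rightarrow>
   'g \<Rightarrow> 'a set \<Rightarrow> ('g \<Rightarrow> 'a set)" where
  "gr_hom K \<nu> R \<phi> c =
     (\<lambda>\<psi>\<in>value_group K \<nu>. if \<psi> = \<phi> then c else P_gt K \<nu> R \<psi>)"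

definition in_val ::
  "('a, 'b) ring_scheme \<Rightarrow> ('a \<Rightarrow> 'g::linordered_ab_group_add) \<Rightarrow> 'a set \<Rightarrow> 'a \<Rightarrow> ('g \<Rightarrow> 'a set)"
  where
  "in_val K \<nu> R f =
     gr_hom K \<nu> R (\<nu> f) (P_gt K \<nu> R (\<nu> f) +>\<^bsub>with_carrier K R\<^esub> f)"

text \<open>
  Elements of the direct sum are finitely supported families of cosets indexed by the value
  group; the zero of the component of degree \<open>\<phi>\<close> is the coset \<open>P_gt K \<nu> R \<phi>\<close>. The product of
  \<open>a + P_gt \<psi>\<close> and \<open>b + P_gt \<chi>\<close> is \<open>a b + P_gt (\<psi> + \<chi>)\<close>.
\<close>

definition gr_ring ::
  "('a, 'b) ring_scheme \<Rightarrow> ('a \<Rightarrow> 'g::linordered_ab_group_add) \<Rightarrow> 'a set \<Rightarrow> ('g \<Rightarrow> 'a set) ring"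
  where
  "gr_ring K \<nu> R =
    \<lparr>carrier = {F \<in> Pi\<^sub>E (value_group K \<nu>) (gr_component K \<nu> R).
        finite {\<phi> \<in> value_group K \<nu>. F \<phi> \<noteq> P_gt K \<nu> R \<phi>}},
     monoid.mult = (\<lambda>F G. \<lambda>\<phi>\<in>value_group K \<nu>.
        finsum (gr_quot K \<nu> R \<phi>)
          (\<lambda>\<psi>. rcoset_mult (with_carrier K R) (P_gt K \<nu> R \<phi>) (F \<psi>) (G (\<phi> - \<psi>)))
          {\<psi> \<in> value_group K \<nu>. F \<psi> \<noteq> P_gt K \<nu> R \<psi> \<and> G (\<phi> - \<psi>) \<noteq> P_gt K \<nu> R (\<phi> - \<psi>)}),
     monoid.one = in_val K \<nu> R \<one>\<^bsub>K\<^esub>,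
     ring.zero = (\<lambda>\<phi>\<in>value_group K \<nu>. P_gt K \<nu> R \<phi>),
     ring.add = (\<lambda>F G. \<lambda>\<phi>\<in>value_group K \<nu>. F \<phi> \<oplus>\<^bsub>gr_quot K \<nu> R \<phi>\<^esub> G \<phi>)\<rparr>"

text \<open>
  If \<open>\<nu>\<close> dominates \<open>R\<close> then \<open>P_ge 0 = R\<close> and \<open>P_gt 0 = m\<close>, so that the residue field \<open>R/m\<close> is
  the component of degree \<open>0\<close>; this is the algebra structure of the graded ring.
\<close>

definition gr_scalars ::
  "('a, 'b) ring_scheme \<Rightarrow> ('a \<Rightarrow> 'g::linordered_ab_group_add) \<Rightarrow> 'a set \<Rightarrow> 'a set \<Rightarrow>
   ('g \<Rightarrow> 'a set) set" where
  "gr_scalars K \<nu> R m = gr_hom K \<nu> R 0 ` carrier (with_carrier K R Quot m)"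

definition generate_algebra :: "('a, 'b) ring_scheme \<Rightarrow> 'a set \<Rightarrow> 'a set \<Rightarrow> 'a set" where
  "generate_algebra A k G = generate_ring A (k \<union> G)"


section \<open>Generating sequences\<close>

definition field_degree :: "('a, 'b) ring_scheme \<Rightarrow> 'a set \<Rightarrow> 'a set \<Rightarrow> enat" where
  "field_degree L E F =
     (if ring.finite_dimension L F E then enat (ring.dim L F E) else \<infinity>)"

text \<open>
  \<open>R/m\<close> is identified with its image in the residue field of \<open>\<nu>\<close>; \<open>adjoined K \<nu> R A\<close> is
  \<open>(R/m)(A)\<close>.
\<close>

definition adjoined ::
  "('a, 'b) ring_scheme \<Rightarrow> ('a \<Rightarrow> 'g::linordered_ab_group_add) \<Rightarrow> 'a set \<Rightarrow> 'a set set \<Rightarrow> 'a set set"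
  where
  "adjoined K \<nu> R A = generate_field (res_field K \<nu>) (res K \<nu> ` R \<union> A)"

definition power_product :: "('a, 'b) ring_scheme \<Rightarrow> (nat \<Rightarrow> 'a) \<Rightarrow> nat \<Rightarrow> (nat \<Rightarrow> nat) \<Rightarrow> 'a" where
  "power_product K P i w = finprod K (\<lambda>k. P k [^]\<^bsub>K\<^esub> w k) {..<i}"

definition coeff_sum ::
  "('a, 'b) ring_scheme \<Rightarrow> (nat \<Rightarrow> 'a) \<Rightarrow> nat \<Rightarrow> nat \<Rightarrow> (nat \<Rightarrow> 'a) \<Rightarrow> (nat \<Rightarrow> nat \<Rightarrow> nat) \<Rightarrow> 'a" where
  "coeff_sum K P i l a j =
     finsum K (\<lambda>s. a s \<otimes>\<^bsub>K\<^esub> power_product K P i (\<lambda>k. j k s)) {1..l}"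

text \<open>
  The step from \<open>P 0, \<dots>, P i\<close> to \<open>P (i + 1)\<close>, with the exponents \<open>w\<close> of \<open>U\<close>, numbers of summands
  \<open>l t\<close>, coefficients \<open>a s t\<close> and exponents \<open>j k s t\<close>. Here \<open>nb\<close> stands for the sequence of the
  indices; \<open>n k\<close> is finite for all \<open>1 \<le> k < i\<close>.
\<close>

definition generating_step ::
  "('a, 'b) ring_scheme \<Rightarrow> ('a \<Rightarrow> 'g::linordered_ab_group_add) \<Rightarrow> 'a set \<Rightarrow> 'a set \<Rightarrow>
   enat \<Rightarrow> (nat \<Rightarrow> 'a) \<Rightarrow> (nat \<Rightarrow> enat) \<Rightarrow> (nat \<Rightarrow> enat) \<Rightarrow> (nat \<Rightarrow> enat) \<Rightarrow> (nat \<Rightarrow> 'a set) \<Rightarrow>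
   nat \<Rightarrow> bool" where
  "generating_step K \<nu> R CS \<Omega> P nb d n \<alpha> i \<longleftrightarrow>
     nb i = group_index (subgroup_generated add_group ((\<lambda>k. \<nu> (P k)) ` {0..i}))
                        (generate add_group ((\<lambda>k. \<nu> (P k)) ` {0..<i})) \<and>
     (if nb i = \<infinity> then \<Omega> = enat i \<and> \<alpha> i = \<one>\<^bsub>res_field K \<nu>\<^esub> \<and> d i = 1 \<and> n i = \<infinity>
      else \<exists>e w U F. nb i = enat e \<and> U = power_product K P i w \<and> F = adjoined K \<nu> R (\<alpha> ` {1..<i}) \<and>
        (\<forall>k \<in> {1..<i}. enat (w k) < n k) \<and>
        \<nu> U = nmul e (\<nu> (P i)) \<and>
        \<alpha> i = res K \<nu> (P i [^]\<^bsub>K\<^esub> e \<otimes>\<^bsub>K\<^esub> inv\<^bsub>K\<^esub> U) \<and>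
        d i = field_degree (res_field K \<nu>) (adjoined K \<nu> R (\<alpha> ` {1..i})) F \<and>
        (if d i = \<infinity> then \<Omega> = enat i \<and> n i = \<infinity>
         else enat i < \<Omega> \<and> n i = nb i * d i \<and>
           (\<exists>D l a j. d i = enat D \<and>
             (\<forall>t<D. \<forall>s \<in> {1..l t}.
                a s t \<in> CS \<and>
                (\<forall>k \<in> {1..<i}. enat (j k s t) < n k) \<and>
                \<nu> (power_product K P i (\<lambda>k. j k s t) \<otimes>\<^bsub>K\<^esub> P i [^]\<^bsub>K\<^esub> (t * e))
                  = nmul (e * D) (\<nu> (P i))) \<and>
             (\<forall>t<D. ring.coeff (res_field K \<nu>) (ring.Irr (res_field K \<nu>) F (\<alpha> i)) t =
                res K \<nu> (coeff_sum K P i (l t) (\<lambda>s. a s t) (\<lambda>k s. j k s t)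
                           \<otimes>\<^bsub>K\<^esub> inv\<^bsub>K\<^esub> (U [^]\<^bsub>K\<^esub> (D - t)))) \<and>
             P (Suc i) = P i [^]\<^bsub>K\<^esub> (e * D) \<oplus>\<^bsub>K\<^esub>
               finsum K (\<lambda>t. coeff_sum K P i (l t) (\<lambda>s. a s t) (\<lambda>k s. j k s t)
                               \<otimes>\<^bsub>K\<^esub> P i [^]\<^bsub>K\<^esub> (t * e)) {..<D})))"

text \<open>The values \<open>P i\<close> for \<open>i > \<Omega>\<close>, and \<open>nb\<close>, \<open>d\<close>, \<open>n\<close>, \<open>\<alpha>\<close> outside \<open>1 \<le> i \<le> \<Omega>\<close>, are arbitrary.\<close>

definition generating_sequence ::
  "('a, 'b) ring_scheme \<Rightarrow> ('a \<Rightarrow> 'g::linordered_ab_group_add) \<Rightarrow> 'a set \<Rightarrow> 'a set \<Rightarrow> 'a \<Rightarrow> 'a \<Rightarrow>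
   enat \<Rightarrow> (nat \<Rightarrow> 'a) \<Rightarrow> (nat \<Rightarrow> enat) \<Rightarrow> (nat \<Rightarrow> enat) \<Rightarrow> (nat \<Rightarrow> enat) \<Rightarrow> (nat \<Rightarrow> 'a set) \<Rightarrow> bool"
  where
  "generating_sequence K \<nu> R CS x y \<Omega> P nb d n \<alpha> \<longleftrightarrow>
     P 0 = x \<and> P 1 = y \<and> 1 \<le> \<Omega> \<and>
     (\<forall>i\<ge>1. enat i \<le> \<Omega> \<longrightarrow> generating_step K \<nu> R CS \<Omega> P nb d n \<alpha> i)"

end

theory Submission
  imports Defs
begin

text \<open>
  Call a monomial in the \<open>P\<^sub>i\<close> reduced if its exponent at \<open>P\<^sub>k\<close> is less than \<open>n\<^sub>k\<close> for all \<open>k \<ge> 1\<close>.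
  The residue of \<open>P\<^sub>i\<^sub>+\<^sub>1\<close> divided by the \<open>d\<^sub>i\<close>-th power of \<open>U\<^sub>i\<close> is the minimal polynomial of
  \<open>\<alpha>\<^sub>i\<close> evaluated at \<open>\<alpha>\<^sub>i\<close>, so \<open>\<nu>(P\<^sub>i\<^sub>+\<^sub>1) > n\<^sub>i \<nu>(P\<^sub>i)\<close>. It follows that \<open>x\<close> divides all terms of
  \<open>P\<^sub>i\<^sub>+\<^sub>1\<close> but the first, so \<open>P\<^sub>i\<close> is congruent modulo \<open>x\<close> to a power of \<open>y\<close>; since no power
  of \<open>y\<close> is a multiple of \<open>x\<close> in dimension two, \<open>P\<^sub>i \<noteq> 0\<close>. As every power of \<open>y\<close> is congruent modulo
  \<open>x\<close> to a reduced monomial, or else to a multiple of some \<open>P\<^sub>i\<close> of large value, every element of \<open>R\<close>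
  is, up to terms of arbitrarily large value, a combination of distinct reduced monomials with
  coefficients in \<open>CS\<close>. Distinct reduced monomials of the same value cannot cancel, because
  \<open>1, \<alpha>\<^sub>i, \<alpha>\<^sub>i\<^sup>2, \<dots>\<close> are independent over \<open>\<kappa>(\<alpha>\<^sub>1, \<dots>, \<alpha>\<^sub>i\<^sub>-\<^sub>1)\<close> up to degree \<open>d\<^sub>i\<close>. Hence the initial
  form of each element of \<open>R\<close> is a combination of initial forms of reduced monomials, which gives
  generation in all three parts. For minimality, in degree \<open>\<nu>(P\<^sub>i)\<close> the remaining
  generators produce only values in the group of \<open>P\<^sub>0, \<dots>, P\<^sub>i\<^sub>-\<^sub>1\<close> and residues in
  \<open>\<kappa>(\<alpha>\<^sub>1, \<dots>, \<alpha>\<^sub>i\<^sub>-\<^sub>1)\<close>.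
\<close>

section \<open>Local rings and a case of the principal ideal theorem\<close>

text \<open>A remainder may be dropped only if its value exceeds that of the element being expanded.
  Expanding modulo a power of \<open>x\<close> and a power of one \<open>P l\<close> achieves this:
  multiples of a positive value are unbounded since the rank is one, and if the sequence stops, the
  last \<open>n l\<close> is \<infinity>, so any exponent of \<open>P l\<close> is allowed. If it
  does not stop, exponents are limited by \<open>n l\<close>, and the values of the
  \<open>P l\<close> themselves must be shown to be unbounded. The condition on \<nu>(x) is used as
  \<nu>(x) \<le> \<nu>(y). It bounds the degree of \<open>P l\<close> modulo \<open>x\<close> by
  means of its value, and it leaves \<open>y\<close> as the only generator that can share the value
  of \<open>x\<close>; this tie is the one case of minimality in which a later generator competes.
  Leading parts are compared through residues of quotients by a common denominator. Denominators are
  Laurent monomials in an initial part of the sequence, and the field of residues considered always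
  contains the residues of all such monomials of value zero, so that membership in it does not
  depend on the denominator.\<close>

lemma (in cring) proper_ideal_in_maximal:
  assumes "ideal I R" "\<one> \<notin> I"
  obtains M where "maximalideal M R" "I \<subseteq> M"
proof -
  define A where "A = {J. ideal J R \<and> I \<subseteq> J \<and> \<one> \<notin> J}"
  have "\<exists>M\<in>A. \<forall>J\<in>A. M \<subseteq> J \<longrightarrow> J = M"
  proof (rule subset_Zorn_nonempty)
    show "A \<noteq> {}" using assms by (auto simp: A_def)
  next
    fix C assume C: "C \<noteq> {}" "subset.chain A C"
    then have "subset.chain {J. ideal J R} C"
      by (auto simp: A_def pred_on.chain_def)
    from chain_Union_is_ideal[OF this] C(1) have "ideal (\<Union>C) R" by simp
    then show "\<Union>C \<in> A"
      using C by (auto simp: A_def pred_on.chain_def)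
  qed
  then obtain M where M: "M \<in> A" "\<And>J. J \<in> A \<Longrightarrow> M \<subseteq> J \<Longrightarrow> J = M" by blast
  have "maximalideal M R"
  proof (rule maximalidealI)
    show "ideal M R" using M by (simp add: A_def)
    show "carrier R \<noteq> M" using M by (auto simp: A_def)
    fix J assume J: "ideal J R" "M \<subseteq> J" "J \<subseteq> carrier R"
    show "J = M \<or> J = carrier R"
    proof (cases "\<one> \<in> J")
      case True
      then show ?thesis using ideal.one_imp_carrier[OF J(1)] by simp
    next
      case False
      then show ?thesis using M J by (auto simp: A_def)
    qed
  qed
  with that M show ?thesis by (auto simp: A_def)
qed

lemma local_ring_Units:
  assumes "local_ring S m" "a \<in> carrier S" "a \<notin> m"
  shows "a \<in> Units S"
proof -
  interpret cring S using assms by (simp add: local_ring_def)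
  have "\<one>\<^bsub>S\<^esub> \<in> PIdl\<^bsub>S\<^esub> a"
  proof (rule ccontr)
    assume "\<one>\<^bsub>S\<^esub> \<notin> PIdl\<^bsub>S\<^esub> a"
    then obtain M where "maximalideal M S" "PIdl\<^bsub>S\<^esub> a \<subseteq> M"
      using proper_ideal_in_maximal[OF cgenideal_ideal] assms by blast
    then have "a \<in> m" using assms cgenideal_self by (auto simp: local_ring_def)
    with assms show False by simp
  qed
  then obtain r where "r \<in> carrier S" "\<one>\<^bsub>S\<^esub> = r \<otimes>\<^bsub>S\<^esub> a"
    by (auto simp: cgenideal_def)
  then show ?thesis using assms m_comm by (auto simp: Units_def)
qed

lemma local_ring_ideal_subset:
  assumes "local_ring S m" "ideal I S" "I \<noteq> carrier S"
  shows "I \<subseteq> m"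
proof -
  interpret cring S using assms by (simp add: local_ring_def)
  interpret ideal I S by fact
  have "\<one>\<^bsub>S\<^esub> \<notin> I" using assms one_imp_carrier by blast
  then show ?thesis
    using proper_ideal_in_maximal[OF assms(2)] assms(1) by (metis local_ring_def)
qed

lemma (in cring) genideal_pair:
  assumes "x \<in> carrier R" "y \<in> carrier R"
  shows "Idl {x, y} = {a \<otimes> x \<oplus> b \<otimes> y | a b. a \<in> carrier R \<and> b \<in> carrier R}" (is "_ = ?J")
proof
  have J: "ideal ?J R"
  proof (rule idealI[OF ring_axioms])
    show "subgroup ?J (add_monoid R)"
    proof
      show "?J \<subseteq> carrier (add_monoid R)" using assms by auto
      have "\<zero> = \<zero> \<otimes> x \<oplus> \<zero> \<otimes> y" using assms by simp
      then show "\<one>\<^bsub>add_monoid R\<^esub> \<in> ?J" by auto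
    next
      fix u v assume "u \<in> ?J" "v \<in> ?J"
      then obtain a b c d where *: "u = a \<otimes> x \<oplus> b \<otimes> y" "v = c \<otimes> x \<oplus> d \<otimes> y"
        "a \<in> carrier R" "b \<in> carrier R" "c \<in> carrier R" "d \<in> carrier R" by auto
      have "u \<oplus> v = (a \<oplus> c) \<otimes> x \<oplus> (b \<oplus> d) \<otimes> y"
        unfolding * using *(3-) assms by algebra
      then show "u \<otimes>\<^bsub>add_monoid R\<^esub> v \<in> ?J" using * by auto
    next
      fix u assume "u \<in> ?J"
      then obtain a b where *: "u = a \<otimes> x \<oplus> b \<otimes> y" "a \<in> carrier R" "b \<in> carrier R" by auto
      have "\<ominus> u = (\<ominus> a) \<otimes> x \<oplus> (\<ominus> b) \<otimes> y"
        unfolding * using *(2-) assms by algebra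
      then show "inv\<^bsub>add_monoid R\<^esub> u \<in> ?J" using * by (auto simp flip: a_inv_def)
    qed
  next
    fix u r assume "u \<in> ?J" and r: "r \<in> carrier R"
    then obtain a b where *: "u = a \<otimes> x \<oplus> b \<otimes> y" "a \<in> carrier R" "b \<in> carrier R" by auto
    have "r \<otimes> u = (r \<otimes> a) \<otimes> x \<oplus> (r \<otimes> b) \<otimes> y"
      unfolding * using *(2-) assms r by algebra
    then show 1: "r \<otimes> u \<in> ?J" using * r by auto
    have "u \<otimes> r = r \<otimes> u" using * assms r by (simp add: m_comm)
    with 1 show "u \<otimes> r \<in> ?J" by simp
  qed
  have "x = \<one> \<otimes> x \<oplus> \<zero> \<otimes> y" "y = \<zero> \<otimes> x \<oplus> \<one> \<otimes> y" using assms by simp_all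
  then have "{x, y} \<subseteq> ?J" by blast
  then show "Idl {x, y} \<subseteq> ?J" using genideal_minimal[OF J] by simp
  have I: "ideal (Idl {x, y}) R" using genideal_ideal assms by simp
  interpret I: ideal "Idl {x, y}" R by fact
  show "?J \<subseteq> Idl {x, y}"
    using I.I_l_closed I.a_closed genideal_self[of "{x, y}"] assms by auto
qed

lemma (in noetherian_ring) ideal_seq_stabilizes:
  assumes "\<And>j::nat. ideal (J j) R" "\<And>j. J j \<subseteq> J (Suc j)"
  obtains j where "J (Suc j) = J j"
proof -
  have mono: "i \<le> j \<Longrightarrow> J i \<subseteq> J j" for i j
    by (rule lift_Suc_mono_le[of J]) (use assms in auto)
  have "\<Union>(range J) \<in> range J"
  proof (rule ideal_chain_is_trivial)
    show "subset.chain {I. ideal I R} (range J)"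
      unfolding subset_chain_def
    proof (intro conjI ballI)
      show "range J \<subseteq> {I. ideal I R}" using assms(1) by blast
      fix U V assume "U \<in> range J" "V \<in> range J"
      then obtain a b where "U = J a" "V = J b" by blast
      then show "U \<subseteq> V \<or> V \<subseteq> U" using mono[of a b] mono[of b a] linear[of a b] by blast
    qed
  qed simp
  then obtain j where "\<Union>(range J) = J j" by blast
  then have "J (Suc j) \<subseteq> J j" by blast
  with assms(2) that show ?thesis by blast
qed

lemma bounded_mono_nat_stabilizes:
  fixes e :: "nat \<Rightarrow> nat"
  assumes "\<And>k. e k \<le> e (Suc k)" "\<And>k. e k \<le> n"
  obtains k where "e (Suc k) = e k"
proof (rule ccontr)
  assume "\<not> thesis"
  with that assms(1) have "e k < e (Suc k)" for k
    by (metis le_neq_implies_less)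
  then have "k \<le> e k" for k
    by (induction k) (auto intro: less_le_trans Suc_leI le_less_trans)
  from this[of "Suc n"] assms(2)[of "Suc n"] show False by simp
qed

text \<open>This is the contraction to the ring of the ideal generated by \<open>z\<close> in the
  localization at \<open>p\<close>; denominators are cleared so that no localization has to be
  formed. For a power of \<open>z\<close> it takes the place of a symbolic power.\<close>

lemma (in domain) saturation_ideal:
  assumes "primeideal p R" "z \<in> carrier R"
  shows "ideal {f \<in> carrier R. \<exists>s \<in> carrier R - p. \<exists>r \<in> carrier R. s \<otimes> f = z \<otimes> r} R" (is "ideal ?I R")
proof (rule idealI[OF ring_axioms])
  interpret p: primeideal p R by fact
  have one: "\<one> \<in> carrier R - p" using p.one_imp_carrier p.I_notcarr by auto
  have mult: "s \<otimes> t \<in> carrier R - p" if "s \<in> carrier R - p" "t \<in> carrier R - p" for s t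
    using that p.I_prime by auto
  show "subgroup ?I (add_monoid R)"
  proof
    show "?I \<subseteq> carrier (add_monoid R)" by auto
    show "\<one>\<^bsub>add_monoid R\<^esub> \<in> ?I" using one assms(2)
      by (auto intro!: bexI[of _ \<one>] bexI[of _ \<zero>])
  next
    fix f g assume "f \<in> ?I" "g \<in> ?I"
    then obtain s t a b where *: "f \<in> carrier R" "g \<in> carrier R" "s \<in> carrier R - p" "t \<in> carrier R - p"
       "a \<in> carrier R" "b \<in> carrier R" "s \<otimes> f = z \<otimes> a" "t \<otimes> g = z \<otimes> b" by auto
    have "(s \<otimes> t) \<otimes> (f \<oplus> g) = t \<otimes> (s \<otimes> f) \<oplus> s \<otimes> (t \<otimes> g)"
      using *(1-4) by simp algebra
    also have "\<dots> = z \<otimes> (t \<otimes> a \<oplus> s \<otimes> b)"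
      unfolding *(7,8) using *(1-6) assms(2) by simp algebra
    finally show "f \<otimes>\<^bsub>add_monoid R\<^esub> g \<in> ?I"
      using * mult[of s t] by (auto simp del: mem_Collect_eq intro!: CollectI bexI[of _ "s \<otimes> t"] bexI[where A = "carrier R" and x = "t \<otimes> a \<oplus> s \<otimes> b"])
  next
    fix f assume "f \<in> ?I"
    then obtain s a where *: "f \<in> carrier R" "s \<in> carrier R - p" 
       "a \<in> carrier R" "s \<otimes> f = z \<otimes> a" by auto
    then have "s \<otimes> (\<ominus> f) = z \<otimes> (\<ominus> a)" using assms(2) by (simp add: r_minus)
    then show "inv\<^bsub>add_monoid R\<^esub> f \<in> ?I"
      using * by (auto simp flip: a_inv_def intro!: bexI[where A = "carrier R - p" and x = s] bexI[where A = "carrier R" and x = "\<ominus> a"])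
  qed
next
  fix f r assume "f \<in> ?I" and r: "r \<in> carrier R"
  then obtain s a where *: "f \<in> carrier R" "s \<in> carrier R" "s \<notin> p"
     "a \<in> carrier R" "s \<otimes> f = z \<otimes> a" by auto
  have "s \<otimes> (r \<otimes> f) = r \<otimes> (s \<otimes> f)" using *(1,2) r by algebra
  also have "\<dots> = z \<otimes> (r \<otimes> a)"
    unfolding *(5) using *(4) assms(2) r by algebra
  finally show 1: "r \<otimes> f \<in> ?I" using * r by auto
  show "f \<otimes> r \<in> ?I" using 1 * r m_comm[of f r] by simp
qed

text \<open>
  A special case of Krull's principal ideal theorem. Otherwise the saturations at a prime \<open>p\<close> of
  height one of the powers of some \<open>z \<in> p\<close> stabilise modulo \<open>x\<close>, hence stabilise
  by Nakayama's lemma, which makes \<open>z\<close> a unit outside \<open>p\<close>.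
\<close>
lemma power_not_in_principal_ideal:
  fixes S (structure)
  assumes "domain S" "noetherian_ring S" "local_ring S m" "1 < krull_dim S"
    and xy: "x \<in> carrier S" "y \<in> carrier S" and m: "m = genideal S {x, y}" and r: "r \<in> carrier S"
  shows "y [^] (n::nat) \<noteq> r \<otimes> x"
proof
  assume eq: "y [^] n = r \<otimes> x"
  interpret domain S by fact
  interpret noetherian_ring S by fact
  note [simp] = xy
  have mset: "m = {a \<otimes> x \<oplus> b \<otimes> y | a b. a \<in> carrier S \<and> b \<in> carrier S}"
    unfolding m by (rule genideal_pair) fact+
  interpret m: maximalideal m S using assms by (simp add: local_ring_def)
  have one_m: "\<one> \<notin> m" using m.one_imp_carrier m.I_notcarr by auto
  obtain N Q where N: "1 < enat N" and Q: "\<And>i. i \<le> N \<Longrightarrow> primeideal (Q i) S"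
    and Qs: "\<And>i. i < N \<Longrightarrow> Q i \<subset> Q (Suc i)"
    using assms(4) unfolding krull_dim_def less_SUP_iff by auto
  from N have N2: "2 \<le> N" by (cases N) (auto simp: one_enat_def)
  \<comment> \<open>The middle member of a chain of three primes: it lies strictly below
    \<open>m\<close> and contains a nonzero element.\<close>
  define p where "p = Q 1"
  interpret p: primeideal p S using Q[of 1] N2 by (simp add: p_def)
  interpret Q0: primeideal "Q 0" S using Q[of 0] N2 by simp
  interpret Q2: primeideal "Q 2" S using Q[of 2] N2 by simp
  have "Q 0 \<subset> p" using Qs[of 0] N2 by (simp add: p_def)
  then obtain z where z: "z \<in> p" "z \<notin> Q 0" by blast
  then have z0: "z \<noteq> \<zero>" using Q0.zero_closed by auto
  have zc [simp]: "z \<in> carrier S" using z p.Icarr by simp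
  have "p \<subset> Q 2" using Qs[of 1] N2 by (simp add: p_def numeral_2_eq_2)
  moreover have "Q 2 \<subseteq> m"
    using local_ring_ideal_subset[OF assms(3)] Q2.is_ideal Q2.I_notcarr by blast
  ultimately have pm: "p \<subset> m" by blast
  have one_p: "\<one> \<notin> p" using p.one_imp_carrier p.I_notcarr by auto
  \<comment> \<open>Otherwise \<open>p\<close> contains \<open>y [^] n\<close>, hence
    \<open>y\<close>, hence all of \<open>m\<close>.\<close>
  have xp: "x \<notin> p"
  proof
    assume "x \<in> p"
    then have 1: "y [^] n \<in> p" unfolding eq using r p.I_l_closed by simp
    have "y [^] k \<in> p \<Longrightarrow> y \<in> p" for k :: nat
    proof (induction k)
      case (Suc k)
      then show ?case using p.I_prime[of "y [^] k" y] by auto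
    qed (use one_p in simp)
    from this[OF 1] have "y \<in> p" .
    with \<open>x \<in> p\<close> have "m \<subseteq> p"
      unfolding m using genideal_minimal[OF p.is_ideal] by simp
    with pm show False by blast
  qed
  define I where "I k = {f \<in> carrier S. \<exists>s \<in> carrier S - p. \<exists>r \<in> carrier S. s \<otimes> f = z [^] k \<otimes> r}" for k :: nat
  have I: "ideal (I k) S" for k
    unfolding I_def by (rule saturation_ideal) (auto simp: p.primeideal)
  note Ic = ideal.Icarr[OF I] note Il = ideal.I_l_closed[OF I]
  note Ia = additive_subgroup.a_closed[OF ideal.axioms(1)[OF I]]
  note I0 = additive_subgroup.zero_closed[OF ideal.axioms(1)[OF I]]
  have Isub: "I (Suc k) \<subseteq> I k" for k
  proof
    fix f assume "f \<in> I (Suc k)"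
    then obtain s a where *: "f \<in> carrier S" "s \<in> carrier S - p" "a \<in> carrier S" "s \<otimes> f = z [^] Suc k \<otimes> a"
      by (auto simp: I_def)
    then have "s \<otimes> f = z [^] k \<otimes> (z \<otimes> a)" by (simp add: m_assoc)
    moreover have "z \<otimes> a \<in> carrier S" using * by simp
    ultimately show "f \<in> I k" unfolding I_def using *(1,2) by blast
  qed
  \<comment> \<open>Modulo \<open>x\<close> every element is a unit times a power of
    \<open>y\<close>, or zero because \<open>y [^] n\<close> is. So the image of \<open>I k\<close>
    modulo \<open>x\<close> is governed by the least power of \<open>y\<close> in it. These
    exponents cannot decrease with \<open>k\<close> and are at most \<open>n\<close>, hence two
    consecutive ones agree.\<close>
  define E where "E k e \<longleftrightarrow> (\<exists>f\<in>I k. \<exists>g\<in>carrier S. f \<oplus> g \<otimes> x = y [^] (e::nat))" for k e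
  have En: "E k n" for k
    unfolding E_def using I0[of k] r eq by (intro bexI[of _ \<zero>] bexI[of _ r]) auto
  define e where "e k = (LEAST e. E k e)" for k
  have Ee: "E k (e k)" for k unfolding e_def using En by (rule LeastI)
  have e_le: "E k j \<Longrightarrow> e k \<le> j" for k j unfolding e_def by (rule Least_le)
  have e_mono: "e k \<le> e (Suc k)" for k
  proof -
    have "E k (e (Suc k))" using Ee[of "Suc k"] Isub[of k] unfolding E_def by blast
    then show ?thesis by (rule e_le)
  qed
  have e_bd: "e k \<le> n" for k by (rule e_le) (rule En)
  obtain k where k: "e (Suc k) = e k"
    using bounded_mono_nat_stabilizes[of e n] e_mono e_bd by metis
  have norm: "(\<exists>e<N. \<exists>u\<in>Units S. \<exists>g\<in>carrier S. f = u \<otimes> y [^] e \<oplus> g \<otimes> x) \<or>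
              (\<exists>h\<in>carrier S. \<exists>g\<in>carrier S. f = h \<otimes> y [^] N \<oplus> g \<otimes> x)" if f: "f \<in> carrier S" for f and N :: nat
  proof (induction N)
    case 0
    have "f = f \<otimes> y [^] (0::nat) \<oplus> \<zero> \<otimes> x" using f by simp
    then show ?case using f by blast
  next
    case (Suc N)
    then show ?case
    proof
      assume "\<exists>e<N. \<exists>u\<in>Units S. \<exists>g\<in>carrier S. f = u \<otimes> y [^] e \<oplus> g \<otimes> x"
      then show ?thesis by (meson less_SucI)
    next
      assume "\<exists>h\<in>carrier S. \<exists>g\<in>carrier S. f = h \<otimes> y [^] N \<oplus> g \<otimes> x"
      then obtain h g where hg: "h \<in> carrier S" "g \<in> carrier S" "f = h \<otimes> y [^] N \<oplus> g \<otimes> x" by blast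
      show ?thesis
      proof (cases "h \<in> m")
        case True
        then obtain a b where ab: "h = a \<otimes> x \<oplus> b \<otimes> y" "a \<in> carrier S" "b \<in> carrier S" using mset by blast
        have yN: "y [^] N \<in> carrier S" by simp
        have "f = b \<otimes> y [^] Suc N \<oplus> (a \<otimes> y [^] N \<oplus> g) \<otimes> x"
          unfolding hg(3) ab(1) nat_pow_Suc using ab(2,3) hg(2) yN xy by algebra
        moreover have "a \<otimes> y [^] N \<oplus> g \<in> carrier S" using ab hg by simp
        ultimately show ?thesis using ab(3) by blast
      next
        case False
        then have "h \<in> Units S" using local_ring_Units[OF assms(3) hg(1)] by simp
        then show ?thesis using hg by blast
      qed
    qed
  qed
  \<comment> \<open>Since the exponents agree, \<open>I k\<close> and \<open>I (Suc k)\<close> have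
    the same image modulo \<open>x\<close>, which yields \<open>g\<close>. Then
    \<open>x \<otimes> h\<close> lies in \<open>I k\<close>, and so does \<open>h\<close> because
    \<open>x\<close> is outside \<open>p\<close>.\<close>
  have key: "\<exists>h\<in>I k. \<exists>g\<in>I (Suc k). f = g \<oplus> x \<otimes> h" if f: "f \<in> I k" for f
  proof -
    have fc: "f \<in> carrier S" using f Ic by blast
    have "\<exists>g\<in>I (Suc k). \<exists>h\<in>carrier S. f = g \<oplus> x \<otimes> h"
      using norm[OF fc, of n]
    proof
      assume "\<exists>h\<in>carrier S. \<exists>g\<in>carrier S. f = h \<otimes> y [^] n \<oplus> g \<otimes> x"
      then obtain h g where *: "h \<in> carrier S" "g \<in> carrier S" "f = h \<otimes> (r \<otimes> x) \<oplus> g \<otimes> x" by (auto simp: eq)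
      have "f = \<zero> \<oplus> x \<otimes> (h \<otimes> r \<oplus> g)"
        unfolding *(3) using *(1,2) r xy by algebra
      then show ?thesis using I0[of "Suc k"] * r by blast
    next
      assume "\<exists>e<n. \<exists>u\<in>Units S. \<exists>g\<in>carrier S. f = u \<otimes> y [^] e \<oplus> g \<otimes> x"
      then obtain j u g where *: "u \<in> Units S" "g \<in> carrier S" "f = u \<otimes> y [^] (j::nat) \<oplus> g \<otimes> x" by blast
      have uc: "u \<in> carrier S" "inv u \<in> carrier S" using *(1) by auto
      have yj: "y [^] j \<in> carrier S" by simp
      have "inv u \<otimes> f \<oplus> \<ominus> (inv u \<otimes> g) \<otimes> x = (inv u \<otimes> u) \<otimes> y [^] j"
        unfolding *(3) using uc yj *(2) xy by algebra
      also have "\<dots> = y [^] j" using *(1) by simp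
      finally have "E k j" unfolding E_def using Il[OF f uc(2)] uc *(2)
        by (intro bexI[of _ "inv u \<otimes> f"] bexI[of _ "\<ominus> (inv u \<otimes> g)"]) auto
      then have "e (Suc k) \<le> j" using e_le k by simp
      obtain f' g' where fg: "f' \<in> I (Suc k)" "g' \<in> carrier S" "f' \<oplus> g' \<otimes> x = y [^] e (Suc k)"
        using Ee[of "Suc k"] unfolding E_def by blast
      have f'c: "f' \<in> carrier S" using fg Ic by blast
      define w where "w = y [^] (j - e (Suc k))"
      have w: "w \<in> carrier S" by (simp add: w_def)
      have "y [^] j = w \<otimes> y [^] e (Suc k)"
        using \<open>e (Suc k) \<le> j\<close> by (simp add: w_def nat_pow_mult)
      also have "\<dots> = w \<otimes> (f' \<oplus> g' \<otimes> x)" by (simp add: fg)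
      finally have "f = (u \<otimes> w) \<otimes> f' \<oplus> x \<otimes> (u \<otimes> w \<otimes> g' \<oplus> g)"
        unfolding *(3) using uc w f'c fg(2) *(2) xy by algebra
      moreover have "(u \<otimes> w) \<otimes> f' \<in> I (Suc k)" using Il fg(1) uc w by simp
      moreover have "u \<otimes> w \<otimes> g' \<oplus> g \<in> carrier S" using uc w fg * by simp
      ultimately show ?thesis by blast
    qed
    then obtain g h where gh: "g \<in> I (Suc k)" "h \<in> carrier S" "f = g \<oplus> x \<otimes> h" by blast
    have gc: "g \<in> carrier S" using gh Ic by blast
    have "x \<otimes> h = f \<oplus> (\<ominus> \<one>) \<otimes> g"
      unfolding gh(3) using gc gh(2) xy by algebra
    moreover have "(\<ominus> \<one>) \<otimes> g \<in> I k" using Il[of g k "\<ominus> \<one>"] gh(1) Isub[of k] by auto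
    ultimately have "x \<otimes> h \<in> I k" using Ia[OF f, of "(\<ominus> \<one>) \<otimes> g"] by simp
    then obtain s a where sa: "s \<in> carrier S - p" "a \<in> carrier S" "s \<otimes> (x \<otimes> h) = z [^] k \<otimes> a"
      by (auto simp: I_def)
    then have "(s \<otimes> x) \<otimes> h = z [^] k \<otimes> a" using gh by (simp add: m_assoc)
    moreover have "s \<otimes> x \<in> carrier S - p" using sa xp p.I_prime[of s x] by auto
    ultimately have "h \<in> I k" unfolding I_def using sa(2) gh(2) by blast
    then show ?thesis using gh by blast
  qed
  then obtain nx where nx: "\<And>f. f \<in> I k \<Longrightarrow> nx f \<in> I k"
    "\<And>f. f \<in> I k \<Longrightarrow> \<exists>g\<in>I (Suc k). f = g \<oplus> x \<otimes> nx f" by metis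
  \<comment> \<open>Nakayama's lemma by an ascending chain: \<open>key\<close> is iterated from
    \<open>z [^] k\<close>, and the ideals generated by \<open>I (Suc k)\<close> and
    \<open>F j\<close> increase with \<open>j\<close>. Once they are stationary,
    \<open>F (Suc j)\<close> times some \<open>1 - u x\<close> lies in \<open>I (Suc k)\<close>.
    That factor is a unit, and membership descends along the chain to
    \<open>z [^] k\<close>.\<close>
  define F where "F j = (nx ^^ j) (z [^] k)" for j
  have "z [^] k \<in> I k"
    using one_p by (auto simp: I_def intro!: bexI[of _ \<one>])
  then have F: "F j \<in> I k" for j
    by (induction j) (auto simp: F_def nx)
  have Fs: "\<exists>g\<in>I (Suc k). F j = g \<oplus> x \<otimes> F (Suc j)" for j
    using nx(2)[OF F[of j]] by (simp add: F_def)
  have Fc [simp]: "F j \<in> carrier S" for j using F Ic by blast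
  define J where "J j = I (Suc k) <+>\<^bsub>S\<^esub> PIdl (F j)" for j
  have Jiff: "f \<in> J j \<longleftrightarrow> (\<exists>g\<in>I (Suc k). \<exists>u\<in>carrier S. f = g \<oplus> u \<otimes> F j)" for f j
    by (auto simp: J_def set_add_def' cgenideal_def)
  have Jid: "ideal (J j) S" for j
    unfolding J_def by (intro add_ideals I cgenideal_ideal Fc)
  have Jmono: "J j \<subseteq> J (Suc j)" for j
  proof
    fix f assume "f \<in> J j"
    then obtain g u where gu: "g \<in> I (Suc k)" "u \<in> carrier S" "f = g \<oplus> u \<otimes> F j" by (auto simp: Jiff)
    obtain g' where g': "g' \<in> I (Suc k)" "F j = g' \<oplus> x \<otimes> F (Suc j)" using Fs by blast
    have c: "g \<in> carrier S" "g' \<in> carrier S" using gu g' Ic by blast+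
    have "f = (g \<oplus> u \<otimes> g') \<oplus> (u \<otimes> x) \<otimes> F (Suc j)"
      unfolding gu(3) g'(2) using gu(2) c xy Fc[of "Suc j"] by algebra
    moreover have "g \<oplus> u \<otimes> g' \<in> I (Suc k)" using gu g' Ia Il by blast
    moreover have "u \<otimes> x \<in> carrier S" using gu by simp
    ultimately show "f \<in> J (Suc j)" unfolding Jiff by blast
  qed
  obtain j where j: "J (Suc j) = J j"
    using ideal_seq_stabilizes[of J] Jid Jmono by metis
  have "F (Suc j) \<in> J (Suc j)" unfolding Jiff
    using I0[of "Suc k"] by (intro bexI[of _ \<zero>] bexI[of _ \<one>]) auto
  then obtain g u where gu: "g \<in> I (Suc k)" "u \<in> carrier S" "F (Suc j) = g \<oplus> u \<otimes> F j" by (auto simp: j Jiff)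
  obtain g' where g': "g' \<in> I (Suc k)" "F j = g' \<oplus> x \<otimes> F (Suc j)" using Fs by blast
  have c: "g \<in> carrier S" "g' \<in> carrier S" using gu g' Ic by blast+
  define d where "d = \<one> \<ominus> u \<otimes> x"
  have dc: "d \<in> carrier S" using gu by (simp add: d_def)
  have "d \<notin> m"
  proof
    assume "d \<in> m"
    moreover have "u \<otimes> x \<in> m" using m.I_l_closed gu genideal_self[of "{x, y}"] xy unfolding m by simp
    ultimately have "d \<oplus> u \<otimes> x \<in> m" by simp
    moreover have "d \<oplus> u \<otimes> x = \<one>" unfolding d_def using gu(2) xy by algebra
    ultimately show False using one_m by simp
  qed
  then have dU: "d \<in> Units S" using local_ring_Units[OF assms(3) dc] by simp
  have "d \<otimes> F (Suc j) = F (Suc j) \<oplus> (\<ominus> \<one>) \<otimes> u \<otimes> (x \<otimes> F (Suc j))"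
    unfolding d_def using gu(2) xy Fc[of "Suc j"] by algebra
  also have "\<dots> = (g \<oplus> u \<otimes> (g' \<oplus> x \<otimes> F (Suc j))) \<oplus> (\<ominus> \<one>) \<otimes> u \<otimes> (x \<otimes> F (Suc j))"
    using gu(3) g'(2) by simp
  also have "\<dots> = g \<oplus> u \<otimes> g'" using gu(2) c xy Fc[of "Suc j"] by algebra
  finally have "d \<otimes> F (Suc j) \<in> I (Suc k)" using gu g' Ia Il by metis
  from Il[OF this, of "inv d"] have "inv d \<otimes> (d \<otimes> F (Suc j)) \<in> I (Suc k)" using dU by simp
  moreover have "inv d \<otimes> (d \<otimes> F (Suc j)) = F (Suc j)"
    using dU dc by (simp add: m_assoc[symmetric])
  ultimately have top: "F (Suc j) \<in> I (Suc k)" by simp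
  have down: "F i \<in> I (Suc k)" if "F (Suc i) \<in> I (Suc k)" for i
    using Fs[of i] Ia Il[OF that xy(1)] by auto
  have "F (Suc j - i) \<in> I (Suc k)" if "i \<le> Suc j" for i
    using that
  proof (induction i)
    case 0
    then show ?case using top by simp
  next
    case (Suc i)
    then show ?case using down[of "Suc j - Suc i"] by (simp add: Suc_diff_le)
  qed
  from this[of "Suc j"] have "z [^] k \<in> I (Suc k)" by (simp add: F_def)
  then obtain s a where sa: "s \<in> carrier S" "s \<notin> p" "a \<in> carrier S" "s \<otimes> z [^] k = z [^] Suc k \<otimes> a"
    by (auto simp: I_def)
  have "z [^] k \<otimes> s = z [^] k \<otimes> (z \<otimes> a)"
    using sa by (simp add: m_assoc m_comm)
  moreover have "z [^] k \<noteq> \<zero>"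
    using z0 by (induction k) (auto simp: integral_iff)
  ultimately have "s = z \<otimes> a" using sa m_lcancel by simp
  then have "s \<in> p" using p.I_r_closed z sa by simp
  with sa show False by simp
qed

section \<open>Degrees of simple extensions\<close>

lemma (in ring) eval_as_finsum:
  assumes "set p \<subseteq> carrier R" "x \<in> carrier R"
  shows "eval p x = (\<Oplus>t\<in>{..<length p}. coeff p t \<otimes> x [^] t)"
  using assms(1)
proof (induction p)
  case (Cons a p)
  have c: "coeff p t \<in> carrier R" for t using Cons.prems by (intro coeff_in_carrier) auto
  have "(\<Oplus>t\<in>{..<length (a # p)}. coeff (a # p) t \<otimes> x [^] t) =
        coeff (a # p) (length p) \<otimes> x [^] length p \<oplus> (\<Oplus>t\<in>{..<length p}. coeff (a # p) t \<otimes> x [^] t)"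
    using Cons.prems c assms(2) by (simp add: lessThan_Suc)
  also have "(\<Oplus>t\<in>{..<length p}. coeff (a # p) t \<otimes> x [^] t) = (\<Oplus>t\<in>{..<length p}. coeff p t \<otimes> x [^] t)"
    using c assms(2) by (intro finsum_cong') auto
  finally show ?case using Cons by simp
qed simp

text \<open>Polynomials are lists with the leading coefficient first, so the range has to be
  reversed for \<open>coeff\<close> to read the function back.\<close>

lemma (in ring) coeff_map_rev:
  "t < T \<Longrightarrow> coeff (map \<beta> (rev [0..<T])) t = \<beta> t"
  by (induction T) auto

lemma (in field) generate_field_insert_algebraic:
  assumes "A \<subseteq> carrier R" "a \<in> carrier R" "(algebraic over generate_field R A) a"
  shows "generate_field R (A \<union> {a}) = simple_extension (generate_field R A) a"
proof
  let ?F = "generate_field R A"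
  have F: "subfield ?F R" using generate_field_is_subfield assms by blast
  have sub: "?F \<subseteq> simple_extension ?F a"
    using simple_extension_incl[OF subfieldE(3)[OF F] assms(2)] .
  show "generate_field R (A \<union> {a}) \<subseteq> simple_extension ?F a"
  proof (rule generate_field_min_subfield1)
    show "subfield (simple_extension ?F a) R" using simple_extension_is_subfield[OF F] assms by blast
    show "A \<union> {a} \<subseteq> simple_extension ?F a"
      using sub simple_extension_mem[OF subfieldE(1)[OF F] assms(2)] by (auto intro: generate_field.incl)
  qed (use assms in auto)
  show "simple_extension ?F a \<subseteq> generate_field R (A \<union> {a})"
  proof (rule simple_extension_subring_incl)
    show "subring (generate_field R (A \<union> {a})) R"
      using generate_field_is_subfield[of "A \<union> {a}"] assms subfieldE(1) by auto
    show "?F \<subseteq> generate_field R (A \<union> {a})" using assms by (intro mono_generate_field) auto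
    show "a \<in> generate_field R (A \<union> {a})" by (simp add: generate_field.incl)
  qed
qed

lemma (in field) field_degree_algebraic:
  assumes "A \<subseteq> carrier R" "a \<in> carrier R" "(algebraic over generate_field R A) a"
  shows "field_degree R (generate_field R (A \<union> {a})) (generate_field R A) =
    enat (degree (Irr (generate_field R A) a))"
proof -
  let ?F = "generate_field R A"
  have F: "subfield ?F R" using generate_field_is_subfield assms by blast
  have "dimension (degree (Irr ?F a)) ?F (generate_field R (A \<union> {a}))"
    using dimension_simple_extension[OF F assms(2,3)] generate_field_insert_algebraic[OF assms] by simp
  then show ?thesis
    using finite_dimensionI dimI[OF F] unfolding field_degree_def over_def by auto
qed

lemma (in field) field_degree_finite_imp_algebraic:
  assumes "A \<subseteq> carrier R" "a \<in> carrier R"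
    and "field_degree R (generate_field R (A \<union> {a})) (generate_field R A) \<noteq> \<infinity>"
  shows "(algebraic over generate_field R A) a"
proof (rule finite_dimension_imp_algebraic)
  show "subfield (generate_field R A) R" using generate_field_is_subfield assms by blast
  show "subring (generate_field R (A \<union> {a})) R"
    using generate_field_is_subfield[of "A \<union> {a}"] assms subfieldE(1) by auto
  show "finite_dimension (generate_field R A) (generate_field R (A \<union> {a}))"
    using assms(3) unfolding field_degree_def by (auto split: if_splits)
  show "a \<in> generate_field R (A \<union> {a})" by (simp add: generate_field.incl)
qed

text \<open>The relation is a nonzero polynomial of degree below \<open>T\<close> with root
  \<open>a\<close>, so the minimal polynomial divides it; \<open>normalize\<close> strips the
  leading coefficients that happen to vanish. This is the independence of the low powers of
  \<open>a\<close> in the form in which it excludes cancellation.\<close>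

lemma (in field) relation_imp_field_degree_less:
  assumes A: "A \<subseteq> carrier R" "a \<in> carrier R"
    and \<beta>: "\<And>t. t < T \<Longrightarrow> \<beta> t \<in> generate_field R A" "t0 < T" "\<beta> t0 \<noteq> \<zero>"
    and rel: "(\<Oplus>t\<in>{..<T}. \<beta> t \<otimes> a [^] t) = \<zero>"
  shows "field_degree R (generate_field R (A \<union> {a})) (generate_field R A) < enat T"
proof -
  let ?F = "generate_field R A"
  have F: "subfield ?F R" using generate_field_is_subfield assms by blast
  have Fc: "?F \<subseteq> carrier R" using subfieldE(3)[OF F] .
  define q where "q = map \<beta> (rev [0..<T])"
  have q: "set q \<subseteq> ?F" "set q \<subseteq> carrier R" "length q = T"
    using \<beta>(1) Fc by (auto simp: q_def)
  have "eval (normalize q) a = eval q a" using eval_normalize[OF q(2) A(2)] .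
  also have "\<dots> = (\<Oplus>t\<in>{..<T}. coeff q t \<otimes> a [^] t)"
    using eval_as_finsum[OF q(2) A(2)] q(3) by simp
  also have "\<dots> = (\<Oplus>t\<in>{..<T}. \<beta> t \<otimes> a [^] t)"
    using \<beta>(1) Fc A(2) by (intro finsum_cong') (auto simp: q_def coeff_map_rev)
  finally have ev: "eval (normalize q) a = \<zero>" using rel by simp
  have np: "normalize q \<in> carrier (?F[X])"
    using normalize_gives_polynomial[OF q(1)] univ_poly_carrier by blast
  have nz: "normalize q \<noteq> []"
  proof
    assume "normalize q = []"
    then have "coeff q t0 = \<zero>" using normalize_coeff[of q] by simp
    then show False using \<beta>(2,3) by (simp add: q_def coeff_map_rev)
  qed
  have alg: "(algebraic over ?F) a"
    using algebraicI[OF np nz ev] .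
  have "degree (Irr ?F a) \<le> degree (normalize q)"
    using pdivides_imp_degree_le[OF subfieldE(1)[OF F] IrrE(1)[OF F A(2) alg] np nz
        Irr_minimal[OF F A(2) alg np ev]] .
  also have "\<dots> < T"
    using normalize_length_le[of q] nz q(3) \<beta>(2) by (cases T) auto
  finally show ?thesis using field_degree_algebraic[OF A alg] by simp
qed

lemma (in field) field_degree_ge_1:
  assumes "A \<subseteq> carrier R" "a \<in> carrier R" 
  shows "1 \<le> field_degree R (generate_field R (A \<union> {a})) (generate_field R A)"
proof (cases "(algebraic over generate_field R A) a")
  case True
  have F: "subfield (generate_field R A) R" using generate_field_is_subfield assms by blast
  have "degree (Irr (generate_field R A) a) \<ge> 1"
    using pirreducible_degree[OF F IrrE(1)[OF F assms(2) True] IrrE(2)[OF F assms(2) True]] .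
  then show ?thesis using field_degree_algebraic[OF assms True] by (simp add: one_enat_def)
next
  case False
  then show ?thesis using field_degree_finite_imp_algebraic[OF assms]
    by (cases "field_degree R (generate_field R (A \<union> {a})) (generate_field R A) = \<infinity>") auto
qed

text \<open>The minimal polynomial is monic, so its leading term can be split off; in this shape it
  is the residue of \<open>P (Suc i)\<close>.\<close>

lemma (in field) Irr_relation:
  assumes A: "A \<subseteq> carrier R" "a \<in> carrier R"
    and "field_degree R (generate_field R (A \<union> {a})) (generate_field R A) = enat D"
  shows "(\<Oplus>t\<in>{..<D}. coeff (Irr (generate_field R A) a) t \<otimes> a [^] t) \<oplus> a [^] D = \<zero>"
    and "coeff (Irr (generate_field R A) a) t \<in> generate_field R A"
proof -
  let ?F = "generate_field R A"
  let ?p = "Irr ?F a"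
  have F: "subfield ?F R" using generate_field_is_subfield assms by blast
  have Fc: "?F \<subseteq> carrier R" using subfieldE(3)[OF F] .
  have alg: "(algebraic over ?F) a" using field_degree_finite_imp_algebraic[OF A] assms(3) by simp
  then have D: "degree ?p = D" using field_degree_algebraic[OF A] assms(3) by simp
  note I = IrrE[OF F A(2) alg]
  have pF: "set ?p \<subseteq> ?F" using I(1) polynomial_incl univ_poly_carrier by blast
  have "?p \<noteq> []" using I(2) univ_poly_zero[of R ?F] by (auto simp: ring_irreducible_def)
  then have len: "length ?p = Suc D" using D by (cases ?p) auto
  have c: "coeff ?p t \<in> carrier R" for t using pF Fc by (intro coeff_in_carrier) auto
  have "coeff ?p D = \<one>" using I(3) \<open>?p \<noteq> []\<close> D by (cases ?p) auto
  moreover have "eval ?p a = (\<Oplus>t\<in>{..<Suc D}. coeff ?p t \<otimes> a [^] t)"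
    using eval_as_finsum[OF _ A(2), of ?p] pF Fc len by auto
  ultimately have "\<zero> = a [^] D \<oplus> (\<Oplus>t\<in>{..<D}. coeff ?p t \<otimes> a [^] t)"
    using I(4) c A(2) by (simp add: lessThan_Suc)
  then show "(\<Oplus>t\<in>{..<D}. coeff ?p t \<otimes> a [^] t) \<oplus> a [^] D = \<zero>"
    using c A(2) by (simp add: a_comm Pi_def)
  show "coeff ?p t \<in> ?F"
  proof (cases "t < length ?p")
    case True
    then have "coeff ?p t \<in> set ?p" using coeff_img_restrict[of ?p] by blast
    then show ?thesis using pF by blast
  next
    case False
    then show ?thesis using coeff_length[of ?p t] subringE(2)[OF subfieldE(1)[OF F]] by simp
  qed
qed

lemma (in field) field_degree_eq_1_iff:
  assumes A: "A \<subseteq> carrier R" "a \<in> carrier R"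
  shows "field_degree R (generate_field R (A \<union> {a})) (generate_field R A) = 1 \<longleftrightarrow> a \<in> generate_field R A"
proof
  let ?F = "generate_field R A"
  have F: "subfield ?F R" using generate_field_is_subfield assms by blast
  note sr = subringE[OF subfieldE(1)[OF F]]
  show "a \<in> ?F" if "field_degree R (generate_field R (A \<union> {a})) ?F = 1"
  proof -
    have d: "field_degree R (generate_field R (A \<union> {a})) ?F = enat 1" using that by (simp add: one_enat_def)
    let ?c = "coeff (Irr ?F a) 0"
    have c: "?c \<in> ?F" using Irr_relation(2)[OF A d] .
    then have cc: "?c \<in> carrier R" using sr(1) by blast
    have "?c \<oplus> a = \<zero>" using Irr_relation(1)[OF A d] cc A(2) by (simp add: lessThan_Suc)
    then have "a = \<ominus> ?c" using cc A(2) minus_equality[of a ?c] by (simp add: a_comm)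
    with sr(5)[OF c] show ?thesis by simp
  qed
  show "field_degree R (generate_field R (A \<union> {a})) ?F = 1" if "a \<in> ?F"
  proof -
    \<comment> \<open>The coefficients of \<open>X - a\<close>.\<close>
    define \<beta> where "\<beta> t = (if t = (0::nat) then \<ominus> a else \<one>)" for t
    have "(\<Oplus>t\<in>{..<2}. \<beta> t \<otimes> a [^] t) = a \<ominus> a"
      using A(2) by (simp add: \<beta>_def numeral_2_eq_2 lessThan_Suc minus_eq)
    then have rel: "(\<Oplus>t\<in>{..<2}. \<beta> t \<otimes> a [^] t) = \<zero>" using A(2) by simp
    have "field_degree R (generate_field R (A \<union> {a})) ?F < enat 2"
    proof (rule relation_imp_field_degree_less[OF A _ _ _ rel, of 1])
      show "\<beta> t \<in> ?F" for t using that sr(3,5) by (auto simp: \<beta>_def)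
    qed (auto simp: \<beta>_def)
    then show ?thesis using field_degree_ge_1[OF A]
      by (cases "field_degree R (generate_field R (A \<union> {a})) ?F") (auto simp: one_enat_def)
  qed
qed

section \<open>Multiples in ordered groups and cyclic quotients\<close>

lemma nmul_0 [simp]: "nmul 0 g = 0" and nmul_Suc: "nmul (Suc n) g = nmul n g + g"
  by (simp_all add: nmul_def)

lemma nmul_1 [simp]: "nmul (Suc 0) g = g"
  by (simp add: nmul_def)

lemma nmul_add: "nmul (m + n) g = nmul m g + nmul n g"
  by (induction n) (simp_all add: nmul_Suc add.assoc)

lemma nmul_zero_right [simp]: "nmul n 0 = 0"
  by (simp add: nmul_def)

lemma nmul_mult: "nmul (m * n) g = nmul m (nmul n g)"
  by (induction m) (simp_all add: nmul_Suc nmul_add add.commute)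

lemma nmul_plus: "nmul n (g + h) = nmul n g + nmul n h"
  by (simp add: nmul_def sum.distrib)

lemma nmul_diff: "n \<le> m \<Longrightarrow> nmul (m - n) g = nmul m g - nmul n g"
  using nmul_add[of "m - n" n g] by (simp add: algebra_simps)

lemma nmul_mono_right:
  fixes g h :: "'g::linordered_ab_group_add"
  shows "g \<le> h \<Longrightarrow> nmul n g \<le> nmul n h"
  by (simp add: nmul_def sum_mono)

lemma nmul_strict_mono_right:
  fixes g h :: "'g::linordered_ab_group_add"
  shows "g < h \<Longrightarrow> 0 < n \<Longrightarrow> nmul n g < nmul n h"
  by (auto simp: nmul_def intro!: sum_strict_mono)

lemma nmul_nonneg:
  fixes g :: "'g::linordered_ab_group_add"
  shows "0 \<le> g \<Longrightarrow> 0 \<le> nmul n g"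
  by (simp add: nmul_def sum_nonneg)

lemma nmul_mono_left:
  fixes g :: "'g::linordered_ab_group_add"
  shows "0 \<le> g \<Longrightarrow> m \<le> n \<Longrightarrow> nmul m g \<le> nmul n g"
  using nmul_add[of m "n - m" g] nmul_nonneg[of g "n - m"] by simp

lemma nmul_strict_mono_left:
  fixes g :: "'g::linordered_ab_group_add"
  shows "0 < g \<Longrightarrow> m < n \<Longrightarrow> nmul m g < nmul n g"
  using nmul_mono_left[of g "Suc m" n] less_le_trans[of "nmul m g" "nmul m g + g" "nmul n g"]
  by (simp add: nmul_Suc)

lemma nmul_less_iff:
  fixes g :: "'g::linordered_ab_group_add"
  shows "0 < g \<Longrightarrow> nmul m g < nmul n g \<longleftrightarrow> m < n"
  by (metis linorder_neqE_nat nmul_strict_mono_left order_less_asym)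

lemma group_add_group: "group (add_group :: 'g::ab_group_add monoid)"
proof (rule groupI)
  show "\<exists>y\<in>carrier add_group. y \<otimes>\<^bsub>add_group\<^esub> x = \<one>\<^bsub>add_group\<^esub>" for x :: 'g
    by (rule bexI[of _ "- x"]) (simp_all add: add_group_def)
qed (simp_all add: add_group_def add.assoc)

lemma add_group_simps [simp]:
  fixes a b :: "'g::ab_group_add"
  shows "carrier (add_group :: 'g monoid) = UNIV" "a \<otimes>\<^bsub>add_group\<^esub> b = a + b" "\<one>\<^bsub>add_group\<^esub> = (0::'g)" "inv\<^bsub>add_group\<^esub> a = - a"
proof -
  interpret group "add_group :: 'g monoid" by (rule group_add_group)
  show "inv\<^bsub>add_group\<^esub> a = - a" by (rule inv_equality) (simp_all add: add_group_def)
qed (simp_all add: add_group_def)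

lemma subgroup_add_group_iff:
  "subgroup H add_group \<longleftrightarrow> 0 \<in> H \<and> (\<forall>a\<in>H. \<forall>b\<in>H. a + b \<in> H) \<and> (\<forall>a\<in>H. - a \<in> H)"
  unfolding subgroup_def by auto

lemma nmul_uminus: "nmul k (- g) = - nmul k (g::'h::ab_group_add)"
  by (simp add: nmul_def sum_negf)

lemma subgroup_nmul: "subgroup H add_group \<Longrightarrow> g \<in> H \<Longrightarrow> nmul n g \<in> H"
  by (induction n) (simp_all add: subgroup_add_group_iff nmul_Suc)

lemma subgroup_minus: "subgroup H add_group \<Longrightarrow> a \<in> H \<Longrightarrow> b \<in> H \<Longrightarrow> a - b \<in> H"
  unfolding subgroup_add_group_iff by (metis diff_conv_add_uminus)

lemma subgroup_sum: "subgroup H add_group \<Longrightarrow> (\<And>i. i \<in> A \<Longrightarrow> f i \<in> H) \<Longrightarrow> sum f A \<in> H"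
  by (induction A rule: infinite_finite_induct) (simp_all add: subgroup_add_group_iff)

lemma generate_add_subgroup: "subgroup (generate add_group S) add_group"
  using group.generate_is_subgroup[OF group_add_group, of S] by simp

lemma rcos_add_group: "generate add_group S #>\<^bsub>subgroup_generated add_group T\<^esub> x = (\<lambda>h. h + x) ` generate add_group S"
  by (auto simp: r_coset_def)

lemma rcos_add_group_eq_iff:
  assumes "subgroup H add_group"
  shows "(\<lambda>h. h + x) ` H = (\<lambda>h. h + y) ` H \<longleftrightarrow> x - y \<in> H" 
proof
  assume eq: "(\<lambda>h. h + x) ` H = (\<lambda>h. h + y) ` H"
  have "0 + x \<in> (\<lambda>h. h + x) ` H" using assms unfolding subgroup_add_group_iff by blast
  then obtain h where "h \<in> H" "x = h + y" unfolding eq by auto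
  then show "x - y \<in> H" by simp
next
  assume *: "x - y \<in> H"
  have "(\<lambda>h. h + x) ` H \<subseteq> (\<lambda>h. h + y) ` H" if "x - y \<in> H" for x y
  proof
    fix z assume "z \<in> (\<lambda>h. h + x) ` H"
    then obtain h where "h \<in> H" "z = (h + (x - y)) + y" by auto
    then show "z \<in> (\<lambda>h. h + y) ` H" using that assms unfolding subgroup_add_group_iff by blast
  qed
  moreover have "y - x \<in> H" using * assms unfolding subgroup_add_group_iff by (metis minus_diff_eq)
  ultimately show "(\<lambda>h. h + x) ` H = (\<lambda>h. h + y) ` H" using * by blast
qed


text \<open>The quotient is cyclic, generated by the class of \<open>g\<close>. So a finite index is
  the order of that class, and an infinite one means that the multiples of \<open>g\<close> are in
  distinct cosets. This turns the index of the algorithm into a divisibility condition on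
  exponents.\<close>

lemma group_index_cyclic:
  fixes S :: "'g::ab_group_add set" and g :: 'g
  defines "H \<equiv> generate add_group S"
  defines "I \<equiv> group_index (subgroup_generated add_group (insert g S)) H"
  shows "I = enat e \<Longrightarrow> 0 < e \<and> nmul e g \<in> H \<and> (\<forall>n. nmul n g \<in> H \<longrightarrow> e dvd n)"
    and "I = \<infinity> \<Longrightarrow> nmul n g \<in> H \<Longrightarrow> n = 0"
proof -
  have H: "subgroup H add_group" unfolding H_def by (rule generate_add_subgroup)
  note Hs = H[unfolded subgroup_add_group_iff]
  define G where "G = generate add_group (insert g S)"
  have G: "subgroup G add_group" unfolding G_def by (rule generate_add_subgroup)
  have gG: "g \<in> G" by (simp add: G_def generate.incl)
  have HG: "H \<subseteq> G" unfolding G_def H_def by (intro group.mono_generate[OF group_add_group]) auto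
  define C where "C x = (\<lambda>h. h + x) ` H" for x
  have Ceq: "C x = C y \<longleftrightarrow> x - y \<in> H" for x y unfolding C_def by (rule rcos_add_group_eq_iff[OF H])
  have I: "I = ecard (C ` G)"
    unfolding I_def group_index_def RCOSETS_def H_def[symmetric] carrier_subgroup_generated
    by (auto simp: H_def rcos_add_group C_def G_def intro!: arg_cong[where f = ecard])
  have "(I = enat e \<longrightarrow> 0 < e \<and> nmul e g \<in> H \<and> (\<forall>n. nmul n g \<in> H \<longrightarrow> e dvd n)) \<and>
    (I = \<infinity> \<longrightarrow> (\<forall>n. nmul n g \<in> H \<longrightarrow> n = 0))"
  proof (cases "\<exists>n>0. nmul n g \<in> H")
    case True
    define N where "N = (LEAST n. 0 < n \<and> nmul n g \<in> H)"
    have N: "0 < N" "nmul N g \<in> H" using LeastI_ex[OF True] by (auto simp: N_def)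
    have least: "0 < n \<Longrightarrow> nmul n g \<in> H \<Longrightarrow> N \<le> n" for n unfolding N_def by (rule Least_le) simp
    have mod: "nmul n g - nmul (n mod N) g \<in> H" for n
    proof -
      have "nmul n g = nmul (n div N * N) g + nmul (n mod N) g"
        using nmul_add[of "n div N * N" "n mod N" g] by simp
      then show ?thesis using subgroup_nmul[OF H N(2), of "n div N"] by (simp add: nmul_mult)
    qed
    have dvd: "N dvd n" if "nmul n g \<in> H" for n
    proof -
      have "nmul n g - (nmul n g - nmul (n mod N) g) \<in> H" using subgroup_minus[OF H that mod[of n]] .
      then have "nmul (n mod N) g \<in> H" by simp
      then have "n mod N = 0" using least[of "n mod N"] N(1) mod_less_divisor[of N n] by (metis not_gr_zero not_le)
      then show ?thesis by auto
    qed
    have Gsub: "G \<subseteq> {h + nmul j g | h j. h \<in> H}" (is "_ \<subseteq> ?J")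
      unfolding G_def
    proof (rule group.generate_subgroup_incl[OF group_add_group])
      have "s \<in> ?J" if "s \<in> S" for s
      proof -
        have "s = s + nmul 0 g" "s \<in> H" using that by (simp_all add: H_def generate.incl)
        then show ?thesis by blast
      qed
      moreover have "g \<in> ?J"
      proof -
        have "g = 0 + nmul 1 g" by simp
        then show ?thesis using Hs by blast
      qed
      ultimately show "insert g S \<subseteq> ?J" by blast
      show "subgroup ?J add_group" unfolding subgroup_add_group_iff
      proof (intro conjI ballI)
        have "0 = 0 + nmul 0 g" by simp
        then show "0 \<in> ?J" using Hs by blast
      next
        fix a b assume "a \<in> ?J" "b \<in> ?J"
        then obtain h j h' j' where *: "h \<in> H" "h' \<in> H" "a = h + nmul j g" "b = h' + nmul j' g" by blast
        then have "a + b = (h + h') + nmul (j + j') g" by (simp add: nmul_add algebra_simps)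
        then show "a + b \<in> ?J" using * Hs by blast
      next
        fix a assume "a \<in> ?J"
        then obtain h j where *: "h \<in> H" "a = h + nmul j g" by blast
        \<comment> \<open>A negative multiple of \<open>g\<close> becomes a natural one after adding
          \<open>j\<close> copies of \<open>nmul N g\<close>, which lies in
          \<open>H\<close>.\<close>
        have "j \<le> j * N" using N by simp
        then have "- a = (- h - nmul j (nmul N g)) + nmul (j * N - j) g"
          using * by (simp add: nmul_diff nmul_mult)
        moreover have "- h - nmul j (nmul N g) \<in> H"
          using subgroup_minus[OF H _ subgroup_nmul[OF H N(2)]] *(1) Hs by blast
        ultimately show "- a \<in> ?J" by blast
      qed
    qed
    have "C ` G = (\<lambda>j. C (nmul j g)) ` {..<N}"
    proof
      show "C ` G \<subseteq> (\<lambda>j. C (nmul j g)) ` {..<N}"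
      proof
        fix c assume "c \<in> C ` G"
        then obtain h j where *: "h \<in> H" "c = C (h + nmul j g)" using Gsub by blast
        have "h + (nmul j g - nmul (j mod N) g) \<in> H" using *(1) mod[of j] Hs by blast
        then have "c = C (nmul (j mod N) g)" unfolding *(2) Ceq by (simp add: algebra_simps)
        then show "c \<in> (\<lambda>j. C (nmul j g)) ` {..<N}" using N by auto
      qed
      show "(\<lambda>j. C (nmul j g)) ` {..<N} \<subseteq> C ` G" using subgroup_nmul[OF G gG] by auto
    qed
    moreover have "inj_on (\<lambda>j. C (nmul j g)) {..<N}"
    proof (rule linorder_inj_onI)
      fix i j assume ij: "i < j" "i \<in> {..<N}" "j \<in> {..<N}"
      show "C (nmul i g) \<noteq> C (nmul j g)"
      proof
        assume "C (nmul i g) = C (nmul j g)"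
        then have "nmul (j - i) g \<in> H" using Ceq[of "nmul j g" "nmul i g"] ij by (simp add: nmul_diff)
        then show False using least[of "j - i"] ij by auto
      qed
    qed auto
    ultimately have "I = enat N" unfolding I ecard_def by (simp add: card_image)
    then show ?thesis using N dvd by auto
  next
    case False
    have "inj (\<lambda>j. C (nmul j g))"
    proof (rule linorder_injI)
      fix i j :: nat assume ij: "i < j"
      show "C (nmul i g) \<noteq> C (nmul j g)"
      proof
        assume "C (nmul i g) = C (nmul j g)"
        then have "nmul (j - i) g \<in> H" using Ceq[of "nmul j g" "nmul i g"] ij by (simp add: nmul_diff)
        then show False using False ij zero_less_diff by blast
      qed
    qed
    then have "infinite (range (\<lambda>j. C (nmul j g)))" by (rule range_inj_infinite)
    moreover have "range (\<lambda>j. C (nmul j g)) \<subseteq> C ` G" using subgroup_nmul[OF G gG] by auto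
    ultimately have "infinite (C ` G)" using finite_subset by blast
    then have "I = \<infinity>" unfolding I ecard_def by simp
    then show ?thesis using False by auto
  qed
  then show "I = enat e \<Longrightarrow> 0 < e \<and> nmul e g \<in> H \<and> (\<forall>n. nmul n g \<in> H \<longrightarrow> e dvd n)"
    and "I = \<infinity> \<Longrightarrow> nmul n g \<in> H \<Longrightarrow> n = 0" by blast+
qed

section \<open>Valued fields, their filtration by value and the residue field\<close>

locale valued_field = field K for K (structure) +
  fixes \<nu> :: "'a \<Rightarrow> 'g::linordered_ab_group_add"
  assumes valuation: "valuation K \<nu>"
begin

text \<open>With \<open>carrier K\<close> in place of the ring, the filtration of the graded ring
  becomes one of the field by fractional ideals of the valuation ring. Zero belongs to every member,
  which absorbs the convention \<nu>(0) = \<infinity>.\<close>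

abbreviation "Kge \<equiv> P_ge K \<nu> (carrier K)"
abbreviation "Kgt \<equiv> P_gt K \<nu> (carrier K)"
abbreviation "V \<equiv> val_ring K \<nu>"
abbreviation "k\<nu> \<equiv> res_field K \<nu>"
abbreviation "rs \<equiv> res K \<nu>"

lemma nonzero_Units [simp]: "a \<in> carrier K \<Longrightarrow> a \<noteq> \<zero> \<Longrightarrow> a \<in> Units K"
  by (simp add: field_Units)

lemma inv_closed' [simp]: "a \<in> carrier K \<Longrightarrow> a \<noteq> \<zero> \<Longrightarrow> inv a \<in> carrier K"
  by simp

lemma inv_nonzero [simp]: "a \<in> carrier K \<Longrightarrow> a \<noteq> \<zero> \<Longrightarrow> inv a \<noteq> \<zero>"
  using Units_inv_Units field_Units by blast

lemma mult_nonzero [simp]: "a \<in> carrier K \<Longrightarrow> b \<in> carrier K \<Longrightarrow> a \<otimes> b = \<zero> \<longleftrightarrow> a = \<zero> \<or> b = \<zero>"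
  using integral_iff by blast

lemma pow_nonzero [simp]: "a \<in> carrier K \<Longrightarrow> a \<noteq> \<zero> \<Longrightarrow> a [^] (n::nat) \<noteq> \<zero>"
  by (induction n) auto

lemma inv_mult_field:
  assumes "a \<in> carrier K" "a \<noteq> \<zero>" "b \<in> carrier K" "b \<noteq> \<zero>"
  shows "inv (a \<otimes> b) = inv a \<otimes> inv b"
proof (rule comm_inv_char)
  have "a \<otimes> b \<otimes> (inv a \<otimes> inv b) = (a \<otimes> inv a) \<otimes> (b \<otimes> inv b)"
    using assms by (simp add: m_ac)
  then show "a \<otimes> b \<otimes> (inv a \<otimes> inv b) = \<one>" using assms by simp
qed (use assms in auto)

lemma val_mult: "a \<in> carrier K \<Longrightarrow> b \<in> carrier K \<Longrightarrow> a \<noteq> \<zero> \<Longrightarrow> b \<noteq> \<zero> \<Longrightarrow> \<nu> (a \<otimes> b) = \<nu> a + \<nu> b"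
  using valuation by (auto simp: valuation_def)

lemma val_one [simp]: "\<nu> \<one> = 0"
  using val_mult[of \<one> \<one>] by simp

lemma val_inv: "a \<in> carrier K \<Longrightarrow> a \<noteq> \<zero> \<Longrightarrow> \<nu> (inv a) = - \<nu> a"
  using val_mult[of a "inv a"] by (simp add: eq_neg_iff_add_eq_0 add.commute)

lemma val_uminus: assumes "a \<in> carrier K" "a \<noteq> \<zero>" shows "\<nu> (\<ominus> a) = \<nu> a"
proof -
  have nz: "\<ominus> \<one> \<noteq> \<zero>" using minus_minus[of \<one>] by fastforce
  have "\<nu> (\<ominus> \<one>) + \<nu> (\<ominus> \<one>) = \<nu> ((\<ominus> \<one>) \<otimes> (\<ominus> \<one>))"
    using val_mult[of "\<ominus> \<one>" "\<ominus> \<one>"] nz by simp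
  also have "(\<ominus> \<one>) \<otimes> (\<ominus> \<one>) = \<one>" by (simp add: l_minus)
  \<comment> \<open>An ordered group has no torsion.\<close>
  finally have "\<nu> (\<ominus> \<one>) = 0" by simp
  then have "\<nu> ((\<ominus> \<one>) \<otimes> a) = \<nu> a" using val_mult[of "\<ominus> \<one>" a] nz assms by simp
  then show ?thesis using assms by (simp add: l_minus)
qed

lemma val_pow: "a \<in> carrier K \<Longrightarrow> a \<noteq> \<zero> \<Longrightarrow> \<nu> (a [^] n) = nmul n (\<nu> a)"
  by (induction n) (simp_all add: val_mult nmul_Suc)

lemma Kge_iff: "a \<in> Kge \<phi> \<longleftrightarrow> a \<in> carrier K \<and> (a = \<zero> \<or> \<phi> \<le> \<nu> a)"
  and Kgt_iff: "a \<in> Kgt \<phi> \<longleftrightarrow> a \<in> carrier K \<and> (a = \<zero> \<or> \<phi> < \<nu> a)"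
  by (auto simp: P_ge_def P_gt_def)

lemma Kge_carr: "a \<in> Kge \<phi> \<Longrightarrow> a \<in> carrier K" and Kgt_carr: "a \<in> Kgt \<phi> \<Longrightarrow> a \<in> carrier K"
  by (simp_all add: Kge_iff Kgt_iff)

lemma Kgt_Kge: "a \<in> Kgt \<phi> \<Longrightarrow> a \<in> Kge \<phi>"
  by (auto simp: Kge_iff Kgt_iff)

lemma zero_Kge [simp]: "\<zero> \<in> Kge \<phi>" and zero_Kgt [simp]: "\<zero> \<in> Kgt \<phi>"
  by (simp_all add: Kge_iff Kgt_iff)

lemma val_add_ge:
  "a \<in> carrier K \<Longrightarrow> b \<in> carrier K \<Longrightarrow> a \<noteq> \<zero> \<Longrightarrow> b \<noteq> \<zero> \<Longrightarrow> a \<oplus> b \<noteq> \<zero> \<Longrightarrow> min (\<nu> a) (\<nu> b) \<le> \<nu> (a \<oplus> b)"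
  using valuation by (auto simp: valuation_def)

lemma Kge_add: assumes "a \<in> Kge \<phi>" "b \<in> Kge \<phi>" shows "a \<oplus> b \<in> Kge \<phi>"
proof (cases "a = \<zero> \<or> b = \<zero> \<or> a \<oplus> b = \<zero>")
  case True
  then show ?thesis using assms by (auto simp: Kge_iff)
next
  case False
  then show ?thesis using assms val_add_ge[of a b] by (auto simp: Kge_iff min_le_iff_disj)
qed

lemma Kgt_add: assumes "a \<in> Kgt \<phi>" "b \<in> Kgt \<phi>" shows "a \<oplus> b \<in> Kgt \<phi>"
proof (cases "a = \<zero> \<or> b = \<zero> \<or> a \<oplus> b = \<zero>")
  case True
  then show ?thesis using assms by (auto simp: Kgt_iff)
next
  case False
  then show ?thesis using assms val_add_ge[of a b] by (auto simp: Kgt_iff min_le_iff_disj)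
qed

lemma Kge_uminus: "a \<in> Kge \<phi> \<Longrightarrow> \<ominus> a \<in> Kge \<phi>"
  by (cases "a = \<zero>") (auto simp: Kge_iff val_uminus)

lemma Kgt_uminus: "a \<in> Kgt \<phi> \<Longrightarrow> \<ominus> a \<in> Kgt \<phi>"
  by (cases "a = \<zero>") (auto simp: Kgt_iff val_uminus)

lemma Kgt_minus: "a \<in> Kgt \<phi> \<Longrightarrow> b \<in> Kgt \<phi> \<Longrightarrow> a \<ominus> b \<in> Kgt \<phi>"
  by (simp add: minus_eq Kgt_add Kgt_uminus)

lemma Kge_mult: "a \<in> Kge \<phi> \<Longrightarrow> b \<in> Kge \<psi> \<Longrightarrow> a \<otimes> b \<in> Kge (\<phi> + \<psi>)"
  by (cases "a = \<zero> \<or> b = \<zero>") (auto simp: Kge_iff val_mult intro: add_mono)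

lemma Kgt_mult: "a \<in> Kgt \<phi> \<Longrightarrow> b \<in> Kge \<psi> \<Longrightarrow> a \<otimes> b \<in> Kgt (\<phi> + \<psi>)"
  by (cases "a = \<zero> \<or> b = \<zero>") (auto simp: Kge_iff Kgt_iff val_mult intro: add_less_le_mono)

lemma Kgt_mult': "a \<in> Kge \<phi> \<Longrightarrow> b \<in> Kgt \<psi> \<Longrightarrow> a \<otimes> b \<in> Kgt (\<phi> + \<psi>)"
  by (cases "a = \<zero> \<or> b = \<zero>") (auto simp: Kge_iff Kgt_iff val_mult intro: add_le_less_mono)

lemma Kge_finsum: "finite A \<Longrightarrow> (\<And>i. i \<in> A \<Longrightarrow> f i \<in> Kge \<phi>) \<Longrightarrow> finsum K f A \<in> Kge \<phi>"
proof (induction A rule: finite_induct)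
  case (insert i A)
  then have "finsum K f (insert i A) = f i \<oplus> finsum K f A"
    by (intro finsum_insert) (auto dest: Kge_carr)
  then show ?case using insert by (simp add: Kge_add)
qed simp

lemma Kgt_finsum: "finite A \<Longrightarrow> (\<And>i. i \<in> A \<Longrightarrow> f i \<in> Kgt \<phi>) \<Longrightarrow> finsum K f A \<in> Kgt \<phi>"
proof (induction A rule: finite_induct)
  case (insert i A)
  then have "finsum K f (insert i A) = f i \<oplus> finsum K f A"
    by (intro finsum_insert) (auto dest: Kgt_carr)
  then show ?case using insert by (simp add: Kgt_add)
qed simp

lemma val_add_gt:
  assumes "a \<in> carrier K" "a \<noteq> \<zero>" "b \<in> Kgt (\<nu> a)"
  shows "a \<oplus> b \<noteq> \<zero>" "\<nu> (a \<oplus> b) = \<nu> a"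
proof -
  have bc: "b \<in> carrier K" using assms by (simp add: Kgt_iff)
  have *: "(a \<oplus> b) \<ominus> b = a" using assms(1) bc by algebra
  have "a \<oplus> b \<notin> Kgt (\<nu> a)"
  proof
    assume "a \<oplus> b \<in> Kgt (\<nu> a)"
    from Kgt_minus[OF this assms(3)] * assms show False by (simp add: Kgt_iff)
  qed
  moreover have "a \<oplus> b \<in> Kge (\<nu> a)"
    using assms by (intro Kge_add Kgt_Kge[of b]) (auto simp: Kge_iff)
  ultimately show "a \<oplus> b \<noteq> \<zero>" "\<nu> (a \<oplus> b) = \<nu> a" by (auto simp: Kge_iff Kgt_iff)
qed

lemma V_eq: "V = Kge 0" and val_ideal_eq: "val_ideal K \<nu> = Kgt 0"
  by (auto simp: val_ring_def val_ideal_def P_ge_def P_gt_def)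

lemma V_subring: "subring V K"
  unfolding V_eq
proof (rule subringI)
  show "\<And>a b. a \<in> Kge 0 \<Longrightarrow> b \<in> Kge 0 \<Longrightarrow> a \<otimes> b \<in> Kge 0"
    using Kge_mult[of _ 0 _ 0] by simp
  show "Kge 0 \<subseteq> carrier K" "\<one> \<in> Kge 0" by (auto simp: Kge_iff)
qed (simp_all add: Kge_add Kge_uminus)

lemma V_cring: "cring (K\<lparr>carrier := V\<rparr>)"
  using subcring_iff subcringI'[OF V_subring] subringE(1)[OF V_subring] by blast

lemma val_ideal_ideal: "ideal (Kgt 0) (K\<lparr>carrier := V\<rparr>)"
proof -
  interpret V: cring "K\<lparr>carrier := V\<rparr>" by (rule V_cring)
  show ?thesis
  proof (rule idealI[OF V.ring_axioms])
    have neg: "\<ominus>\<^bsub>K\<lparr>carrier := V\<rparr>\<^esub> a = \<ominus> a" if "a \<in> Kgt 0" for a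
    proof -
      have "a \<in> V" "\<ominus> a \<in> V" using that by (auto simp: V_eq Kgt_Kge Kge_uminus)
      then show ?thesis using V.minus_equality[of "\<ominus> a" a] that by (simp add: Kgt_carr l_neg)
    qed
    show "subgroup (Kgt 0) (add_monoid (K\<lparr>carrier := V\<rparr>))"
    proof
      show "inv\<^bsub>add_monoid (K\<lparr>carrier := V\<rparr>)\<^esub> a \<in> Kgt 0" if "a \<in> Kgt 0" for a
        unfolding a_inv_def[symmetric] neg[OF that] by (rule Kgt_uminus[OF that])
    qed (auto simp: V_eq Kgt_Kge Kgt_add)
  next
    fix a b assume a: "a \<in> Kgt 0" and b: "b \<in> carrier (K\<lparr>carrier := V\<rparr>)"
    then show "b \<otimes>\<^bsub>K\<lparr>carrier := V\<rparr>\<^esub> a \<in> Kgt 0" "a \<otimes>\<^bsub>K\<lparr>carrier := V\<rparr>\<^esub> b \<in> Kgt 0"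
      using Kgt_mult'[of b 0 a 0] Kgt_mult[of a 0 b 0] by (simp_all add: V_eq)
  qed
qed

lemma val_ideal_maximal: "maximalideal (Kgt 0) (K\<lparr>carrier := V\<rparr>)"
proof (rule maximalidealI)
  show "carrier (K\<lparr>carrier := V\<rparr>) \<noteq> Kgt 0"
  proof
    assume "carrier (K\<lparr>carrier := V\<rparr>) = Kgt 0"
    moreover have "\<one> \<in> V" by (simp add: V_eq Kge_iff)
    ultimately show False by (auto simp: Kgt_iff)
  qed
  fix J assume J: "ideal J (K\<lparr>carrier := V\<rparr>)" "Kgt 0 \<subseteq> J" "J \<subseteq> carrier (K\<lparr>carrier := V\<rparr>)"
  interpret J: ideal J "K\<lparr>carrier := V\<rparr>" by fact
  show "J = Kgt 0 \<or> J = carrier (K\<lparr>carrier := V\<rparr>)"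
  proof (cases "J \<subseteq> Kgt 0")
    case False
    then obtain u where u: "u \<in> J" "u \<notin> Kgt 0" by blast
    then have "u \<in> V" using J by auto
    then have u': "u \<in> carrier K" "u \<noteq> \<zero>" "\<nu> u = 0" using u(2) by (auto simp: V_eq Kge_iff Kgt_iff)
    then have "inv u \<in> V" by (simp add: V_eq Kge_iff val_inv)
    with u(1) have "inv u \<otimes> u \<in> J" using J.I_l_closed by simp
    then have "\<one> \<in> J" using u' by simp
    then show ?thesis using J.one_imp_carrier by simp
  qed (use J in auto)
qed (rule val_ideal_ideal)

lemma res_field_field: "field k\<nu>"
  unfolding res_field_def val_ideal_eq
  using maximalideal.quotient_is_field[OF val_ideal_maximal V_cring] .

sublocale kf: field "k\<nu>" by (rule res_field_field)

lemma rs_hom: "rs \<in> ring_hom (K\<lparr>carrier := V\<rparr>) k\<nu>"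
proof -
  have "rs = (\<lambda>f. Kgt 0 +>\<^bsub>K\<lparr>carrier := V\<rparr>\<^esub> f)" by (simp add: fun_eq_iff res_def val_ideal_eq)
  then show ?thesis unfolding res_field_def val_ideal_eq
    using ideal.rcos_ring_hom[OF val_ideal_ideal] by simp
qed

lemma rs_closed [simp]: "f \<in> Kge 0 \<Longrightarrow> rs f \<in> carrier k\<nu>"
  and rs_mult: "f \<in> Kge 0 \<Longrightarrow> g \<in> Kge 0 \<Longrightarrow> rs (f \<otimes> g) = rs f \<otimes>\<^bsub>k\<nu>\<^esub> rs g"
  and rs_add: "f \<in> Kge 0 \<Longrightarrow> g \<in> Kge 0 \<Longrightarrow> rs (f \<oplus> g) = rs f \<oplus>\<^bsub>k\<nu>\<^esub> rs g"
  and rs_one: "rs \<one> = \<one>\<^bsub>k\<nu>\<^esub>"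
  using ring_hom_memE[OF rs_hom] by (auto simp: V_eq)

lemma rs_surj: "carrier k\<nu> = rs ` Kge 0"
  by (auto simp: res_field_def FactRing_def A_RCOSETS_def' V_eq res_def a_r_coset_def'
      image_iff)

lemma rs_zero_iff: assumes "f \<in> Kge 0" shows "rs f = \<zero>\<^bsub>k\<nu>\<^esub> \<longleftrightarrow> f \<in> Kgt 0"
proof -
  interpret I: ideal "Kgt 0" "K\<lparr>carrier := V\<rparr>" by (rule val_ideal_ideal)
  have "rs f = \<zero>\<^bsub>k\<nu>\<^esub> \<longleftrightarrow> Kgt 0 +>\<^bsub>K\<lparr>carrier := V\<rparr>\<^esub> f = Kgt 0"
    by (simp add: res_field_def FactRing_def res_def val_ideal_eq)
  also have "\<dots> \<longleftrightarrow> f \<in> Kgt 0"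
    using I.rcos_const_imp_mem[of f] I.a_rcos_const[of f] assms by (auto simp: V_eq)
  finally show ?thesis .
qed

lemma rs_zero: "rs \<zero> = \<zero>\<^bsub>k\<nu>\<^esub>"
  using rs_zero_iff[of \<zero>] by simp

lemma rs_uminus: assumes "f \<in> Kge 0" shows "rs (\<ominus> f) = \<ominus>\<^bsub>k\<nu>\<^esub> rs f"
proof -
  have "rs (\<ominus> f) \<oplus>\<^bsub>k\<nu>\<^esub> rs f = \<zero>\<^bsub>k\<nu>\<^esub>"
    using rs_add[of "\<ominus> f" f] assms by (simp add: Kge_uminus Kge_carr l_neg rs_zero)
  then show ?thesis using kf.minus_equality assms by (simp add: Kge_uminus)
qed

lemma rs_pow: "f \<in> Kge 0 \<Longrightarrow> f [^] (n::nat) \<in> Kge 0 \<and> rs (f [^] n) = rs f [^]\<^bsub>k\<nu>\<^esub> n"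
proof (induction n)
  case 0
  then show ?case by (simp add: rs_one Kge_iff)
next
  case (Suc n)
  then show ?case using Kge_mult[of "f [^] n" 0 f 0] by (simp add: rs_mult)
qed

lemma rs_inv: assumes "f \<in> carrier K" "f \<noteq> \<zero>" "\<nu> f = 0" shows "rs (inv f) = inv\<^bsub>k\<nu>\<^esub> rs f"
proof -
  have f: "f \<in> Kge 0" "inv f \<in> Kge 0" using assms by (auto simp: Kge_iff val_inv)
  have "rs (inv f) \<otimes>\<^bsub>k\<nu>\<^esub> rs f = \<one>\<^bsub>k\<nu>\<^esub>"
    using rs_mult[of "inv f" f] f assms by (simp add: rs_one)
  then show ?thesis using kf.inv_unique' f by (metis kf.m_comm rs_closed)
qed

lemma rs_finsum: "finite A \<Longrightarrow> (\<And>i. i \<in> A \<Longrightarrow> f i \<in> Kge 0) \<Longrightarrow>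
    rs (finsum K f A) = (\<Oplus>\<^bsub>k\<nu>\<^esub>i\<in>A. rs (f i))"
proof (induction A rule: finite_induct)
  case (insert i A)
  then have "finsum K f (insert i A) = f i \<oplus> finsum K f A"
    by (intro finsum_insert) (auto dest: Kge_carr)
  moreover have "(\<Oplus>\<^bsub>k\<nu>\<^esub>i\<in>insert i A. rs (f i)) = rs (f i) \<oplus>\<^bsub>k\<nu>\<^esub> (\<Oplus>\<^bsub>k\<nu>\<^esub>i\<in>A. rs (f i))"
    using insert by (intro kf.finsum_insert) auto
  ultimately show ?case using insert by (simp add: rs_add Kge_finsum)
qed (simp add: rs_zero)

text \<open>
  The residue of \<open>f / W\<close>, meaningful only if \<open>\<nu> W \<le> \<nu> f\<close>.
\<close>

definition lres :: "'a \<Rightarrow> 'a \<Rightarrow> 'a set" where "lres W f = rs (f \<otimes> inv W)"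

lemma div_Kge:
  assumes "W \<in> carrier K" "W \<noteq> \<zero>"
  shows "f \<in> Kge (\<nu> W + \<phi>) \<Longrightarrow> f \<otimes> inv W \<in> Kge \<phi>" "f \<in> Kge (\<nu> W) \<Longrightarrow> f \<otimes> inv W \<in> Kge 0"
proof -
  have i: "inv W \<in> Kge (- \<nu> W)" using assms by (simp add: Kge_iff val_inv)
  show "f \<in> Kge (\<nu> W + \<phi>) \<Longrightarrow> f \<otimes> inv W \<in> Kge \<phi>" "f \<in> Kge (\<nu> W) \<Longrightarrow> f \<otimes> inv W \<in> Kge 0"
    using Kge_mult[OF _ i] by (fastforce simp: algebra_simps)+
qed

lemma lres_closed: "W \<in> carrier K \<Longrightarrow> W \<noteq> \<zero> \<Longrightarrow> f \<in> Kge (\<nu> W) \<Longrightarrow> lres W f \<in> carrier k\<nu>"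
  by (simp add: lres_def div_Kge)

lemma lres_add:
  "W \<in> carrier K \<Longrightarrow> W \<noteq> \<zero> \<Longrightarrow> f \<in> Kge (\<nu> W) \<Longrightarrow> g \<in> Kge (\<nu> W) \<Longrightarrow>
    lres W (f \<oplus> g) = lres W f \<oplus>\<^bsub>k\<nu>\<^esub> lres W g"
  unfolding lres_def by (subst l_distr) (auto simp: rs_add div_Kge dest: Kge_carr)

lemma lres_uminus:
  "W \<in> carrier K \<Longrightarrow> W \<noteq> \<zero> \<Longrightarrow> f \<in> Kge (\<nu> W) \<Longrightarrow> lres W (\<ominus> f) = \<ominus>\<^bsub>k\<nu>\<^esub> lres W f"
  unfolding lres_def by (subst l_minus) (auto simp: rs_uminus div_Kge dest: Kge_carr)

lemma lres_finsum:
  "finite A \<Longrightarrow> W \<in> carrier K \<Longrightarrow> W \<noteq> \<zero> \<Longrightarrow> (\<And>i. i \<in> A \<Longrightarrow> f i \<in> Kge (\<nu> W)) \<Longrightarrow>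
    lres W (finsum K f A) = (\<Oplus>\<^bsub>k\<nu>\<^esub>i\<in>A. lres W (f i))"
  unfolding lres_def
  by (subst finsum_ldistr) (auto simp: Pi_def rs_finsum div_Kge dest: Kge_carr)

lemma lres_mult:
  assumes "W \<in> carrier K" "W \<noteq> \<zero>" "W' \<in> carrier K" "W' \<noteq> \<zero>" "f \<in> Kge (\<nu> W)" "f' \<in> Kge (\<nu> W')"
  shows "lres (W \<otimes> W') (f \<otimes> f') = lres W f \<otimes>\<^bsub>k\<nu>\<^esub> lres W' f'"
proof -
  have c: "f \<in> carrier K" "f' \<in> carrier K" "inv W \<in> carrier K" "inv W' \<in> carrier K"
    using assms by (auto dest: Kge_carr)
  have "inv (W \<otimes> W') = inv W \<otimes> inv W'"
    using assms by (intro inv_mult_field)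
  then have "(f \<otimes> f') \<otimes> inv (W \<otimes> W') = (f \<otimes> inv W) \<otimes> (f' \<otimes> inv W')"
    using c by (simp add: m_ac)
  then show ?thesis using assms by (simp add: lres_def rs_mult div_Kge)
qed

lemma lres_self: "W \<in> carrier K \<Longrightarrow> W \<noteq> \<zero> \<Longrightarrow> lres W W = \<one>\<^bsub>k\<nu>\<^esub>"
  by (simp add: lres_def rs_one)

lemma lres_pow:
  assumes "W \<in> carrier K" "W \<noteq> \<zero>" "f \<in> Kge (\<nu> W)"
  shows "f [^] (k::nat) \<in> Kge (\<nu> (W [^] k)) \<and> lres (W [^] k) (f [^] k) = lres W f [^]\<^bsub>k\<nu>\<^esub> k"
proof (induction k)
  case 0
  then show ?case using lres_self[of \<one>] by (simp add: Kge_iff)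
next
  case (Suc k)
  have "\<nu> (W [^] Suc k) = \<nu> (W [^] k) + \<nu> W" using assms by (simp add: val_mult)
  then show ?case using Suc assms Kge_mult lres_mult[of "W [^] k" W "f [^] k" f] by simp
qed

lemma lres_zero_iff:
  assumes "W \<in> carrier K" "W \<noteq> \<zero>" "f \<in> Kge (\<nu> W)"
  shows "lres W f = \<zero>\<^bsub>k\<nu>\<^esub> \<longleftrightarrow> f \<in> Kgt (\<nu> W)"
proof -
  have "f \<in> carrier K" using assms Kge_carr by blast
  then have "f \<otimes> inv W \<in> Kgt 0 \<longleftrightarrow> f \<in> Kgt (\<nu> W)"
    using assms by (cases "f = \<zero>") (auto simp: Kgt_iff val_mult val_inv)
  then show ?thesis using assms by (simp add: lres_def rs_zero_iff div_Kge)
qed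

lemma lres_one: "f \<in> carrier K \<Longrightarrow> lres \<one> f = rs f"
  by (simp add: lres_def)

text \<open>The factor \<open>lres W W'\<close> is the residue of an element of value zero. When
  \<open>W\<close> and \<open>W'\<close> are monomials it lies in the field attached to them, which
  is what makes \<open>homog\<close> independent of the denominator.\<close>

lemma lres_change:
  assumes "W \<in> carrier K" "W \<noteq> \<zero>" "W' \<in> carrier K" "W' \<noteq> \<zero>" "\<nu> W = \<nu> W'" "f \<in> Kge (\<nu> W)"
  shows "lres W f = lres W' f \<otimes>\<^bsub>k\<nu>\<^esub> lres W W'"
proof -
  have c: "f \<in> carrier K" "inv W \<in> carrier K" "inv W' \<in> carrier K" using assms Kge_carr by auto
  have "f \<otimes> inv W = (f \<otimes> inv W') \<otimes> (W' \<otimes> inv W)"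
  proof -
    have "(f \<otimes> inv W') \<otimes> (W' \<otimes> inv W) = f \<otimes> (inv W' \<otimes> W') \<otimes> inv W"
      using c assms(1,3) by (simp add: m_assoc)
    then show ?thesis using c assms by simp
  qed
  moreover have "W' \<in> Kge (\<nu> W)" using assms by (simp add: Kge_iff)
  ultimately show ?thesis using assms by (simp add: lres_def rs_mult div_Kge)
qed

end

section \<open>Rank one, Laurent monomials and the fields of their residues\<close>

context valued_field
begin

lemma value_group_subgroup: "subgroup (value_group K \<nu>) add_group"
  unfolding subgroup_add_group_iff
proof (intro conjI ballI)
  show "0 \<in> value_group K \<nu>"
    unfolding value_group_def by (rule image_eqI[of _ _ \<one>]) simp_all
next
  fix a b assume "a \<in> value_group K \<nu>" "b \<in> value_group K \<nu>"
  then obtain f g where "f \<in> carrier K" "g \<in> carrier K" "f \<noteq> \<zero>" "g \<noteq> \<zero>" "a = \<nu> f" "b = \<nu> g"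
    by (auto simp: value_group_def)
  then show "a + b \<in> value_group K \<nu>"
    unfolding value_group_def by (intro image_eqI[of _ _ "f \<otimes> g"]) (simp_all add: val_mult)
next
  fix a assume "a \<in> value_group K \<nu>"
  then obtain f where "f \<in> carrier K" "f \<noteq> \<zero>" "a = \<nu> f"
    by (auto simp: value_group_def)
  then show "- a \<in> value_group K \<nu>"
    unfolding value_group_def by (intro image_eqI[of _ _ "inv f"]) (simp_all add: val_inv)
qed

text \<open>The elements bounded on both sides by multiples of \<open>a\<close> form an isolated
  subgroup. Rank one leaves the zero subgroup as the only proper one, and \<open>a\<close> is not
  zero.\<close>

lemma rank_one_archimedean:
  assumes "valuation_rank K \<nu> = 1" "a \<in> value_group K \<nu>" "0 < a" "b \<in> value_group K \<nu>"
  shows "\<exists>n. b < nmul n a"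
proof -
  let ?\<Gamma> = "value_group K \<nu>"
  note G = value_group_subgroup[unfolded subgroup_add_group_iff]
  let ?I = "{H. isolated_subgroup ?\<Gamma> H \<and> H \<noteq> ?\<Gamma>}"
  have "card ?I = 1"
    using assms(1) by (auto simp: valuation_rank_def ecard_def one_enat_def split: if_splits)
  then obtain H0 where H0: "?I = {H0}" using card_1_singletonE by blast
  have "isolated_subgroup ?\<Gamma> {0}" using G by (auto simp: isolated_subgroup_def subgroup_add_group_iff)
  moreover have "{0} \<noteq> ?\<Gamma>" using assms(2,3) by (metis less_irrefl singletonD)
  ultimately have "{0} \<in> ?I" by simp
  then have only: "H = {0}" if "H \<in> ?I" for H using that H0 by auto
  define H where "H = {g \<in> ?\<Gamma>. \<exists>n. g \<le> nmul n a \<and> - g \<le> nmul n a}"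
  have "isolated_subgroup ?\<Gamma> H"
    unfolding isolated_subgroup_def
  proof (intro conjI ballI impI)
    show "subgroup H add_group" unfolding subgroup_add_group_iff
    proof (intro conjI ballI)
      show "0 \<in> H" unfolding H_def using G by (auto intro: exI[of _ 0])
    next
      fix g h assume "g \<in> H" "h \<in> H"
      then obtain m n where "g \<in> ?\<Gamma>" "h \<in> ?\<Gamma>" "g \<le> nmul m a" "- g \<le> nmul m a" "h \<le> nmul n a" "- h \<le> nmul n a"
        by (auto simp: H_def)
      then have "g + h \<in> ?\<Gamma>" "g + h \<le> nmul (m + n) a" "- (g + h) \<le> nmul (m + n) a"
        using G add_mono[of g "nmul m a" h "nmul n a"] add_mono[of "- g" "nmul m a" "- h" "nmul n a"]
        by (auto simp: nmul_add)
      then show "g + h \<in> H" by (auto simp: H_def)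
    next
      fix g assume "g \<in> H"
      then show "- g \<in> H" using G by (auto simp: H_def)
    qed
    show "H \<subseteq> ?\<Gamma>" by (auto simp: H_def)
    fix h g assume "h \<in> H" "g \<in> ?\<Gamma>" "0 \<le> g \<and> g \<le> h"
    then obtain n where "h \<le> nmul n a" by (auto simp: H_def)
    then have "g \<le> nmul n a" using \<open>0 \<le> g \<and> g \<le> h\<close> by (meson order_trans)
    moreover have "- g \<le> nmul n a" using calculation \<open>0 \<le> g \<and> g \<le> h\<close> order_trans[of "- g" 0 "nmul n a"] order_trans[of 0 g "nmul n a"] by auto
    ultimately show "g \<in> H" using \<open>g \<in> ?\<Gamma>\<close> by (auto simp: H_def)
  qed
  moreover have "a \<in> H"
  proof -
    have "a \<le> nmul 1 a" "- a \<le> nmul 1 a" using assms(3) by auto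
    then show ?thesis using assms(2) unfolding H_def by blast
  qed
  ultimately have "H = ?\<Gamma>" using only[of H] assms(3) by auto
  then obtain n where "b \<le> nmul n a" using assms(4) by (auto simp: H_def)
  also have "\<dots> < nmul (Suc n) a" using assms(3) by (simp add: nmul_Suc)
  finally show ?thesis by blast
qed

text \<open>For a set of nonzero elements this is the multiplicative subgroup it generates: the
  Laurent monomials, built one factor at a time.\<close>

inductive_set mon_group :: "'a set \<Rightarrow> 'a set" for S where
  one: "\<one> \<in> mon_group S"
| mult: "z \<in> mon_group S \<Longrightarrow> s \<in> S \<Longrightarrow> z \<otimes> s \<in> mon_group S"
| div: "z \<in> mon_group S \<Longrightarrow> s \<in> S \<Longrightarrow> z \<otimes> inv s \<in> mon_group S"

lemma mon_group_carrier:
  assumes "S \<subseteq> carrier K - {\<zero>}" "z \<in> mon_group S"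
  shows "z \<in> carrier K \<and> z \<noteq> \<zero>"
  using assms(2)
proof (induction rule: mon_group.induct)
  case (mult z s)
  then have "s \<in> carrier K" "s \<noteq> \<zero>" using assms(1) by auto
  with mult show ?case by simp
next
  case (div z s)
  then have "s \<in> carrier K" "s \<noteq> \<zero>" using assms(1) by auto
  with div show ?case by simp
qed simp

lemma mon_group_mono:
  assumes "S \<subseteq> T" "z \<in> mon_group S" shows "z \<in> mon_group T"
  using assms(2,1) by (induction rule: mon_group.induct) (auto intro: mon_group.intros)

lemma mon_group_mult:
  assumes S: "S \<subseteq> carrier K - {\<zero>}" and z: "z \<in> mon_group S" and w: "w \<in> mon_group S"
  shows "z \<otimes> w \<in> mon_group S"
  using w
proof (induction rule: mon_group.induct)
  case one
  then show ?case using z mon_group_carrier[OF S z] by simp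
next
  case (mult w s)
  then have "z \<otimes> (w \<otimes> s) = z \<otimes> w \<otimes> s"
    using mon_group_carrier[OF S z] mon_group_carrier[OF S mult(1)] S by (auto simp: m_assoc subset_eq)
  then show ?case using mon_group.mult[OF mult(3,2)] by simp
next
  case (div w s)
  then have "z \<otimes> (w \<otimes> inv s) = z \<otimes> w \<otimes> inv s"
    using mon_group_carrier[OF S z] mon_group_carrier[OF S div(1)] S by (auto simp: m_assoc subset_eq)
  then show ?case using mon_group.div[OF div(3,2)] by simp
qed

lemma mon_group_incl: "S \<subseteq> carrier K - {\<zero>} \<Longrightarrow> s \<in> S \<Longrightarrow> s \<in> mon_group S"
  using mon_group.mult[OF mon_group.one, of s S] by auto

lemma mon_group_pow: "S \<subseteq> carrier K - {\<zero>} \<Longrightarrow> z \<in> mon_group S \<Longrightarrow> z [^] (n::nat) \<in> mon_group S"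
  by (induction n) (simp_all add: mon_group.one mon_group_mult)

lemma mon_group_inv:
  assumes S: "S \<subseteq> carrier K - {\<zero>}" and z: "z \<in> mon_group S"
  shows "inv z \<in> mon_group S"
  using z
proof (induction rule: mon_group.induct)
  case one
  then show ?case by (simp add: mon_group.one)
next
  case (mult z s)
  have "s \<in> carrier K" "s \<noteq> \<zero>" using S mult by auto
  then have "inv (z \<otimes> s) = inv z \<otimes> inv s" using mon_group_carrier[OF S mult(1)] inv_mult_field by simp
  then show ?case using mon_group.div[OF mult(3,2)] by simp
next
  case (div z s)
  have "s \<in> carrier K" "s \<noteq> \<zero>" using S div by auto
  then have "inv (z \<otimes> inv s) = inv z \<otimes> s" using mon_group_carrier[OF S div(1)] by (simp add: inv_mult_field)
  then show ?case using mon_group.mult[OF div(3,2)] by simp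
qed

text \<open>Passes from subgroups generated by values, in which the algorithm is phrased, to
  monomials of the field, which are needed as denominators.\<close>

lemma val_mon_group:
  assumes S: "S \<subseteq> carrier K - {\<zero>}"
  shows "\<nu> ` mon_group S = generate add_group (\<nu> ` S)"
proof
  note G = generate_add_subgroup[of "\<nu> ` S", unfolded subgroup_add_group_iff]
  show "\<nu> ` mon_group S \<subseteq> generate add_group (\<nu> ` S)"
  proof
    fix a assume "a \<in> \<nu> ` mon_group S"
    then obtain z where z: "z \<in> mon_group S" "a = \<nu> z" by blast
    have "\<nu> z \<in> generate add_group (\<nu> ` S)"
      using z(1)
    proof (induction rule: mon_group.induct)
      case (mult z s)
      then have "\<nu> (z \<otimes> s) = \<nu> z + \<nu> s" using mon_group_carrier[OF S mult(1)] S val_mult by blast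
      then show ?case using mult G generate.incl[of "\<nu> s" "\<nu> ` S" add_group] by auto
    next
      case (div z s)
      then have "s \<in> carrier K" "s \<noteq> \<zero>" using S by auto
      then have "\<nu> (z \<otimes> inv s) = \<nu> z + - \<nu> s" using mon_group_carrier[OF S div(1)] by (simp add: val_mult val_inv)
      then show ?case using div G generate.incl[of "\<nu> s" "\<nu> ` S" add_group] by (metis imageI)
    qed (use G in simp)
    then show "a \<in> generate add_group (\<nu> ` S)" using z by simp
  qed
  show "generate add_group (\<nu> ` S) \<subseteq> \<nu> ` mon_group S"
  proof (rule group.generate_subgroup_incl[OF group_add_group])
    show "\<nu> ` S \<subseteq> \<nu> ` mon_group S" using mon_group_incl[OF S] by blast
    show "subgroup (\<nu> ` mon_group S) add_group"
      unfolding subgroup_add_group_iff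
    proof (intro conjI ballI)
      show "0 \<in> \<nu> ` mon_group S" by (rule image_eqI[OF _ mon_group.one]) simp
    next
      fix a b assume "a \<in> \<nu> ` mon_group S" "b \<in> \<nu> ` mon_group S"
      then obtain z w where *: "z \<in> mon_group S" "w \<in> mon_group S" "a = \<nu> z" "b = \<nu> w" by blast
      then have "a + b = \<nu> (z \<otimes> w)" using mon_group_carrier[OF S *(1)] mon_group_carrier[OF S *(2)] by (simp add: val_mult)
      then show "a + b \<in> \<nu> ` mon_group S" using mon_group_mult[OF S *(1,2)] by blast
    next
      fix a assume "a \<in> \<nu> ` mon_group S"
      then obtain z where *: "z \<in> mon_group S" "a = \<nu> z" by blast
      then have "- a = \<nu> (inv z)" using mon_group_carrier[OF S *(1)] by (simp add: val_inv)
      then show "- a \<in> \<nu> ` mon_group S" using mon_group_inv[OF S *(1)] by blast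
    qed
  qed
qed

text \<open>Collecting the powers of \<open>s\<close> leaves one integer exponent; passing to the
  inverse of \<open>z\<close> if necessary makes it natural, as the description of the index by
  natural multiples requires. Inside the proof, positive and negative powers are kept on different
  sides of an equation.\<close>

lemma mon_group_insertE:
  assumes S: "insert s S \<subseteq> carrier K - {\<zero>}" and z: "z \<in> mon_group (insert s S)"
  obtains w n where "w \<in> mon_group S" "z = w \<otimes> s [^] (n::nat) \<or> inv z = w \<otimes> s [^] n"
proof -
  have S': "S \<subseteq> carrier K - {\<zero>}" and s: "s \<in> carrier K" "s \<noteq> \<zero>" using S by auto
  have "\<exists>w\<in>mon_group S. \<exists>(a::nat) (b::nat). z \<otimes> s [^] b = w \<otimes> s [^] a"
    using z
  proof (induction rule: mon_group.induct)
    case one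
    then show ?case by (intro bexI[OF _ mon_group.one] exI[of _ 0]) simp
  next
    case (mult z t)
    then obtain w a b where *: "w \<in> mon_group S" "z \<otimes> s [^] (b::nat) = w \<otimes> s [^] (a::nat)" by blast
    have c: "z \<in> carrier K" "w \<in> carrier K" "t \<in> carrier K"
      using mon_group_carrier[OF S mult(1)] mon_group_carrier[OF S' *(1)] S mult(2) by auto
    have "z \<otimes> t \<otimes> s [^] b = (z \<otimes> s [^] b) \<otimes> t" using c s by (simp add: m_ac)
    then have eq: "z \<otimes> t \<otimes> s [^] b = w \<otimes> s [^] a \<otimes> t" using * by simp
    show ?case
    proof (cases "t = s")
      case True
      then have "z \<otimes> t \<otimes> s [^] b = w \<otimes> s [^] Suc a" using eq c s by (simp add: m_assoc)
      then show ?thesis using *(1) by blast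
    next
      case False
      then have "w \<otimes> t \<in> mon_group S" using mult(2) *(1) mon_group.mult by blast
      moreover have "z \<otimes> t \<otimes> s [^] b = (w \<otimes> t) \<otimes> s [^] a" using eq c s by (simp add: m_ac)
      ultimately show ?thesis by blast
    qed
  next
    case (div z t)
    then obtain w a b where *: "w \<in> mon_group S" "z \<otimes> s [^] (b::nat) = w \<otimes> s [^] (a::nat)" by blast
    have c: "z \<in> carrier K" "w \<in> carrier K" "t \<in> carrier K" "t \<noteq> \<zero>" 
      using mon_group_carrier[OF S div(1)] mon_group_carrier[OF S' *(1)] S div(2) by auto
    then have ci: "inv t \<in> carrier K" by simp
    have "z \<otimes> inv t \<otimes> s [^] b = (z \<otimes> s [^] b) \<otimes> inv t" using c ci s by (simp add: m_ac)
    then have eq: "z \<otimes> inv t \<otimes> s [^] b = w \<otimes> s [^] a \<otimes> inv t" using * by simp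
    show ?case
    proof (cases "t = s")
      case True
      have "z \<otimes> inv t \<otimes> s [^] Suc b = (z \<otimes> inv t \<otimes> s [^] b) \<otimes> s" using c ci s by (simp add: m_assoc)
      also have "\<dots> = w \<otimes> s [^] a \<otimes> (inv t \<otimes> s)" unfolding eq using c ci s by (simp add: m_assoc)
      also have "\<dots> = w \<otimes> s [^] a" using True c s by simp
      finally show ?thesis using *(1) by blast
    next
      case False
      then have "w \<otimes> inv t \<in> mon_group S" using div(2) *(1) mon_group.div by blast
      moreover have "z \<otimes> inv t \<otimes> s [^] b = (w \<otimes> inv t) \<otimes> s [^] a" using eq c ci s by (simp add: m_ac)
      ultimately show ?thesis by blast
    qed
  qed
  then obtain w a b where *: "w \<in> mon_group S" "z \<otimes> s [^] (b::nat) = w \<otimes> s [^] (a::nat)" by blast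
  have c: "z \<in> carrier K" "z \<noteq> \<zero>" "w \<in> carrier K" "w \<noteq> \<zero>"
    using mon_group_carrier[OF S z] mon_group_carrier[OF S' *(1)] by auto
  have sp: "s [^] n \<in> carrier K" "s [^] n \<noteq> \<zero>" for n :: nat using s by auto
  show thesis
  proof (cases "b \<le> a")
    case True
    then have "s [^] a = s [^] (a - b) \<otimes> s [^] b" using s by (simp add: nat_pow_mult)
    then have "z \<otimes> s [^] b = (w \<otimes> s [^] (a - b)) \<otimes> s [^] b" using * c sp by (simp add: m_assoc)
    then have "z = w \<otimes> s [^] (a - b)" using c sp m_rcancel[of "s [^] b" z "w \<otimes> s [^] (a - b)"] by simp
    then show thesis using that *(1) by blast
  next
    case False
    then have "s [^] b = s [^] (b - a) \<otimes> s [^] a" using s by (simp add: nat_pow_mult)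
    then have "(z \<otimes> s [^] (b - a)) \<otimes> s [^] a = w \<otimes> s [^] a" using * c sp by (simp add: m_assoc)
    then have "z \<otimes> s [^] (b - a) = w" using c sp m_rcancel[of "s [^] a" "z \<otimes> s [^] (b - a)" w] by simp
    then have "z \<otimes> (inv w \<otimes> s [^] (b - a)) = \<one>" using c sp
      by (metis Units_closed Units_inv_Units nonzero_Units m_lcomm Units_l_inv)
    then have "inv z = inv w \<otimes> s [^] (b - a)" using c sp comm_inv_char by simp
    then show thesis using that mon_group_inv[OF S' *(1)] by blast
  qed
qed

text \<open>Two monomials in \<open>S\<close> of equal value differ by one of value zero, whose
  residue lies in \<open>F\<close>. Hence whether a residue lies in \<open>F\<close> can be tested
  with any of them as denominator.\<close>

definition admissible :: "'a set \<Rightarrow> 'a set set \<Rightarrow> bool" where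
  "admissible S F \<longleftrightarrow> S \<subseteq> carrier K - {\<zero>} \<and> subfield F k\<nu> \<and> (\<forall>z\<in>mon_group S. \<nu> z = 0 \<longrightarrow> rs z \<in> F)"

lemma subfield_nat_pow: "subfield F k\<nu> \<Longrightarrow> a \<in> F \<Longrightarrow> a [^]\<^bsub>k\<nu>\<^esub> (n::nat) \<in> F"
proof (induction n)
  case 0
  then show ?case using subringE(3)[OF subfieldE(1)] by simp
next
  case (Suc n)
  then show ?case using subringE(6)[OF subfieldE(1)] by simp
qed

text \<open>If \<open>w \<otimes> s [^] n\<close> has value zero, then
  \<open>nmul n (\<nu> s)\<close> is the value of a monomial in \<open>S\<close>. Either this forces
  \<open>n = 0\<close>, or \<open>n = e q\<close> and \<open>s [^] n\<close> is the
  \<open>q\<close>-th power of \<open>s [^] e / U\<close> times that of \<open>U\<close>, so that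
  only powers of one new residue arise. The alternatives correspond to infinite and finite
  index.\<close>

lemma admissible_insert:
  assumes adm: "admissible S F" and F': "subfield F' k\<nu>" "F \<subseteq> F'" and s: "s \<in> carrier K" "s \<noteq> \<zero>"
    and alt: "(\<forall>n. nmul n (\<nu> s) \<in> \<nu> ` mon_group S \<longrightarrow> n = 0) \<or>
      (\<exists>e U. (\<forall>n. nmul n (\<nu> s) \<in> \<nu> ` mon_group S \<longrightarrow> e dvd n) \<and> U \<in> mon_group S \<and> \<nu> U = nmul e (\<nu> s) \<and> lres U (s [^] e) \<in> F')"
  shows "admissible (insert s S) F'"
proof -
  have S: "S \<subseteq> carrier K - {\<zero>}" and sS: "insert s S \<subseteq> carrier K - {\<zero>}" using adm s by (auto simp: admissible_def)
  have pos: "rs z \<in> F'" if z: "z = w \<otimes> s [^] n" "w \<in> mon_group S" "\<nu> z = 0" for z w and n :: nat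
  proof -
    have wc: "w \<in> carrier K" "w \<noteq> \<zero>" using mon_group_carrier[OF S z(2)] by auto
    have "0 = \<nu> w + nmul n (\<nu> s)" using z s wc by (simp add: val_mult val_pow)
    then have nv: "nmul n (\<nu> s) = \<nu> (inv w)" using wc by (simp add: val_inv eq_neg_iff_add_eq_0 add.commute)
    then have mem: "nmul n (\<nu> s) \<in> \<nu> ` mon_group S" using mon_group_inv[OF S z(2)] by auto
    from alt show ?thesis
    proof
      assume "\<forall>n. nmul n (\<nu> s) \<in> \<nu> ` mon_group S \<longrightarrow> n = 0"
      then have "n = 0" using mem by blast
      then have "z = w" using z wc by simp
      then show ?thesis using adm z F' by (auto simp: admissible_def)
    next
      assume "\<exists>e U. (\<forall>n. nmul n (\<nu> s) \<in> \<nu> ` mon_group S \<longrightarrow> e dvd n) \<and> U \<in> mon_group S \<and> \<nu> U = nmul e (\<nu> s) \<and> lres U (s [^] e) \<in> F'"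
      then obtain e U where e: "e dvd n" and U: "U \<in> mon_group S" "\<nu> U = nmul e (\<nu> s)" "lres U (s [^] e) \<in> F'"
        using mem by blast
      obtain q where q: "n = e * q" using e by blast
      have Uc: "U \<in> carrier K" "U \<noteq> \<zero>" using mon_group_carrier[OF S U(1)] by auto
      define u where "u = s [^] e \<otimes> inv U"
      have sec: "s [^] e \<in> carrier K" using s by simp
      have uc: "u \<in> carrier K" "u \<noteq> \<zero>" "\<nu> u = 0" using s Uc U(2) by (auto simp: u_def val_mult val_inv val_pow)
      have "u \<otimes> U = s [^] e \<otimes> (inv U \<otimes> U)" using sec Uc unfolding u_def by (simp add: m_assoc)
      then have su: "s [^] e = u \<otimes> U" using sec Uc by simp
      have "s [^] n = (s [^] e) [^] q" using s by (simp add: nat_pow_pow q)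
      also have "\<dots> = u [^] q \<otimes> U [^] q" unfolding su using uc Uc by (simp add: nat_pow_distrib)
      finally have zz: "z = (w \<otimes> U [^] q) \<otimes> u [^] q" using z(1) wc uc Uc by (simp add: m_ac)
      have m: "w \<otimes> U [^] q \<in> mon_group S" using mon_group_mult[OF S z(2) mon_group_pow[OF S U(1)]] .
      have "\<nu> (w \<otimes> U [^] q) = \<nu> (inv (u [^] q))"
        using z(3) zz wc Uc uc by (simp add: val_mult val_inv val_pow)
      also have "\<dots> = 0" using uc by (simp add: val_inv val_pow)
      finally have m0: "\<nu> (w \<otimes> U [^] q) = 0" .
      have "rs (w \<otimes> U [^] q) \<in> F'" using adm m m0 F' by (auto simp: admissible_def)
      moreover have "rs (u [^] q) \<in> F'"
      proof -
        have "u \<in> Kge 0" using uc by (simp add: Kge_iff)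
        then show ?thesis using rs_pow[of u q] subfield_nat_pow[OF F'(1), of "rs u"] U(3) by (simp add: lres_def u_def)
      qed
      moreover have "w \<otimes> U [^] q \<in> Kge 0" "u [^] q \<in> Kge 0" using m0 wc Uc uc by (auto simp: Kge_iff val_pow)
      ultimately show ?thesis unfolding zz using subringE(6)[OF subfieldE(1)[OF F'(1)]] by (simp add: rs_mult)
    qed
  qed
  have "rs z \<in> F'" if z: "z \<in> mon_group (insert s S)" "\<nu> z = 0" for z
  proof -
    have zc: "z \<in> carrier K" "z \<noteq> \<zero>" using mon_group_carrier[OF sS z(1)] by auto
    obtain w n where "w \<in> mon_group S" "z = w \<otimes> s [^] (n::nat) \<or> inv z = w \<otimes> s [^] n"
      using mon_group_insertE[OF sS z(1)] by blast
    moreover have "\<nu> (inv z) = 0" using z(2) zc by (simp add: val_inv)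
    ultimately have "rs z \<in> F' \<or> rs (inv z) \<in> F'" using pos[of z w n] pos[of "inv z" w n] z(2) by blast
    moreover have "rs (inv z) = inv\<^bsub>k\<nu>\<^esub> rs z" using rs_inv zc z(2) by simp
    moreover have "rs z \<in> carrier k\<nu>" "rs z \<noteq> \<zero>\<^bsub>k\<nu>\<^esub>" using zc z(2) by (auto simp: rs_zero_iff Kge_iff Kgt_iff)
    ultimately show ?thesis
      using kf.subfield_m_inv(1)[OF F'(1), of "inv\<^bsub>k\<nu>\<^esub> rs z"] kf.field_Units kf.Units_inv_inv kf.Units_inv_Units by auto
  qed
  then show ?thesis using sS F' by (simp add: admissible_def)
qed

text \<open>
  If \<open>(S, F)\<close> is admissible then the residue below lies in \<open>F\<close> for every \<open>W\<close> of value \<open>\<psi>\<close>.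
\<close>

definition homog :: "'a set \<Rightarrow> 'a set set \<Rightarrow> 'g \<Rightarrow> 'a set" where
  "homog S F \<psi> = {f \<in> Kge \<psi>. f \<in> Kgt \<psi> \<or> (\<exists>W\<in>mon_group S. \<nu> W = \<psi> \<and> lres W f \<in> F)}"

lemma homog_Kge: "f \<in> homog S F \<psi> \<Longrightarrow> f \<in> Kge \<psi>"
  by (simp add: homog_def)

lemma homog_lres:
  assumes adm: "admissible S F" and f: "f \<in> homog S F \<psi>" and W: "W \<in> mon_group S" "\<nu> W = \<psi>"
  shows "lres W f \<in> F"
proof -
  have S: "S \<subseteq> carrier K - {\<zero>}" and F: "subfield F k\<nu>" using adm by (auto simp: admissible_def)
  have Wc: "W \<in> carrier K" "W \<noteq> \<zero>" using mon_group_carrier[OF S W(1)] by auto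
  have fge: "f \<in> Kge (\<nu> W)" using f W by (simp add: homog_def)
  show ?thesis
  proof (cases "f \<in> Kgt \<psi>")
    case True
    then have "lres W f = \<zero>\<^bsub>k\<nu>\<^esub>" using lres_zero_iff[OF Wc fge] W by simp
    then show ?thesis using subringE(2)[OF subfieldE(1)[OF F]] by simp
  next
    case False
    then obtain W' where W': "W' \<in> mon_group S" "\<nu> W' = \<psi>" "lres W' f \<in> F" using f by (auto simp: homog_def)
    have W'c: "W' \<in> carrier K" "W' \<noteq> \<zero>" using mon_group_carrier[OF S W'(1)] by auto
    have "W' \<otimes> inv W \<in> mon_group S" using mon_group_mult[OF S W'(1) mon_group_inv[OF S W(1)]] .
    moreover have "\<nu> (W' \<otimes> inv W) = 0" using Wc W'c W W' by (simp add: val_mult val_inv)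
    ultimately have "lres W W' \<in> F" using adm by (simp add: admissible_def lres_def)
    then show ?thesis
      using lres_change[OF Wc W'c _ fge] W W' subringE(6)[OF subfieldE(1)[OF F]] by simp
  qed
qed

lemma homog_zero [simp]: "\<zero> \<in> homog S F \<psi>"
  by (simp add: homog_def)

lemma homog_Kgt: "f \<in> Kgt \<psi> \<Longrightarrow> f \<in> homog S F \<psi>"
  by (simp add: homog_def Kgt_Kge)

lemma homog_add:
  assumes adm: "admissible S F" and f: "f \<in> homog S F \<psi>" and g: "g \<in> homog S F \<psi>"
  shows "f \<oplus> g \<in> homog S F \<psi>"
\<comment> \<open>If both have larger value, there may be no monomial of value \<open>\<psi>\<close>
  to serve as denominator.\<close>
proof (cases "f \<in> Kgt \<psi> \<and> g \<in> Kgt \<psi>")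
  case True
  then show ?thesis by (simp add: homog_Kgt Kgt_add)
next
  case False
  have S: "S \<subseteq> carrier K - {\<zero>}" and F: "subfield F k\<nu>" using adm by (auto simp: admissible_def)
  obtain W where W: "W \<in> mon_group S" "\<nu> W = \<psi>" using False f g by (auto simp: homog_def)
  have Wc: "W \<in> carrier K" "W \<noteq> \<zero>" using mon_group_carrier[OF S W(1)] by auto
  have "lres W (f \<oplus> g) = lres W f \<oplus>\<^bsub>k\<nu>\<^esub> lres W g"
    using lres_add[OF Wc] homog_Kge[OF f] homog_Kge[OF g] W by simp
  then have "lres W (f \<oplus> g) \<in> F"
    using homog_lres[OF adm f W] homog_lres[OF adm g W] subringE(7)[OF subfieldE(1)[OF F]] by simp
  then show ?thesis unfolding homog_def using W homog_Kge[OF f] homog_Kge[OF g] Kge_add by blast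
qed

lemma homog_uminus:
  assumes adm: "admissible S F" and f: "f \<in> homog S F \<psi>"
  shows "\<ominus> f \<in> homog S F \<psi>"
proof (cases "f \<in> Kgt \<psi>")
  case True
  then show ?thesis by (simp add: homog_Kgt Kgt_uminus)
next
  case False
  have S: "S \<subseteq> carrier K - {\<zero>}" and F: "subfield F k\<nu>" using adm by (auto simp: admissible_def)
  obtain W where W: "W \<in> mon_group S" "\<nu> W = \<psi>" using False f by (auto simp: homog_def)
  have Wc: "W \<in> carrier K" "W \<noteq> \<zero>" using mon_group_carrier[OF S W(1)] by auto
  have "lres W (\<ominus> f) \<in> F"
    using lres_uminus[OF Wc] homog_Kge[OF f] W homog_lres[OF adm f W] subringE(5)[OF subfieldE(1)[OF F]] by simp
  then show ?thesis unfolding homog_def using W homog_Kge[OF f] Kge_uminus by blast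
qed

lemma homog_mult:
  assumes adm: "admissible S F" and f: "f \<in> homog S F \<phi>" and g: "g \<in> homog S F \<psi>"
  shows "f \<otimes> g \<in> homog S F (\<phi> + \<psi>)"
proof (cases "f \<in> Kgt \<phi> \<or> g \<in> Kgt \<psi>")
  case True
  then show ?thesis using Kgt_mult[of f \<phi> g \<psi>] Kgt_mult'[of f \<phi> g \<psi>] homog_Kge[OF f] homog_Kge[OF g] homog_Kgt by blast
next
  case False
  have S: "S \<subseteq> carrier K - {\<zero>}" and F: "subfield F k\<nu>" using adm by (auto simp: admissible_def)
  obtain W where W: "W \<in> mon_group S" "\<nu> W = \<phi>" using False f by (auto simp: homog_def)
  obtain W' where W': "W' \<in> mon_group S" "\<nu> W' = \<psi>" using False g by (auto simp: homog_def)
  have Wc: "W \<in> carrier K" "W \<noteq> \<zero>" "W' \<in> carrier K" "W' \<noteq> \<zero>" using mon_group_carrier[OF S] W W' by auto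
  have "lres (W \<otimes> W') (f \<otimes> g) = lres W f \<otimes>\<^bsub>k\<nu>\<^esub> lres W' g"
    using lres_mult[OF Wc] homog_Kge[OF f] homog_Kge[OF g] W W' by simp
  then have "lres (W \<otimes> W') (f \<otimes> g) \<in> F"
    using homog_lres[OF adm f W] homog_lres[OF adm g W'] subringE(6)[OF subfieldE(1)[OF F]] by simp
  moreover have "\<nu> (W \<otimes> W') = \<phi> + \<psi>" using W W' Wc by (simp add: val_mult)
  moreover have "W \<otimes> W' \<in> mon_group S" using mon_group_mult[OF S W(1) W'(1)] .
  ultimately show ?thesis unfolding homog_def using Kge_mult homog_Kge[OF f] homog_Kge[OF g] by blast
qed

lemma homog_finsum:
  assumes "admissible S F"
  shows "finite A \<Longrightarrow> (\<And>i. i \<in> A \<Longrightarrow> f i \<in> homog S F \<phi>) \<Longrightarrow> finsum K f A \<in> homog S F \<phi>"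
proof (induction A rule: finite_induct)
  case (insert i A)
  then have "finsum K f (insert i A) = f i \<oplus> finsum K f A"
    by (intro finsum_insert) (auto dest: homog_Kge Kge_carr)
  then show ?case using insert assms by (simp add: homog_add)
qed simp

lemma homog_mono: "S \<subseteq> S' \<Longrightarrow> F \<subseteq> F' \<Longrightarrow> homog S F \<psi> \<subseteq> homog S' F' \<psi>"
  using mon_group_mono[of S S'] unfolding homog_def by blast

lemma homog_gen: assumes "admissible S F" "s \<in> S" shows "s \<in> homog S F (\<nu> s)"
proof -
  have S: "S \<subseteq> carrier K - {\<zero>}" and F: "subfield F k\<nu>" using assms by (auto simp: admissible_def)
  have "s \<in> carrier K" "s \<noteq> \<zero>" using S assms(2) by auto
  then have "lres s s \<in> F" using lres_self[of s] subringE(3)[OF subfieldE(1)[OF F]] by metis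
  moreover have "s \<in> Kge (\<nu> s)" using S assms(2) by (auto simp: Kge_iff)
  ultimately show ?thesis using mon_group_incl[OF S assms(2)] by (auto simp: homog_def)
qed

lemma homog_pow: assumes "admissible S F" "s \<in> homog S F \<phi>" shows "s [^] n \<in> homog S F (nmul n \<phi>)"
proof (induction n)
  case 0
  have F: "subfield F k\<nu>" using assms by (auto simp: admissible_def)
  have "lres \<one> \<one> \<in> F" using lres_self[of \<one>] subringE(3)[OF subfieldE(1)[OF F]] by simp
  then show ?case using mon_group.one[of S] by (auto simp: homog_def Kge_iff)
next
  case (Suc n)
  then show ?case using homog_mult[OF assms(1) Suc assms(2)] by (simp add: nmul_Suc)
qed

lemma homog_scalar: assumes "c \<in> Kge 0" "rs c \<in> F" shows "c \<in> homog S F 0"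
  unfolding homog_def using assms mon_group.one[of S] lres_one[of c] by (auto simp: Kge_carr intro!: bexI[of _ \<one>])

end

section \<open>The generating sequence\<close>

locale generating_sequence_setup = valued_field K \<nu>
  for K (structure) and \<nu> :: "'a \<Rightarrow> 'g::linordered_ab_group_add" +
  fixes R m CS :: "'a set" and x y :: 'a and \<Omega> :: enat and P :: "nat \<Rightarrow> 'a"
    and nb d n :: "nat \<Rightarrow> enat" and \<alpha> :: "nat \<Rightarrow> 'a set"
  assumes qf: "quotient_field K R"
    and reg: "regular_local_ring (with_carrier K R) m"
    and dim2: "krull_dim (with_carrier K R) = 2"
    and coeff_set: "coefficient_set (with_carrier K R) m CS"
    and xR: "x \<in> R" and yR: "y \<in> R" and m_gen: "m = genideal (with_carrier K R) {x, y}"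
    and rank: "valuation_rank K \<nu> = 1" and dom: "dominates K \<nu> R m"
    and val_x: "\<nu> x = ideal_value K \<nu> m"
    and gs: "generating_sequence K \<nu> R CS x y \<Omega> P nb d n \<alpha>"
begin

abbreviation "S \<equiv> with_carrier K R"

lemma R_subring: "subring R K" using qf by (simp add: quotient_field_def)

lemma R_carr: "a \<in> R \<Longrightarrow> a \<in> carrier K" using subringE(1)[OF R_subring] by blast

lemma xy_carr [simp]: "x \<in> carrier K" "y \<in> carrier K" using xR yR R_carr by auto

lemmas R_ops = subringE(2,3,5,6,7)[OF R_subring]

lemma R_minus: "a \<in> R \<Longrightarrow> b \<in> R \<Longrightarrow> a \<ominus> b \<in> R"
  by (simp add: minus_eq R_ops)

lemma R_pow: "a \<in> R \<Longrightarrow> a [^] (k::nat) \<in> R"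
  by (induction k) (simp_all add: R_ops)

lemma R_finsum: "finite A \<Longrightarrow> (\<And>i. i \<in> A \<Longrightarrow> f i \<in> R) \<Longrightarrow> finsum K f A \<in> R"
proof (induction A rule: finite_induct)
  case (insert i A)
  then have "finsum K f (insert i A) = f i \<oplus> finsum K f A"
    by (intro finsum_insert) (auto dest: R_carr)
  then show ?case using insert by (simp add: R_ops)
qed (simp add: R_ops)

lemma S_domain: "domain S"
  using subring_is_domain[OF R_subring] .

lemma S_cring: "cring S"
  using S_domain by (rule domain.axioms(1))

lemma S_local: "local_ring S m" and S_noeth: "noetherian_ring S"
  using reg by (simp_all add: regular_local_ring_def)

lemma R_Kge: "a \<in> R \<Longrightarrow> a \<in> Kge 0"
  using dom by (auto simp: dominates_def V_eq)

lemma m_iff: "a \<in> m \<longleftrightarrow> a \<in> R \<and> a \<in> Kgt 0"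
  using dom by (auto simp: dominates_def val_ideal_eq)

lemma m_set: "m = {a \<otimes> x \<oplus> b \<otimes> y | a b. a \<in> R \<and> b \<in> R}"
  unfolding m_gen using cring.genideal_pair[OF S_cring, of x y] xR yR by simp

lemma y_pow_neq: assumes "h \<in> R" shows "y [^] (k::nat) \<noteq> h \<otimes> x"
proof -
  have "(1::enat) < 2" by simp
  then show ?thesis
    using power_not_in_principal_ideal[OF S_domain S_noeth S_local, of x y h k] dim2 xR yR m_gen assms
    by (simp add: nat_pow_consistent[symmetric])
qed

lemma x_nonzero: "x \<noteq> \<zero>"
proof
  assume "x = \<zero>"
  have "(1::enat) < 2" by simp
  \<comment> \<open>The parameters exchange roles: \<open>x\<close> is not a multiple of
    \<open>y\<close>, in particular not \<open>\<zero> \<otimes> y\<close>.\<close>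
  moreover have "m = genideal S {y, x}" using m_gen by (simp add: insert_commute)
  ultimately have "x [^]\<^bsub>S\<^esub> (1::nat) \<noteq> \<zero> \<otimes>\<^bsub>S\<^esub> y"
    using power_not_in_principal_ideal[OF S_domain S_noeth S_local, of y x \<zero> 1] dim2 xR yR R_ops by simp
  moreover have "x [^]\<^bsub>S\<^esub> (1::nat) = x" using cring.cring_simprules xR
      monoid.nat_pow_eone[OF ring.is_monoid[OF cring.axioms(1)[OF S_cring]], of x] by simp
  ultimately show False using \<open>x = \<zero>\<close> by simp
qed

lemma y_nonzero: "y \<noteq> \<zero>"
  using y_pow_neq[of \<zero> 1] R_ops by auto

lemma x_m: "x \<in> m" and y_m: "y \<in> m"
proof -
  have "x = \<one> \<otimes> x \<oplus> \<zero> \<otimes> y" "y = \<zero> \<otimes> x \<oplus> \<one> \<otimes> y" by simp_all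
  then show "x \<in> m" "y \<in> m" unfolding m_set using R_ops by blast+
qed

lemma val_x_pos: "0 < \<nu> x" and val_y_pos: "0 < \<nu> y"
  using x_m y_m x_nonzero y_nonzero by (auto simp: m_iff Kgt_iff)

text \<open>All elements of \<open>m\<close> are combinations of \<open>x\<close> and
  \<open>y\<close>, so the minimum of the two values is attained and least. This shows that the
  \<open>LEAST\<close> in \<open>ideal_value\<close> exists and that the hypothesis on \<nu>(x)
  identifies it with \<nu>(x).\<close>

lemma val_m_ge: assumes "f \<in> m" shows "f \<in> Kge (\<nu> x)"
proof -
  let ?M = "min (\<nu> x) (\<nu> y)"
  have ge: "f \<in> Kge ?M" if f: "f \<in> m" for f
  proof -
    obtain a b where *: "f = a \<otimes> x \<oplus> b \<otimes> y" "a \<in> R" "b \<in> R" using f m_set by blast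
    have "a \<otimes> x \<in> Kge (0 + ?M)" "b \<otimes> y \<in> Kge (0 + ?M)"
      using *(2,3) by (intro Kge_mult R_Kge; simp add: Kge_iff)+
    then show ?thesis using * Kge_add by simp
  qed
  have "ideal_value K \<nu> m = ?M" unfolding ideal_value_def
  proof (rule Least_equality)
    have "?M = \<nu> x \<or> ?M = \<nu> y" by (simp add: min_def)
    then show "?M \<in> \<nu> ` (m - {\<zero>})" using x_m y_m x_nonzero y_nonzero by auto
    show "?M \<le> v" if "v \<in> \<nu> ` (m - {\<zero>})" for v
      using that ge unfolding Kge_iff by auto
  qed
  then have "\<nu> x = ?M" using val_x by simp
  then show ?thesis using ge[OF assms] by simp
qed

lemma val_x_le_y: "\<nu> x \<le> \<nu> y"
  using val_m_ge[OF y_m] y_nonzero by (simp add: Kge_iff)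

lemma CS_R: "c \<in> CS \<Longrightarrow> c \<in> R" and CS_zero: "\<zero> \<in> CS" and CS_one: "\<one> \<in> CS"
  using coeff_set by (auto simp: coefficient_set_def)

lemma CS_unit: assumes "c \<in> CS" "c \<noteq> \<zero>" shows "\<nu> c = 0"
proof -
  interpret m: ideal m S using S_local by (simp add: local_ring_def maximalideal_def)
  have inj: "inj_on (\<lambda>a. m +>\<^bsub>S\<^esub> a) CS"
    using coeff_set by (auto simp: coefficient_set_def bij_betw_def)
  have "c \<notin> m"
  proof
    assume "c \<in> m"
    then have "m +>\<^bsub>S\<^esub> c = m +>\<^bsub>S\<^esub> \<zero>"
      using m.a_rcos_const[of c] m.a_rcos_const[OF additive_subgroup.zero_closed[OF m.is_additive_subgroup]] by simp
    then show False using inj assms CS_zero by (auto dest: inj_onD)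
  qed
  then show ?thesis using R_Kge[OF CS_R[OF assms(1)]] CS_R[OF assms(1)] assms(2) by (auto simp: m_iff Kge_iff Kgt_iff)
qed

lemma CS_approx: assumes "f \<in> R" obtains c where "c \<in> CS" "f \<ominus> c \<in> m"
proof -
  interpret Scr: cring S by (rule S_cring)
  interpret m: ideal m S using S_local by (simp add: local_ring_def maximalideal_def)
  have "m +>\<^bsub>S\<^esub> f \<in> carrier (S Quot m)"
    using assms by (auto simp: FactRing_def A_RCOSETS_def')
  then obtain c where c: "c \<in> CS" "m +>\<^bsub>S\<^esub> f = m +>\<^bsub>S\<^esub> c"
    using coeff_set unfolding coefficient_set_def bij_betw_def
    by (elim conjE) (drule equalityD2, drule (1) subsetD, elim imageE, rule that)
  have "f \<in> m +>\<^bsub>S\<^esub> c" using m.a_rcos_self[of f] assms c(2) by simp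
  then obtain h where h: "h \<in> m" "f = h \<oplus> c" by (auto simp: a_r_coset_def')
  have cc: "h \<in> carrier K" "c \<in> carrier K" using h c CS_R R_carr by (auto simp: m_iff)
  then have "f \<ominus> c = h" using h(2) by algebra
  then show thesis using that c h by simp
qed

text \<open>
  The indices of \<open>SS\<close> and \<open>FF\<close> are exclusive: \<open>SS i = {P 0, \<dots>, P (i - 1)}\<close> and
  \<open>FF i = (R/m)(\<alpha> 1, \<dots>, \<alpha> (i - 1))\<close>. For \<open>i \<ge> 1\<close>, \<open>P i\<close> is congruent to \<open>y ^ dg i\<close> modulo \<open>x\<close>.
\<close>

definition v :: "nat \<Rightarrow> 'g" where "v i = \<nu> (P i)"
definition nn :: "nat \<Rightarrow> nat" where "nn i = the_enat (n i)"
definition SS :: "nat \<Rightarrow> 'a set" where "SS i = P ` {0..<i}"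
definition FF :: "nat \<Rightarrow> 'a set set" where "FF i = adjoined K \<nu> R (\<alpha> ` {1..<i})"
primrec dg :: "nat \<Rightarrow> nat" where "dg 0 = 1" | "dg (Suc i) = (if i = 0 then 1 else nn i * dg i)"

lemma P_0: "P 0 = x" and P_1: "P (Suc 0) = y" and \<Omega>_ge_1: "1 \<le> \<Omega>"
  and step: "1 \<le> i \<Longrightarrow> enat i \<le> \<Omega> \<Longrightarrow> generating_step K \<nu> R CS \<Omega> P nb d n \<alpha> i"
  using gs by (auto simp: generating_sequence_def)

lemma SS_Suc: "SS (Suc i) = insert (P i) (SS i)"
  by (auto simp: SS_def atLeast0_lessThan_Suc)

lemma nb_eq: assumes "1 \<le> i" "enat i \<le> \<Omega>"
  shows "nb i = group_index (subgroup_generated add_group (insert (v i) (\<nu> ` SS i))) (generate add_group (\<nu> ` SS i))"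
proof -
  have "(\<lambda>k. \<nu> (P k)) ` {0..<i} = \<nu> ` SS i" by (auto simp: SS_def)
  moreover have "(\<lambda>k. \<nu> (P k)) ` {0..i} = insert (v i) (\<nu> ` SS i)"
    by (simp add: SS_def v_def image_image flip: atLeastLessThanSuc_atLeastAtMost)
      (simp add: atLeast0_lessThan_Suc)
  ultimately show ?thesis using step[OF assms] by (simp add: generating_step_def)
qed

text \<open>The induction invariant just before step \<open>i\<close>: \<open>P i\<close> is known,
  whereas \<open>n k\<close>, \<open>\<alpha> k\<close> and the growth of values are known only for
  \<open>k < i\<close>. The congruence modulo \<open>x\<close> is what keeps the next element
  nonzero.\<close>

definition good :: "nat \<Rightarrow> bool" where
  "good i \<longleftrightarrow> (\<forall>k\<le>i. P k \<in> R \<and> P k \<noteq> \<zero> \<and> 0 < v k) \<and>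
     (\<forall>k\<in>{1..i}. \<exists>h\<in>R. P k = y [^] dg k \<oplus> h \<otimes> x) \<and>
     (\<forall>k\<in>{1..<i}. nmul (nn k) (v k) < v (Suc k) \<and> n k = enat (nn k) \<and> 1 \<le> nn k \<and> \<alpha> k \<in> carrier k\<nu>) \<and>
     admissible (SS i) (FF i)"

lemma good_P: "good i \<Longrightarrow> k \<le> i \<Longrightarrow> P k \<in> R \<and> P k \<in> carrier K \<and> P k \<noteq> \<zero> \<and> 0 < v k"
  by (auto simp: good_def R_carr)

lemma rsR_sub: "rs ` R \<subseteq> carrier k\<nu>"
  by (auto simp: R_Kge)

lemma FF_subfield:
  assumes "\<And>k. k \<in> {1..<i} \<Longrightarrow> \<alpha> k \<in> carrier k\<nu>"
  shows "subfield (FF i) k\<nu>"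
  unfolding FF_def adjoined_def using assms rsR_sub by (intro kf.generate_field_is_subfield) auto

lemma rsR_FF: "f \<in> R \<Longrightarrow> rs f \<in> FF i"
  unfolding FF_def adjoined_def by (auto intro: generate_field.incl)

lemma FF_mono:
  assumes "\<And>k. k \<in> {1..<j} \<Longrightarrow> \<alpha> k \<in> carrier k\<nu>" "i \<le> j"
  shows "FF i \<subseteq> FF j"
  unfolding FF_def adjoined_def using assms rsR_sub by (intro kf.mono_generate_field) auto

lemma good_1: "good 1"
proof -
  have P: "\<forall>k\<le>1. P k \<in> R \<and> P k \<noteq> \<zero> \<and> 0 < v k"
    using xR yR x_nonzero y_nonzero val_x_pos val_y_pos by (auto simp: le_Suc_eq P_0 P_1 v_def)
  have c: "\<forall>k\<in>{1..1}. \<exists>h\<in>R. P k = y [^] dg k \<oplus> h \<otimes> x"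
  proof
    fix k :: nat assume "k \<in> {1..1}"
    then have "P k = y [^] dg k \<oplus> \<zero> \<otimes> x" by (simp add: P_1)
    then show "\<exists>h\<in>R. P k = y [^] dg k \<oplus> h \<otimes> x" using R_ops(1) by blast
  qed
  have F: "subfield (FF 1) k\<nu>" by (rule FF_subfield) simp
  have m0: "z \<in> mon_group {} \<Longrightarrow> z = \<one>" for z by (induction rule: mon_group.induct) auto
  have "admissible {} (FF 1)"
    unfolding admissible_def using F m0 rsR_FF[of \<one> 1] R_ops by auto
  \<comment> \<open>As \<nu>(x) > 0, no positive power of \<open>x\<close> has value zero, so adding
    \<open>x\<close> creates no new residue.\<close>
  then have "admissible (insert x {}) (FF 1)"
  proof (rule admissible_insert)
    have "k = 0" if "nmul k (\<nu> x) \<in> \<nu> ` mon_group {}" for k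
      using that m0 nmul_strict_mono_left[OF val_x_pos, of 0 k] by force
    then show "(\<forall>k. nmul k (\<nu> x) \<in> \<nu> ` mon_group {} \<longrightarrow> k = 0) \<or>
      (\<exists>e U. (\<forall>n. nmul n (\<nu> x) \<in> \<nu> ` mon_group {} \<longrightarrow> e dvd n) \<and> U \<in> mon_group {} \<and> \<nu> U = nmul e (\<nu> x) \<and> lres U (x [^] e) \<in> FF 1)"
      by blast
  qed (use F x_nonzero in auto)
  then have "admissible (SS 1) (FF 1)" by (simp add: SS_def P_0)
  then show ?thesis using P c by (simp add: good_def)
qed

lemma power_product_facts:
  assumes "\<And>k. k < i \<Longrightarrow> P k \<in> R \<and> P k \<noteq> \<zero>"
  shows "power_product K P i w \<in> mon_group (SS i)" "power_product K P i w \<in> R"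
    "power_product K P i w \<noteq> \<zero>" "\<nu> (power_product K P i w) = (\<Sum>k<i. nmul (w k) (v k))"
    "0 < i \<Longrightarrow> 0 < w 0 \<Longrightarrow> \<exists>h\<in>R. power_product K P i w = h \<otimes> x"
proof -
  have SSK: "SS j \<subseteq> carrier K - {\<zero>}" if "j \<le> i" for j
  proof
    fix p assume "p \<in> SS j"
    then obtain k where "k < j" "p = P k" by (auto simp: SS_def)
    then show "p \<in> carrier K - {\<zero>}" using assms[of k] R_carr that by auto
  qed
  have "j \<le> i \<Longrightarrow> power_product K P j w \<in> mon_group (SS j) \<and> power_product K P j w \<in> R
    \<and> power_product K P j w \<noteq> \<zero> \<and> \<nu> (power_product K P j w) = (\<Sum>k<j. nmul (w k) (v k))
    \<and> (0 < j \<longrightarrow> 0 < w 0 \<longrightarrow> (\<exists>h\<in>R. power_product K P j w = h \<otimes> x))" for j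
  proof (induction j)
    case 0
    then show ?case by (simp add: power_product_def mon_group.one R_ops)
  next
    case (Suc j)
    let ?p = "power_product K P j w"
    have IH: "?p \<in> mon_group (SS j)" "?p \<in> R" "?p \<noteq> \<zero>" "\<nu> ?p = (\<Sum>k<j. nmul (w k) (v k))"
       "0 < j \<Longrightarrow> 0 < w 0 \<Longrightarrow> \<exists>h\<in>R. ?p = h \<otimes> x" using Suc by auto
    have PR: "P j \<in> R" "P j \<noteq> \<zero>" "P j \<in> carrier K" using assms[of j] Suc(2) R_carr by auto
    have pc: "?p \<in> carrier K" using IH R_carr by blast
    have "finprod K (\<lambda>k. P k [^] w k) {..<Suc j} = P j [^] w j \<otimes> finprod K (\<lambda>k. P k [^] w k) {..<j}"
      unfolding lessThan_Suc using assms Suc(2) R_carr by (intro finprod_insert) auto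
    then have eq: "power_product K P (Suc j) w = P j [^] w j \<otimes> ?p" by (simp add: power_product_def)
    have "P j \<in> mon_group (SS (Suc j))" using mon_group_incl[OF SSK[OF Suc(2)], of "P j"] by (simp add: SS_Suc)
    then have m: "power_product K P (Suc j) w \<in> mon_group (SS (Suc j))"
      unfolding eq using IH(1) mon_group_mono[of "SS j" "SS (Suc j)"]
      by (intro mon_group_mult[OF SSK[OF Suc(2)]] mon_group_pow[OF SSK[OF Suc(2)]]) (auto simp: SS_Suc)
    have "\<exists>h\<in>R. power_product K P (Suc j) w = h \<otimes> x" if pos: "0 < w 0"
    proof (cases "j = 0")
      case True
      obtain w' where w': "w 0 = Suc w'" using pos gr0_conv_Suc[of "w 0"] by auto
      have "?p = \<one>" using True by (simp add: power_product_def)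
      then have "power_product K P (Suc j) w = x [^] w' \<otimes> x" unfolding eq using True w' P_0 by simp
      then show ?thesis using R_pow[OF xR] by blast
    next
      case False
      then obtain h where h: "h \<in> R" "?p = h \<otimes> x" using IH(5) pos by blast
      then have "power_product K P (Suc j) w = (P j [^] w j \<otimes> h) \<otimes> x" unfolding eq using PR R_carr by (simp add: m_assoc)
      then show ?thesis using R_ops(4)[OF R_pow[OF PR(1)] h(1)] by blast
    qed
    then show ?case using m IH PR pc R_pow[OF PR(1)] R_ops
      by (simp add: eq val_mult val_pow v_def add.commute)
  qed
  then show "power_product K P i w \<in> mon_group (SS i)" "power_product K P i w \<in> R"
    "power_product K P i w \<noteq> \<zero>" "\<nu> (power_product K P i w) = (\<Sum>k<i. nmul (w k) (v k))"
    "0 < i \<Longrightarrow> 0 < w 0 \<Longrightarrow> \<exists>h\<in>R. power_product K P i w = h \<otimes> x" by auto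
qed

lemma ranges_Suc: "{1..i} = {1..<Suc i}" by auto

text \<open>The part of \<open>generating_step\<close> in which both index and degree are finite,
  with \<open>e\<close> and \<open>U\<close> fixed, so that its choices are unpacked only where the
  new element is studied.\<close>

definition next_poly :: "nat \<Rightarrow> nat \<Rightarrow> 'a \<Rightarrow> nat \<Rightarrow> bool" where
  "next_poly i e U D \<longleftrightarrow> (\<exists>l a j.
     (\<forall>t<D. \<forall>s \<in> {1..l t}. a s t \<in> CS \<and> (\<forall>k \<in> {1..<i}. enat (j k s t) < n k) \<and>
        \<nu> (power_product K P i (\<lambda>k. j k s t) \<otimes> P i [^] (t * e)) = nmul (e * D) (\<nu> (P i))) \<and>
     (\<forall>t<D. kf.coeff (kf.Irr (FF i) (\<alpha> i)) t =
        rs (coeff_sum K P i (l t) (\<lambda>s. a s t) (\<lambda>k s. j k s t) \<otimes> inv (U [^] (D - t)))) \<and>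
     P (Suc i) = P i [^] (e * D) \<oplus>
       finsum K (\<lambda>t. coeff_sum K P i (l t) (\<lambda>s. a s t) (\<lambda>k s. j k s t) \<otimes> P i [^] (t * e)) {..<D})"

lemma step_finite:
  assumes i: "1 \<le> i" "enat i \<le> \<Omega>" and g: "good i" and e: "nb i = enat e"
  obtains w U where "U = power_product K P i w" "\<forall>k\<in>{1..<i}. enat (w k) < n k"
    "U \<in> mon_group (SS i)" "U \<in> carrier K" "U \<noteq> \<zero>" "\<nu> U = nmul e (v i)" "\<alpha> i = lres U (P i [^] e)"
    "P i [^] e \<in> Kge (\<nu> U)"
    "\<alpha> i \<in> carrier k\<nu>" "d i = field_degree k\<nu> (FF (Suc i)) (FF i)"
    "d i = \<infinity> \<Longrightarrow> \<Omega> = enat i \<and> n i = \<infinity>"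
    "d i \<noteq> \<infinity> \<Longrightarrow> enat i < \<Omega> \<and> n i = nb i * d i \<and> (\<exists>D. d i = enat D \<and> next_poly i e U D)"
proof -
  have Pk: "P k \<in> R \<and> P k \<noteq> \<zero>" if "k < i" for k using good_P[OF g, of k] that by auto
  have Pi: "P i \<in> carrier K" "P i \<noteq> \<zero>" using good_P[OF g, of i] by auto
  have ne: "nb i \<noteq> \<infinity>" using e by simp
  from step[OF i, unfolded generating_step_def ranges_Suc[of i] FF_def[symmetric], THEN conjunct2, unfolded if_not_P[OF ne]]
  show thesis
    apply (elim exE conjE)
    subgoal premises a for e' w U F
    proof -
      have e': "e' = e" using a(1) e by simp
      note pp = power_product_facts[of i w, OF Pk]
      have U: "U \<in> mon_group (SS i)" "U \<in> carrier K" "U \<noteq> \<zero>" using pp a(2) R_carr by auto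
      have vU: "\<nu> U = nmul e (v i)" using a(5) by (simp add: e' v_def)
      have Pe: "P i [^] e \<in> Kge (\<nu> U)" using Pi by (simp add: Kge_iff vU val_pow v_def)
      have al: "\<alpha> i = lres U (P i [^] e)" using a(6) by (simp add: lres_def e')
      have alc: "\<alpha> i \<in> carrier k\<nu>" unfolding al by (rule lres_closed[OF U(2,3) Pe])
      have inf: "\<Omega> = enat i \<and> n i = \<infinity>" if "d i = \<infinity>" using a(8)[unfolded if_P[OF that]] .
      have fin: "enat i < \<Omega> \<and> n i = nb i * d i \<and> (\<exists>D. d i = enat D \<and> next_poly i e U D)" if "d i \<noteq> \<infinity>"
        using a(8)[unfolded if_not_P[OF that] e' a(3)] unfolding next_poly_def by blast
      show thesis by (rule that[OF a(2,4) U vU al Pe alc a(7)[unfolded a(3)] inf fin])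
    qed
    done
qed

text \<open>For finite index the new residue of \<open>admissible_insert\<close> is
  \<open>\<alpha> i\<close> itself; for infinite index no new monomial has value zero. The last
  index of a sequence that stops is included.\<close>

lemma good_imp_admissible:
  assumes i: "1 \<le> i" "enat i \<le> \<Omega>" and g: "good i"
  shows "\<alpha> i \<in> carrier k\<nu>" "admissible (SS (Suc i)) (FF (Suc i))" "subfield (FF (Suc i)) k\<nu>" "FF i \<subseteq> FF (Suc i)"
proof -
  have adm: "admissible (SS i) (FF i)" using g by (simp add: good_def)
  then have S: "SS i \<subseteq> carrier K - {\<zero>}" by (simp add: admissible_def)
  have Pi: "P i \<in> carrier K" "P i \<noteq> \<zero>" using good_P[OF g, of i] by auto
  note idx = group_index_cyclic[of "v i" "\<nu> ` SS i", folded nb_eq[OF i] val_mon_group[OF S]]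
  have *: "\<alpha> i \<in> carrier k\<nu> \<and> (subfield (FF (Suc i)) k\<nu> \<longrightarrow> FF i \<subseteq> FF (Suc i) \<longrightarrow>
    admissible (insert (P i) (SS i)) (FF (Suc i)))"
  proof (cases "nb i")
    case (enat e)
    obtain w U where *: "U = power_product K P i w" "U \<in> mon_group (SS i)" "\<nu> U = nmul e (v i)" "\<alpha> i = lres U (P i [^] e)"
      "\<alpha> i \<in> carrier k\<nu>"
      by (rule step_finite[OF i g enat]) (rule that, assumption+)
    have "lres U (P i [^] e) \<in> FF (Suc i)"
      unfolding *(4)[symmetric] FF_def adjoined_def using i(1) by (auto intro: generate_field.incl)
    then show ?thesis using *(5) idx(1)[OF enat] *(2,3) Pi
      by (intro conjI impI admissible_insert[OF adm]) (auto simp: v_def)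
  next
    case infinity
    then have "\<alpha> i = \<one>\<^bsub>k\<nu>\<^esub>" using step[OF i] by (simp add: generating_step_def)
    then show ?thesis using idx(2)[OF infinity] Pi
      by (intro conjI impI admissible_insert[OF adm]) (auto simp: v_def)
  qed
  then show "\<alpha> i \<in> carrier k\<nu>" by blast
  have al: "\<alpha> k \<in> carrier k\<nu>" if "k \<in> {1..<Suc i}" for k
    using that * g by (cases "k = i") (auto simp: good_def)
  show F: "subfield (FF (Suc i)) k\<nu>" "FF i \<subseteq> FF (Suc i)"
    using FF_subfield[of "Suc i"] FF_mono[of "Suc i" i] al by auto
  then show "admissible (SS (Suc i)) (FF (Suc i))" using * by (simp add: SS_Suc)
qed

text \<open>The exponents behave like digits: since \<open>nmul (nn k) (v k) < v (Suc k)\<close>, a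
  carry is worth less than the next place. Consequently a reduced monomial in earlier elements whose
  value reaches \<open>v i\<close> must involve \<open>x\<close>.\<close>

lemma weighted_sum_less:
  assumes "good i" "i0 \<le> i" "1 \<le> i0" "\<And>k. k \<in> {1..<i} \<Longrightarrow> w k < nn k"
  shows "(\<Sum>k\<in>{1..<i0}. nmul (w k) (v k)) < v i0"
  using assms(2,3)
proof (induction i0)
  case (Suc i0)
  show ?case
  proof (cases "i0 = 0")
    case True
    then show ?thesis using good_P[OF assms(1), of 1] Suc(2) by simp
  next
    case False
    have g: "nmul (nn i0) (v i0) < v (Suc i0)" "0 < v i0" "w i0 < nn i0"
      using assms(1,4) False Suc(2) by (auto simp: good_def)
    have "{1..<Suc i0} = insert i0 {1..<i0}" using False by auto
    then have "(\<Sum>k\<in>{1..<Suc i0}. nmul (w k) (v k)) = nmul (w i0) (v i0) + (\<Sum>k\<in>{1..<i0}. nmul (w k) (v k))" by simp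
    also have "\<dots> < nmul (w i0) (v i0) + v i0" using Suc False by simp
    also have "\<dots> = nmul (Suc (w i0)) (v i0)" by (simp add: nmul_Suc)
    also have "\<dots> \<le> nmul (nn i0) (v i0)" using g by (intro nmul_mono_left) auto
    also have "\<dots> < v (Suc i0)" by (rule g)
    finally show ?thesis .
  qed
qed simp

lemma pow_mod_x:
  assumes "h \<in> R" shows "\<exists>h'\<in>R. (y [^] (p::nat) \<oplus> h \<otimes> x) [^] (k::nat) = y [^] (k * p) \<oplus> h' \<otimes> x"
proof (induction k)
  case 0
  have "(y [^] p \<oplus> h \<otimes> x) [^] (0::nat) = y [^] (0 * p) \<oplus> \<zero> \<otimes> x" by simp
  then show ?case using R_ops by blast
next
  case (Suc k)
  then obtain h' where h': "h' \<in> R" "(y [^] p \<oplus> h \<otimes> x) [^] k = y [^] (k * p) \<oplus> h' \<otimes> x" by blast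
  have c: "h \<in> carrier K" "h' \<in> carrier K" using assms h' R_carr by auto
  have cc: "y [^] p \<in> carrier K" "y [^] (k * p) \<in> carrier K" by auto
  have "(y [^] p \<oplus> h \<otimes> x) [^] Suc k = (y [^] (k * p) \<oplus> h' \<otimes> x) \<otimes> (y [^] p \<oplus> h \<otimes> x)"
    using h'(2) by simp
  also have "\<dots> = y [^] (k * p) \<otimes> y [^] p \<oplus> (y [^] (k * p) \<otimes> h \<oplus> h' \<otimes> (y [^] p \<oplus> h \<otimes> x)) \<otimes> x"
    using c cc xy_carr(1) by algebra
  also have "y [^] (k * p) \<otimes> y [^] p = y [^] (Suc k * p)" by (simp add: nat_pow_mult add.commute)
  finally have eq: "(y [^] p \<oplus> h \<otimes> x) [^] Suc k = y [^] (Suc k * p) \<oplus>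
    (y [^] (k * p) \<otimes> h \<oplus> h' \<otimes> (y [^] p \<oplus> h \<otimes> x)) \<otimes> x" .
  have "y [^] (k * p) \<otimes> h \<oplus> h' \<otimes> (y [^] p \<oplus> h \<otimes> x) \<in> R"
    by (intro R_ops R_pow yR xR assms h'(1))
  then show ?case using eq by (rule bexI[rotated])
qed


lemma Rx_finsum:
  "finite A \<Longrightarrow> (\<And>i. i \<in> A \<Longrightarrow> \<exists>h\<in>R. f i = h \<otimes> x) \<Longrightarrow> \<exists>h\<in>R. finsum K f A = h \<otimes> x"
proof (induction A rule: finite_induct)
  case empty
  have "finsum K f {} = \<zero> \<otimes> x" by simp
  then show ?case using R_ops(1) by blast
next
  case (insert i A)
  then obtain h h' where h: "h \<in> R" "f i = h \<otimes> x" "h' \<in> R" "finsum K f A = h' \<otimes> x" by blast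
  have "f \<in> A \<rightarrow> carrier K" using insert(4) R_carr xy_carr(1) by fastforce
  moreover have "f i \<in> carrier K" using h R_carr by simp
  ultimately have "finsum K f (insert i A) = (h \<oplus> h') \<otimes> x"
    using insert(1,2) h R_carr by (simp add: l_distr)
  then show ?case using R_ops h by blast
qed

lemma FF_Suc: "1 \<le> i \<Longrightarrow> FF (Suc i) = generate_field k\<nu> ((rs ` R \<union> \<alpha> ` {1..<i}) \<union> {\<alpha> i})"
  unfolding FF_def adjoined_def by (rule arg_cong[where f = "generate_field k\<nu>"]) (auto simp: less_Suc_eq)

lemma FF_gen: "FF i = generate_field k\<nu> (rs ` R \<union> \<alpha> ` {1..<i})"
  by (simp add: FF_def adjoined_def)

lemma good_gens: "good i \<Longrightarrow> rs ` R \<union> \<alpha> ` {1..<i} \<subseteq> carrier k\<nu>"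
  using rsR_sub by (auto simp: good_def)

lemma step_infinite:
  assumes "1 \<le> i" "enat i \<le> \<Omega>" "nb i = \<infinity>"
  shows "\<Omega> = enat i \<and> \<alpha> i = \<one>\<^bsub>k\<nu>\<^esub> \<and> d i = 1 \<and> n i = \<infinity>"
  using step[OF assms(1,2), unfolded generating_step_def, THEN conjunct2, unfolded if_P[OF assms(3)]] .

lemma good_step:
  assumes i: "1 \<le> i" "enat i < \<Omega>" and g: "good i"
  shows "good (Suc i)"
proof -
  have i': "enat i \<le> \<Omega>" using i by simp
  have nbf: "nb i \<noteq> \<infinity>" using step_infinite[OF i(1) i'] i(2) by auto
  then obtain e where e: "nb i = enat e" by (cases "nb i") auto
  have adm: "admissible (SS i) (FF i)" using g by (simp add: good_def)
  then have S: "SS i \<subseteq> carrier K - {\<zero>}" by (simp add: admissible_def)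
  have e0: "0 < e"
    using group_index_cyclic(1)[of "v i" "\<nu> ` SS i", folded nb_eq[OF i(1) i'], OF e] by simp
  have Pk: "P k \<in> R \<and> P k \<noteq> \<zero>" if "k < i" for k using good_P[OF g, of k] that by auto
  have Pi: "P i \<in> R" "P i \<in> carrier K" "P i \<noteq> \<zero>" "0 < v i" using good_P[OF g, of i] by auto
  show ?thesis
  proof (rule step_finite[OF i(1) i' g e])
    fix w U
    assume U: "U \<in> mon_group (SS i)" "U \<in> carrier K" "U \<noteq> \<zero>" and vU: "\<nu> U = nmul e (v i)"
      and al: "\<alpha> i = lres U (P i [^] e)" and Pe: "P i [^] e \<in> Kge (\<nu> U)" and alc: "\<alpha> i \<in> carrier k\<nu>"
      and d: "d i = field_degree k\<nu> (FF (Suc i)) (FF i)"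
      and inf: "d i = \<infinity> \<Longrightarrow> \<Omega> = enat i \<and> n i = \<infinity>"
      and fin: "d i \<noteq> \<infinity> \<Longrightarrow> enat i < \<Omega> \<and> n i = nb i * d i \<and> (\<exists>D. d i = enat D \<and> next_poly i e U D)"
    have "d i \<noteq> \<infinity>" using inf i(2) by auto
    with fin obtain D where n: "n i = nb i * d i" and D: "d i = enat D" and np: "next_poly i e U D" by blast
    obtain l a j where terms': "\<forall>t<D. \<forall>s \<in> {1..l t}. a s t \<in> CS \<and> (\<forall>k \<in> {1..<i}. enat (j k s t) < n k) \<and>
                \<nu> (power_product K P i (\<lambda>k. j k s t) \<otimes> P i [^] (t * e)) = nmul (e * D) (\<nu> (P i))"
      and co': "\<forall>t<D. kf.coeff (kf.Irr (FF i) (\<alpha> i)) t =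
                rs (coeff_sum K P i (l t) (\<lambda>s. a s t) (\<lambda>k s. j k s t) \<otimes> inv (U [^] (D - t)))"
      and PS: "P (Suc i) = P i [^] (e * D) \<oplus>
               finsum K (\<lambda>t. coeff_sum K P i (l t) (\<lambda>s. a s t) (\<lambda>k s. j k s t) \<otimes> P i [^] (t * e)) {..<D}"
      using np unfolding next_poly_def by (elim exE conjE) (rule that, assumption+)
    note terms = terms'[rule_format] note co = co'[rule_format]
    define p where "p t s = power_product K P i (\<lambda>k. j k s t)" for t s
    define c where "c t = coeff_sum K P i (l t) (\<lambda>s. a s t) (\<lambda>k s. j k s t)" for t
    define Q where "Q = P i [^] e"
    have c_eq: "c t = (\<Oplus>s\<in>{1..l t}. a s t \<otimes> p t s)" for t by (simp add: c_def p_def coeff_sum_def)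
    note pp = power_product_facts[of i, OF Pk]
    have pR: "p t s \<in> R" "p t s \<noteq> \<zero>" "p t s \<in> carrier K" for t s
      using pp(2,3) R_carr by (auto simp: p_def)
    have Q: "Q \<in> carrier K" "Q \<noteq> \<zero>" "Q \<in> R" using Pi R_pow by (auto simp: Q_def)
    have Qpow: "P i [^] (t * e) = Q [^] t" for t
      using Pi by (simp add: Q_def nat_pow_pow mult.commute)
    \<comment> \<open>Removing the factor \<open>P i [^] (t * e)\<close> from the prescribed value
      \<open>nmul (e * D) (v i)\<close> leaves the value of \<open>U [^] (D - t)\<close>, the
      denominator prescribed for this coefficient.\<close>
    have vp: "\<nu> (p t s) = nmul (e * (D - t)) (v i)" if "t < D" "s \<in> {1..l t}" for t s
    proof -
      have "nmul (e * D) (v i) = \<nu> (p t s) + nmul (t * e) (v i)"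
        using terms[OF that] pR Pi by (simp add: val_mult val_pow p_def v_def)
      moreover have "nmul (e * D - t * e) (v i) = nmul (e * D) (v i) - nmul (t * e) (v i)"
        using that by (intro nmul_diff) (simp add: mult.commute)
      moreover have "e * D - t * e = e * (D - t)" by (simp add: diff_mult_distrib2 mult.commute)
      ultimately show ?thesis by simp
    qed
    have aR: "a s t \<in> R" if "t < D" "s \<in> {1..l t}" for t s using terms[OF that] CS_R by blast
    have cR: "c t \<in> R" if "t < D" for t
      unfolding c_eq using aR[OF that] pR by (intro R_finsum R_ops) auto
    have vUp: "\<nu> (U [^] k) = nmul (e * k) (v i)" for k
      using U vU by (simp add: val_pow nmul_mult[symmetric] mult.commute)
    have cge: "c t \<in> Kge (\<nu> (U [^] (D - t)))" if "t < D" for t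
      unfolding c_eq
    proof (rule Kge_finsum)
      fix s assume s: "s \<in> {1..l t}"
      have "p t s \<in> Kge (nmul (e * (D - t)) (v i))" using vp[OF that s] pR by (simp add: Kge_iff)
      from Kge_mult[OF R_Kge[OF aR[OF that s]] this] show "a s t \<otimes> p t s \<in> Kge (\<nu> (U [^] (D - t)))"
        by (simp add: vUp)
    qed simp
    have Qge: "Q \<in> Kge (\<nu> U)" using Pe by (simp add: Q_def)
    note Qp = lres_pow[OF U(2,3) Qge]
    have Up: "U [^] k \<in> carrier K" "U [^] k \<noteq> \<zero>" for k :: nat using U by auto
    have Usplit: "U [^] (D - t) \<otimes> U [^] t = U [^] D" if "t < D" for t
      using that U by (simp add: nat_pow_mult)
    have vsplit: "\<nu> (U [^] D) = \<nu> (U [^] (D - t)) + \<nu> (U [^] t)" if "t < D" for t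
      using Usplit[OF that] Up val_mult[of "U [^] (D - t)" "U [^] t"] by simp
    have term_ge: "c t \<otimes> Q [^] t \<in> Kge (\<nu> (U [^] D))" if "t < D" for t
      using Kge_mult[OF cge[OF that]] Qp[of t] vsplit[OF that] by simp
    let ?p = "ring.Irr k\<nu> (FF i) (\<alpha> i)"
    have term_lres: "lres (U [^] D) (c t \<otimes> Q [^] t) = ring.coeff k\<nu> ?p t \<otimes>\<^bsub>k\<nu>\<^esub> \<alpha> i [^]\<^bsub>k\<nu>\<^esub> t" if "t < D" for t
    proof -
      have "lres (U [^] D) (c t \<otimes> Q [^] t) = lres (U [^] (D - t)) (c t) \<otimes>\<^bsub>k\<nu>\<^esub> lres (U [^] t) (Q [^] t)"
        using lres_mult[OF Up Up cge[OF that], of "Q [^] t" t] Qp[of t] Usplit[OF that] by simp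
      also have "lres (U [^] (D - t)) (c t) = ring.coeff k\<nu> ?p t"
        using co[OF that] by (simp add: lres_def c_def)
      finally show ?thesis using Qp[of t] by (simp add: al Q_def)
    qed
    have PS': "P (Suc i) = Q [^] D \<oplus> (\<Oplus>t\<in>{..<D}. c t \<otimes> Q [^] t)"
      unfolding PS c_def Qpow using Pi by (simp add: Q_def nat_pow_pow)
    have sum_ge: "(\<Oplus>t\<in>{..<D}. c t \<otimes> Q [^] t) \<in> Kge (\<nu> (U [^] D))"
      by (rule Kge_finsum) (auto simp: term_ge)
    have PSge: "P (Suc i) \<in> Kge (\<nu> (U [^] D))"
      unfolding PS' using Qp sum_ge by (simp add: Kge_add)
    note A = good_gens[OF g]
    have dd: "field_degree k\<nu> (generate_field k\<nu> ((rs ` R \<union> \<alpha> ` {1..<i}) \<union> {\<alpha> i})) (generate_field k\<nu> (rs ` R \<union> \<alpha> ` {1..<i})) = enat D"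
      unfolding FF_gen[symmetric] FF_Suc[OF i(1), symmetric] using d D by simp
    note Irr = kf.Irr_relation[OF A alc dd, folded FF_gen]
    have cc: "ring.coeff k\<nu> ?p t \<in> carrier k\<nu>" for t
      using Irr(2)[of t] FF_subfield[of i] subfieldE(3) g by (auto simp: good_def)
    have "lres (U [^] D) (P (Suc i)) = \<alpha> i [^]\<^bsub>k\<nu>\<^esub> D \<oplus>\<^bsub>k\<nu>\<^esub> (\<Oplus>\<^bsub>k\<nu>\<^esub>t\<in>{..<D}. lres (U [^] D) (c t \<otimes> Q [^] t))"
      unfolding PS' using lres_add[OF Up _ sum_ge, of "Q [^] D"] Qp[of D] lres_finsum[OF _ Up, of "{..<D}" "\<lambda>t. c t \<otimes> Q [^] t" D] term_ge
      by (simp add: al Q_def)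
    also have "(\<Oplus>\<^bsub>k\<nu>\<^esub>t\<in>{..<D}. lres (U [^] D) (c t \<otimes> Q [^] t)) = (\<Oplus>\<^bsub>k\<nu>\<^esub>t\<in>{..<D}. ring.coeff k\<nu> ?p t \<otimes>\<^bsub>k\<nu>\<^esub> \<alpha> i [^]\<^bsub>k\<nu>\<^esub> t)"
      using cc alc by (intro kf.finsum_cong') (auto simp: term_lres)
    also have "\<alpha> i [^]\<^bsub>k\<nu>\<^esub> D \<oplus>\<^bsub>k\<nu>\<^esub> \<dots> = \<zero>\<^bsub>k\<nu>\<^esub>"
      using Irr(1) cc alc by (simp add: kf.a_comm Pi_def)
    finally have PSgt: "P (Suc i) \<in> Kgt (\<nu> (U [^] D))" using lres_zero_iff[OF Up PSge] by simp
    have D1: "1 \<le> D" using kf.field_degree_ge_1[OF A alc] dd by (simp add: one_enat_def)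
    have nni: "n i = enat (e * D)" "nn i = e * D" using n e D by (simp_all add: nn_def)
    \<comment> \<open>Without \<open>x\<close> the monomial would have value below
      \<open>v i\<close>, yet it has \<open>e * (D - t) \<ge> 1\<close> copies of it.\<close>
    have px: "\<exists>h\<in>R. p t s = h \<otimes> x" if ts: "t < D" "s \<in> {1..l t}" for t s
    proof -
      have "j 0 s t \<noteq> 0"
      proof
        assume j0: "j 0 s t = 0"
        have "{..<i} = insert 0 {1..<i}" using i by auto
        then have "\<nu> (p t s) = (\<Sum>k\<in>{1..<i}. nmul (j k s t) (v k))"
          unfolding p_def using pp(4)[of "\<lambda>k. j k s t"] j0 by simp
        also have "\<dots> < v i"
        proof (rule weighted_sum_less[OF g _ i(1)])
          show "j k s t < nn k" if "k \<in> {1..<i}" for k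
            using terms[OF ts] that g by (auto simp: good_def)
        qed simp
        also have "v i \<le> nmul (e * (D - t)) (v i)"
          using nmul_mono_left[of "v i" 1 "e * (D - t)"] Pi e0 ts by (simp add: Suc_le_eq)
        finally show False using vp[OF ts] by simp
      qed
      then show ?thesis unfolding p_def using pp(5)[of "\<lambda>k. j k s t"] i by auto
    qed
    have cx: "\<exists>h\<in>R. c t = h \<otimes> x" if t: "t < D" for t
      unfolding c_eq
    proof (rule Rx_finsum)
      fix s assume s: "s \<in> {1..l t}"
      obtain h where h: "h \<in> R" "p t s = h \<otimes> x" using px[OF t s] by blast
      then have "a s t \<otimes> p t s = (a s t \<otimes> h) \<otimes> x" using aR[OF t s] R_carr by (simp add: m_assoc)
      then show "\<exists>h\<in>R. a s t \<otimes> p t s = h \<otimes> x" using R_ops(4) aR[OF t s] h(1) by blast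
    qed simp
    have "\<exists>h\<in>R. (\<Oplus>t\<in>{..<D}. c t \<otimes> Q [^] t) = h \<otimes> x"
    proof (rule Rx_finsum)
      fix t assume t: "t \<in> {..<D}"
      obtain h where h: "h \<in> R" "c t = h \<otimes> x" using cx t by blast
      then have "c t \<otimes> Q [^] t = (Q [^] t \<otimes> h) \<otimes> x" using Q R_carr by (simp add: m_ac)
      then show "\<exists>h\<in>R. c t \<otimes> Q [^] t = h \<otimes> x" using R_ops(4) R_pow[OF Q(3)] h(1) by blast
    qed simp
    then obtain h1 where h1: "h1 \<in> R" "(\<Oplus>t\<in>{..<D}. c t \<otimes> Q [^] t) = h1 \<otimes> x" by blast
    have "i \<in> {1..i}" using i by simp
    with g obtain h2 where h2: "h2 \<in> R" "P i = y [^] dg i \<oplus> h2 \<otimes> x" unfolding good_def by blast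
    obtain h3 where h3: "h3 \<in> R" "P i [^] (e * D) = y [^] (e * D * dg i) \<oplus> h3 \<otimes> x"
      using pow_mod_x[OF h2(1), of "dg i" "e * D"] h2(2) by auto
    have hc: "h1 \<in> carrier K" "h3 \<in> carrier K" using h1 h3 R_carr by auto
    have dgS: "dg (Suc i) = e * D * dg i" using i nni by simp
    have yc: "y [^] (e * D * dg i) \<in> carrier K" by simp
    have "P (Suc i) = (y [^] (e * D * dg i) \<oplus> h3 \<otimes> x) \<oplus> h1 \<otimes> x"
      unfolding PS' h1(2) h3(2)[symmetric] using Pi by (simp add: Q_def nat_pow_pow)
    also have "\<dots> = y [^] (e * D * dg i) \<oplus> (h3 \<oplus> h1) \<otimes> x"
      using hc yc xy_carr(1) by algebra
    finally have PSx: "P (Suc i) = y [^] dg (Suc i) \<oplus> (h3 \<oplus> h1) \<otimes> x" by (simp only: dgS)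
    have h31: "h3 \<oplus> h1 \<in> R" using h1 h3 R_ops by blast
    have PSR: "P (Suc i) \<in> R" unfolding PSx by (intro R_ops(4,5) R_pow yR xR h31)
    have PSn: "P (Suc i) \<noteq> \<zero>"
    proof
      assume "P (Suc i) = \<zero>"
      then have z: "y [^] dg (Suc i) \<oplus> (h3 \<oplus> h1) \<otimes> x = \<zero>" using PSx by simp
      have "y [^] dg (Suc i) = \<ominus> ((h3 \<oplus> h1) \<otimes> x)"
        using minus_equality[OF z] R_carr[OF h31] by simp
      also have "\<dots> = (\<ominus> (h3 \<oplus> h1)) \<otimes> x" using R_carr[OF h31] by (simp only: l_minus xy_carr(1))
      finally show False using y_pow_neq R_ops(3)[OF h31] by blast
    qed
    have vlt: "nmul (nn i) (v i) < v (Suc i)" using PSgt PSn by (simp add: Kgt_iff vUp nni v_def)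
    moreover have "0 \<le> nmul (nn i) (v i)" using Pi by (intro nmul_nonneg) simp
    ultimately have vpos: "0 < v (Suc i)" by (rule le_less_trans[rotated])
    have "1 \<le> nn i" using e0 D1 by (simp add: nni Suc_le_eq)
    have ex: "\<exists>h\<in>R. P (Suc i) = y [^] dg (Suc i) \<oplus> h \<otimes> x" using PSx h31 by blast
    note g' = g[unfolded good_def]
    show "good (Suc i)"
      unfolding good_def
    proof (intro conjI)
      show "\<forall>k\<le>Suc i. P k \<in> R \<and> P k \<noteq> \<zero> \<and> 0 < v k"
        using g' PSR PSn vpos by (simp add: le_Suc_eq)
      show "\<forall>k\<in>{1..Suc i}. \<exists>h\<in>R. P k = y [^] dg k \<oplus> h \<otimes> x"
        using g' ex by (metis atLeastAtMost_iff le_Suc_eq)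
      show "\<forall>k\<in>{1..<Suc i}. nmul (nn k) (v k) < v (Suc k) \<and> n k = enat (nn k) \<and> 1 \<le> nn k \<and> \<alpha> k \<in> carrier k\<nu>"
        using g' vlt nni alc \<open>1 \<le> nn i\<close> by (auto simp: less_Suc_eq)
      show "admissible (SS (Suc i)) (FF (Suc i))" using good_imp_admissible(2)[OF i(1) i' g] .
    qed
  qed
qed

lemma good_all: "1 \<le> i \<Longrightarrow> enat i \<le> \<Omega> \<Longrightarrow> good i"
proof (induction i)
  case (Suc i)
  show ?case
  proof (cases "i = 0")
    case True
    then show ?thesis using good_1 by simp
  next
    case False
    have "enat i < \<Omega>" using Suc(3) by (metis Suc_ile_eq)
    then show ?thesis using good_step[of i] Suc(1) False by simp
  qed
qed simp

section \<open>Reduced monomials\<close>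

lemma P_good: "enat k \<le> \<Omega> \<Longrightarrow> P k \<in> R \<and> P k \<in> carrier K \<and> P k \<noteq> \<zero> \<and> 0 < v k"
proof (cases "k = 0")
  case True
  then show ?thesis using good_P[OF good_1, of 0] by simp
next
  case False
  moreover assume "enat k \<le> \<Omega>"
  ultimately show ?thesis using good_P[OF good_all, of k k] by simp
qed

lemma adm: assumes "enat i \<le> \<Omega>" shows "admissible (SS (Suc i)) (FF (Suc i))"
proof (cases "i = 0")
  case True
  then show ?thesis using good_1 by (simp add: good_def)
next
  case False
  then show ?thesis using good_imp_admissible(2)[OF _ assms good_all] assms by simp
qed

lemma SS_sub: "enat i \<le> \<Omega> \<Longrightarrow> SS (Suc i) \<subseteq> carrier K - {\<zero>}"
  and FF_sf: "enat i \<le> \<Omega> \<Longrightarrow> subfield (FF (Suc i)) k\<nu>"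
  using adm by (auto simp: admissible_def)

lemma \<alpha>_carr: "1 \<le> i \<Longrightarrow> enat i \<le> \<Omega> \<Longrightarrow> \<alpha> i \<in> carrier k\<nu>"
  using good_imp_admissible(1) good_all by simp

lemma enat_le_trans: "enat i \<le> \<Omega> \<Longrightarrow> j \<le> i \<Longrightarrow> enat j \<le> \<Omega>"
  using order_trans[of "enat j" "enat i" \<Omega>] by simp

lemma FF_le: "i \<le> j \<Longrightarrow> enat j \<le> \<Omega> \<Longrightarrow> FF (Suc i) \<subseteq> FF (Suc j)"
  using \<alpha>_carr enat_le_trans by (intro FF_mono) auto

lemma SS_mono: "i \<le> j \<Longrightarrow> SS i \<subseteq> SS j"
  by (auto simp: SS_def)

lemma gens_carr: "enat i \<le> \<Omega> \<Longrightarrow> rs ` R \<union> \<alpha> ` {1..<Suc i} \<subseteq> carrier k\<nu>"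
  using \<alpha>_carr enat_le_trans rsR_sub by auto

lemma step_good: assumes "1 \<le> k" "enat k < \<Omega>"
  shows "nmul (nn k) (v k) < v (Suc k)" "n k = enat (nn k)" "1 \<le> nn k"
proof -
  have "enat (Suc k) \<le> \<Omega>" using assms(2) by (simp add: Suc_ile_eq)
  then have "good (Suc k)" using good_all by simp
  then show "nmul (nn k) (v k) < v (Suc k)" "n k = enat (nn k)" "1 \<le> nn k"
    using assms(1) by (auto simp: good_def)
qed

lemma step_index:
  assumes "1 \<le> i" "enat i \<le> \<Omega>"
  shows "nb i = enat e \<Longrightarrow> 0 < e \<and> (\<forall>k. nmul k (v i) \<in> \<nu> ` mon_group (SS i) \<longrightarrow> e dvd k)"
    and "nb i = \<infinity> \<Longrightarrow> nmul k (v i) \<in> \<nu> ` mon_group (SS i) \<Longrightarrow> k = 0"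
proof -
  have "SS i \<subseteq> carrier K - {\<zero>}" using SS_sub[of "i - 1"] assms enat_le_trans[of i "i - 1"] by simp
  note idx = group_index_cyclic[of "v i" "\<nu> ` SS i", folded nb_eq[OF assms] val_mon_group[OF this]]
  show "nb i = enat e \<Longrightarrow> 0 < e \<and> (\<forall>k. nmul k (v i) \<in> \<nu> ` mon_group (SS i) \<longrightarrow> e dvd k)"
    and "nb i = \<infinity> \<Longrightarrow> nmul k (v i) \<in> \<nu> ` mon_group (SS i) \<Longrightarrow> k = 0"
    using idx by blast+
qed

lemma step_U:
  assumes "1 \<le> i" "enat i \<le> \<Omega>" "nb i = enat e"
  obtains w U where "U = power_product K P i w" "\<forall>k\<in>{1..<i}. enat (w k) < n k"
    "U \<in> mon_group (SS i)" "U \<in> carrier K" "U \<noteq> \<zero>" "\<nu> U = nmul e (v i)" "\<alpha> i = lres U (P i [^] e)"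
    "P i [^] e \<in> Kge (\<nu> U)"
    "d i = field_degree k\<nu> (FF (Suc i)) (FF i)" "n i = nb i * d i"
proof -
  show thesis
  proof (rule step_finite[OF assms(1,2) good_all[OF assms(1,2)] assms(3)], goal_cases)
  case (1 w U)
  have "n i = nb i * d i"
  proof (cases "d i = \<infinity>")
    case True
    \<comment> \<open>Positivity of \<open>e\<close> matters: in \<open>enat\<close> zero times
      \<infinity> is zero.\<close>
    have "enat e * \<infinity> = \<infinity>" using step_index(1)[OF assms] by (simp add: times_enat_def zero_enat_def)
    then show ?thesis using 1(11)[OF True] assms(3) True by simp
  next
    case False
    show ?thesis using 1(12)[OF False] by blast
  qed
  with 1(1-8,10) show ?case by (rule that)
  qed
qed

text \<open>
  The combinations, with coefficients in \<open>CS\<close>, of the monomials of value \<open>\<phi>\<close> in \<open>P 0, \<dots>, P i\<close> whose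
  exponent at \<open>P k\<close> is less than \<open>n k\<close> for all \<open>k \<ge> 1\<close>.
\<close>

primrec std :: "nat \<Rightarrow> 'g \<Rightarrow> 'a set" where
  "std 0 \<phi> = insert \<zero> {c \<otimes> x [^] a | c a. c \<in> CS \<and> nmul a (\<nu> x) = \<phi>}"
| "std (Suc i) \<phi> = {\<Oplus>j\<in>{..<J}. B j \<otimes> P (Suc i) [^] j | B J.
     enat J \<le> n (Suc i) \<and> (\<forall>j<J. B j \<in> std i (\<phi> - nmul j (v (Suc i))))}"

lemma std_R: "enat i \<le> \<Omega> \<Longrightarrow> B \<in> std i \<phi> \<Longrightarrow> B \<in> R"
proof (induction i arbitrary: \<phi> B)
  case 0
  then show ?case using R_ops CS_R R_pow[OF xR] by auto
next
  case (Suc i)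
  then obtain C J where B: "B = (\<Oplus>j\<in>{..<J}. C j \<otimes> P (Suc i) [^] j)"
    "\<forall>j<J. C j \<in> std i (\<phi> - nmul j (v (Suc i)))" by auto
  have "C j \<in> R" if "j < J" for j using Suc(1)[OF _ B(2)[rule_format, OF that]] enat_le_trans[OF Suc(2), of i] by simp
  moreover have "P (Suc i) [^] j \<in> R" for j :: nat using P_good[OF Suc(2)] R_pow by blast
  ultimately show ?case unfolding B(1) by (intro R_finsum R_ops) auto
qed

lemma std_homog: "enat i \<le> \<Omega> \<Longrightarrow> B \<in> std i \<phi> \<Longrightarrow> B \<in> homog (SS (Suc i)) (FF (Suc i)) \<phi>"
proof (induction i arbitrary: \<phi> B)
  case 0
  show ?case
  proof (cases "B = \<zero>")
    case False
    then obtain c a where *: "B = c \<otimes> x [^] a" "c \<in> CS" "nmul a (\<nu> x) = \<phi>" using 0(2) by auto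
    have "c \<in> homog (SS 1) (FF 1) 0" using CS_R[OF *(2)] R_Kge rsR_FF by (intro homog_scalar) auto
    moreover have "x \<in> SS 1" by (simp add: SS_def P_0)
    then have "x [^] a \<in> homog (SS 1) (FF 1) (nmul a (\<nu> x))"
      using adm[OF 0(1)] by (intro homog_pow homog_gen) simp_all
    ultimately show ?thesis using homog_mult[OF adm[OF 0(1)], of c 0 "x [^] a" \<phi>] * by simp
  qed simp
next
  case (Suc i)
  then obtain C J where B: "B = (\<Oplus>j\<in>{..<J}. C j \<otimes> P (Suc i) [^] j)"
    "\<forall>j<J. C j \<in> std i (\<phi> - nmul j (v (Suc i)))" by auto
  have i: "enat i \<le> \<Omega>" using enat_le_trans[OF Suc(2), of i] by simp
  let ?H = "homog (SS (Suc (Suc i))) (FF (Suc (Suc i)))"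
  show ?case unfolding B(1)
  proof (rule homog_finsum[OF adm[OF Suc(2)]])
    fix j assume j: "j \<in> {..<J}"
    have "C j \<in> homog (SS (Suc i)) (FF (Suc i)) (\<phi> - nmul j (v (Suc i)))" using Suc(1)[OF i, of "C j"] B(2) j by simp
    then have "C j \<in> ?H (\<phi> - nmul j (v (Suc i)))"
      using homog_mono[OF SS_mono FF_le[OF _ Suc(2)], of "Suc i" "Suc (Suc i)" i] by auto
    moreover have "P (Suc i) [^] j \<in> ?H (nmul j (v (Suc i)))"
      using homog_pow[OF adm[OF Suc(2)] homog_gen[OF adm[OF Suc(2)], of "P (Suc i)"]] by (simp add: SS_Suc v_def)
    ultimately show "C j \<otimes> P (Suc i) [^] j \<in> ?H \<phi>"
      using homog_mult[OF adm[OF Suc(2)]] by fastforce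
  qed simp
qed

text \<open>Rewrites a sum over the exponents of \<open>P q\<close> in one residue class modulo
  \<open>e\<close> as a polynomial in \<open>t\<close>. The bound \<open>T\<close> may be generous,
  since absent terms count as zero.\<close>

lemma (in abelian_monoid) finsum_progression:
  fixes J r e T :: nat
  assumes "\<And>j. j < J \<Longrightarrow> g j \<in> carrier G"
    and "\<And>j. j < J \<Longrightarrow> (\<nexists>t. j = r + t * e) \<Longrightarrow> g j = \<zero>"
    and "0 < e" and "\<And>t. r + t * e < J \<Longrightarrow> t < T"
  shows "(\<Oplus>j\<in>{..<J}. g j) = (\<Oplus>t\<in>{..<T}. if r + t * e < J then g (r + t * e) else \<zero>)"
proof -
  define A where "A = {t. t < T \<and> r + t * e < J}"
  have inj: "inj_on (\<lambda>t. r + t * e) A" using assms(3) by (auto simp: inj_on_def)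
  have sub: "(\<lambda>t. r + t * e) ` A \<subseteq> {..<J}" by (auto simp: A_def)
  have "(\<Oplus>j\<in>{..<J}. g j) = (\<Oplus>j\<in>(\<lambda>t. r + t * e) ` A. g j)"
  proof (rule add.finprod_mono_neutral_cong_left[symmetric])
    fix j assume "j \<in> {..<J} - (\<lambda>t. r + t * e) ` A"
    then show "g j = \<zero>" using assms(2,4) by (force simp: A_def)
  qed (use sub assms(1) in auto)
  also have "\<dots> = (\<Oplus>t\<in>A. g (r + t * e))"
    using sub assms(1) inj by (intro finsum_reindex) auto
  also have "\<dots> = (\<Oplus>t\<in>{..<T}. if r + t * e < J then g (r + t * e) else \<zero>)"
    by (rule add.finprod_mono_neutral_cong_left) (auto simp: A_def assms(1))
  finally show ?thesis .
qed

text \<open>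
  The terms that occur have exponents \<open>j\<close> in a single class modulo the index \<open>nb (i + 1)\<close>, so a
  cancellation would yield a relation of degree less than \<open>d (i + 1)\<close> for \<open>\<alpha> (i + 1)\<close> over
  \<open>FF (i + 1)\<close>.
\<close>

lemma std_sum_leading:
  fixes J :: nat
  assumes q\<Omega>: "enat (Suc i) \<le> \<Omega>" and J': "enat J \<le> n (Suc i)"
    and C': "\<And>j. j < J \<Longrightarrow> C j \<in> std i (\<phi> - nmul j (v (Suc i)))"
    and IH': "\<And>j. j < J \<Longrightarrow> C j \<noteq> \<zero> \<Longrightarrow> \<nu> (C j) = \<phi> - nmul j (v (Suc i)) \<and>
      \<phi> - nmul j (v (Suc i)) \<in> \<nu> ` mon_group (SS (Suc i))"
    and j0: "j0 < J" "C j0 \<noteq> \<zero>"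
  shows "\<phi> \<in> \<nu> ` mon_group (SS (Suc (Suc i))) \<and> (\<Oplus>j\<in>{..<J}. C j \<otimes> P (Suc i) [^] j) \<in> Kge \<phi> - Kgt \<phi>"
proof -
  define q where "q = Suc i"
  define B where "B = (\<Oplus>j\<in>{..<J}. C j \<otimes> P q [^] j)"
  have q: "1 \<le> q" "enat q \<le> \<Omega>" using q\<Omega> by (auto simp: q_def)
  note J = J'[folded q_def] note C = C'[folded q_def] note IH = IH'[folded q_def]
  have B: "B = (\<Oplus>j\<in>{..<J}. C j \<otimes> P q [^] j)" by (simp add: B_def)
  have Bstd: "B \<in> std (Suc i) \<phi>" using J' C' by (auto simp: B_def q_def)
  have i: "enat i \<le> \<Omega>" using enat_le_trans[OF q\<Omega>, of i] by simp
  have Pq: "P q \<in> carrier K" "P q \<noteq> \<zero>" using P_good[OF q(2)] by auto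
  have Cc: "C j \<in> carrier K" if "j < J" for j using std_R[OF i C[OF that]] R_carr by simp
  have S: "SS q \<subseteq> carrier K - {\<zero>}" using SS_sub[OF i] by (simp add: q_def)
  have S': "SS (Suc q) \<subseteq> carrier K - {\<zero>}" using SS_sub[OF q(2)] .
  have Sq: "SS (Suc q) = insert (P q) (SS q)" by (simp add: SS_Suc)
  obtain W0 where W0: "W0 \<in> mon_group (SS q)" "\<nu> W0 = \<phi> - nmul j0 (v q)" using IH[OF j0] by auto
  have W0c: "W0 \<in> carrier K" "W0 \<noteq> \<zero>" using mon_group_carrier[OF S W0(1)] by auto
  have grp: "subgroup (\<nu> ` mon_group (SS q)) add_group"
    using generate_add_subgroup val_mon_group[OF S] by metis
  have "W0 \<otimes> P q [^] j0 \<in> mon_group (SS (Suc q))"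
    using mon_group_mono[OF _ W0(1), of "SS (Suc q)"] mon_group_incl[OF S', of "P q"] Sq
    by (intro mon_group_mult[OF S'] mon_group_pow[OF S']) auto
  moreover have "\<nu> (W0 \<otimes> P q [^] j0) = \<phi>" using W0 W0c Pq by (simp add: val_mult val_pow v_def)
  ultimately have \<phi>: "\<phi> \<in> \<nu> ` mon_group (SS (Suc q))" by force
  have Bge: "B \<in> Kge \<phi>" using std_homog[OF q\<Omega> Bstd] homog_Kge by blast
  have term_ge: "C j \<otimes> P q [^] j \<in> Kge \<phi>" if "j < J" for j
  proof -
    have "C j \<in> Kge (\<phi> - nmul j (v q))" using std_homog[OF i C[OF that]] homog_Kge by blast
    moreover have "P q [^] j \<in> Kge (nmul j (v q))" using Pq by (simp add: Kge_iff val_pow v_def)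
    ultimately show ?thesis using Kge_mult by fastforce
  qed
  have diff: "nmul (j - k) (v q) \<in> \<nu> ` mon_group (SS q)" if "j < J" "C j \<noteq> \<zero>" "k < J" "C k \<noteq> \<zero>" "k \<le> j" for j k
    using subgroup_minus[OF grp, of "\<phi> - nmul k (v q)" "\<phi> - nmul j (v q)"] IH[OF that(1,2)] IH[OF that(3,4)] that(5)
    by (simp add: nmul_diff)
  have "B \<notin> Kgt \<phi>"
  proof (cases "nb q")
    case infinity
    \<comment> \<open>By \<open>diff\<close>, the difference of two occurring exponents times
      \<open>v q\<close> is the value of an earlier monomial; with infinite index that difference is
      zero, so a single term remains.\<close>
    have zero: "C j = \<zero>" if "j < J" "j \<noteq> j0" for j
    proof (rule ccontr)
      assume "C j \<noteq> \<zero>"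
      then have "j0 \<le> j \<Longrightarrow> j - j0 = 0" "j \<le> j0 \<Longrightarrow> j0 - j = 0"
        using diff[OF that(1) _ j0] diff[OF j0 that(1)] step_index(2)[OF q infinity] by blast+
      then show False using that(2) by linarith
    qed
    have "B = (\<Oplus>j\<in>{..<J}. if j0 = j then C j \<otimes> P q [^] j else \<zero>)"
      unfolding B using zero Cc Pq by (intro finsum_cong') auto
    also have "\<dots> = C j0 \<otimes> P q [^] j0" using j0 Cc Pq by (intro add.finprod_singleton) auto
    finally have "\<nu> B = \<phi> \<and> B \<noteq> \<zero>" using IH[OF j0] j0 Cc Pq by (simp add: val_mult val_pow v_def)
    then show ?thesis by (simp add: Kgt_iff)
  next
    case (enat e)
    obtain w U where U: "U \<in> mon_group (SS q)" "U \<in> carrier K" "U \<noteq> \<zero>" "\<nu> U = nmul e (v q)"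
      "\<alpha> q = lres U (P q [^] e)" "P q [^] e \<in> Kge (\<nu> U)"
      "d q = field_degree k\<nu> (FF (Suc q)) (FF q)" "n q = nb q * d q"
      by (rule step_U[OF q enat]) (rule that, assumption+)
    note idx = step_index(1)[OF q enat]
    define r where "r = j0 mod e"
    define t0 where "t0 = j0 div e"
    have j0_eq: "j0 = r + t0 * e" by (simp add: r_def t0_def)
    have zero: "C j = \<zero>" if "j < J" "\<nexists>t. j = r + t * e" for j
    proof (rule ccontr)
      assume "C j \<noteq> \<zero>"
      then have "e dvd j - j0" "e dvd j0 - j"
        using diff[of j j0] diff[of j0 j] that(1) j0 idx by (metis diff_is_0_eq dvd_0_right nat_le_linear)+
      then have "j mod e = r" unfolding r_def by (metis mod_eq_dvd_iff_nat nat_le_linear)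
      then have "j = r + (j div e) * e" using div_mult_mod_eq[of j e] by (simp add: add.commute)
      then show False using that(2) by blast
    qed
    \<comment> \<open>The common denominator will be \<open>Wf = W \<otimes> P q [^] r\<close>, of
      value \<open>\<phi>\<close>. It factors as \<open>Wt t\<close> times
      \<open>U [^] t \<otimes> P q [^] r\<close>, so the residue of each term splits into that of
      its coefficient and \<open>\<alpha> q\<close> to the power \<open>t\<close>.\<close>
    define W where "W = W0 \<otimes> U [^] t0"
    have W: "W \<in> mon_group (SS q)" unfolding W_def by (intro mon_group_mult[OF S W0(1)] mon_group_pow[OF S U(1)])
    have Wc: "W \<in> carrier K" "W \<noteq> \<zero>" using mon_group_carrier[OF S W] by auto
    have Upow: "\<nu> (U [^] t) = nmul (t * e) (v q)" for t using U by (simp add: val_pow nmul_mult)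
    have vW: "\<nu> W = \<phi> - nmul r (v q)"
      using W0c U W0(2) Upow[of t0] j0_eq nmul_add[of r "t0 * e" "v q"] by (simp add: W_def val_mult algebra_simps)
    define Wf where "Wf = W \<otimes> P q [^] r"
    have Wf: "Wf \<in> carrier K" "Wf \<noteq> \<zero>" "\<nu> Wf = \<phi>" using Wc Pq vW by (auto simp: Wf_def val_mult val_pow v_def)
    define Wt where "Wt t = W \<otimes> inv (U [^] t)" for t :: nat
    have Ut: "U [^] t \<in> carrier K" "U [^] t \<noteq> \<zero>" for t :: nat using U by auto
    have Wt: "Wt t \<in> mon_group (SS q)" for t
      unfolding Wt_def by (intro mon_group_mult[OF S W] mon_group_inv[OF S] mon_group_pow[OF S U(1)])
    have Wtc: "Wt t \<in> carrier K" "Wt t \<noteq> \<zero>" for t using mon_group_carrier[OF S Wt] by auto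
    have vWt: "\<nu> (Wt t) = \<phi> - nmul (r + t * e) (v q)" for t
      using Wc Ut vW Upow[of t] by (simp add: Wt_def val_mult val_inv nmul_add algebra_simps)
    define \<beta> where "\<beta> t = (if r + t * e < J then lres (Wt t) (C (r + t * e)) else \<zero>\<^bsub>k\<nu>\<^esub>)" for t
    have \<beta>F: "\<beta> t \<in> FF q" for t
    proof -
      have "lres (Wt t) (C (r + t * e)) \<in> FF q" if "r + t * e < J"
        using homog_lres[OF adm[OF i] std_homog[OF i C[OF that]]] Wt vWt by (simp add: q_def)
      then show ?thesis using subringE(2)[OF subfieldE(1)[OF FF_sf[OF i]]] by (simp add: \<beta>_def q_def)
    qed
    have Fc: "FF q \<subseteq> carrier k\<nu>" using subfieldE(3)[OF FF_sf[OF i]] by (simp add: q_def)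
    have \<alpha>c: "\<alpha> q \<in> carrier k\<nu>" using \<alpha>_carr[OF q] .
    have term_lres: "lres Wf (C (r + t * e) \<otimes> P q [^] (r + t * e)) = \<beta> t \<otimes>\<^bsub>k\<nu>\<^esub> \<alpha> q [^]\<^bsub>k\<nu>\<^esub> t" if t: "r + t * e < J" for t
    proof -
      define Q where "Q = P q [^] e"
      have Qc: "Q \<in> carrier K" "Q \<noteq> \<zero>" using Pq by (auto simp: Q_def)
      have Cge: "C (r + t * e) \<in> Kge (\<nu> (Wt t))" using homog_Kge[OF std_homog[OF i C[OF t]]] vWt by simp
      note Qp = lres_pow[OF U(2,3,6), folded Q_def, of t]
      have Pr: "P q [^] r \<in> carrier K" "P q [^] r \<noteq> \<zero>" "P q [^] r \<in> Kge (\<nu> (P q [^] r))" using Pq by (auto simp: Kge_iff)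
      have e1: "P q [^] (r + t * e) = Q [^] t \<otimes> P q [^] r"
        using Pq by (simp add: Q_def nat_pow_pow nat_pow_mult add.commute mult.commute)
      have "Wt t \<otimes> (U [^] t \<otimes> P q [^] r) = W \<otimes> (inv (U [^] t) \<otimes> U [^] t) \<otimes> P q [^] r"
        unfolding Wt_def using Wc(1) Ut(1)[of t] Pr(1) inv_closed'[OF Ut, of t]
        by (simp only: m_assoc m_closed)
      then have e2: "Wf = Wt t \<otimes> (U [^] t \<otimes> P q [^] r)" using Wc Ut[of t] by (simp add: Wf_def)
      have ge2: "Q [^] t \<otimes> P q [^] r \<in> Kge (\<nu> (U [^] t \<otimes> P q [^] r))"
        using Kge_mult[of "Q [^] t" _ "P q [^] r"] Qp Pr Ut[of t] by (simp add: val_mult)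
      have "lres Wf (C (r + t * e) \<otimes> P q [^] (r + t * e)) =
        lres (Wt t) (C (r + t * e)) \<otimes>\<^bsub>k\<nu>\<^esub> lres (U [^] t \<otimes> P q [^] r) (Q [^] t \<otimes> P q [^] r)"
        unfolding e1 e2 using lres_mult[OF Wtc _ _ Cge ge2] Ut[of t] Pr by simp
      also have "lres (U [^] t \<otimes> P q [^] r) (Q [^] t \<otimes> P q [^] r) = \<alpha> q [^]\<^bsub>k\<nu>\<^esub> t"
        using lres_mult[OF Ut Pr(1,2) _ Pr(3)] Qp lres_self[OF Pr(1,2)] \<alpha>c by (simp add: U(5) Q_def)
      finally show ?thesis using t by (simp add: \<beta>_def)
    qed
    \<comment> \<open>For finite degree \<open>D\<close>, exponents below \<open>e * D\<close> give
      \<open>t < D\<close>. For infinite degree any bound on \<open>t\<close> will do, and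
      \<open>J\<close> is one.\<close>
    obtain T where T: "enat T \<le> d q" "\<And>t. r + t * e < J \<Longrightarrow> t < T"
    proof (cases "d q")
      case (enat D)
      have "J \<le> e * D" using J U(8) \<open>nb q = enat e\<close> enat by simp
      then have "t < D" if "r + t * e < J" for t
        using that idx by (metis add_leD2 le_less_trans less_le_trans mult.commute mult_less_cancel1 nat_le_linear not_less)
      then show thesis using that[of D] enat by simp
    next
      case infinity
      have "t < J" if "r + t * e < J" for t
      proof -
        have "t * 1 \<le> t * e" using idx by (intro mult_le_mono2) (simp add: Suc_le_eq)
        then have "t \<le> t * e" by simp
        also have "\<dots> < J" using \<open>r + t * e < J\<close> by linarith
        finally show ?thesis .
      qed
      then show thesis using that[of J] infinity by simp
    qed
    show ?thesis
    proof
      assume "B \<in> Kgt \<phi>"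
      then have "lres Wf B = \<zero>\<^bsub>k\<nu>\<^esub>" using lres_zero_iff[OF Wf(1,2)] Wf(3) Bge by simp
      moreover have "lres Wf B = (\<Oplus>\<^bsub>k\<nu>\<^esub>j\<in>{..<J}. lres Wf (C j \<otimes> P q [^] j))"
        unfolding B using term_ge Wf by (intro lres_finsum) auto
      also have "\<dots> = (\<Oplus>\<^bsub>k\<nu>\<^esub>t\<in>{..<T}. if r + t * e < J then lres Wf (C (r + t * e) \<otimes> P q [^] (r + t * e)) else \<zero>\<^bsub>k\<nu>\<^esub>)"
      proof (rule kf.finsum_progression)
        show "lres Wf (C j \<otimes> P q [^] j) \<in> carrier k\<nu>" if "j < J" for j
          using lres_closed[OF Wf(1,2)] term_ge[OF that] Wf(3) by simp
        show "lres Wf (C j \<otimes> P q [^] j) = \<zero>\<^bsub>k\<nu>\<^esub>" if "j < J" "\<nexists>t. j = r + t * e" for j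
          using zero[OF that] Pq lres_zero_iff[OF Wf(1,2), of \<zero>] by simp
      qed (use idx T in auto)
      also have "\<dots> = (\<Oplus>\<^bsub>k\<nu>\<^esub>t\<in>{..<T}. \<beta> t \<otimes>\<^bsub>k\<nu>\<^esub> \<alpha> q [^]\<^bsub>k\<nu>\<^esub> t)"
      proof (rule kf.finsum_cong')
        fix t
        show "(if r + t * e < J then lres Wf (C (r + t * e) \<otimes> P q [^] (r + t * e)) else \<zero>\<^bsub>k\<nu>\<^esub>) =
          \<beta> t \<otimes>\<^bsub>k\<nu>\<^esub> \<alpha> q [^]\<^bsub>k\<nu>\<^esub> t" using term_lres[of t] \<alpha>c by (auto simp: \<beta>_def)
      qed (use \<beta>F Fc \<alpha>c in auto)
      ultimately have rel: "(\<Oplus>\<^bsub>k\<nu>\<^esub>t\<in>{..<T}. \<beta> t \<otimes>\<^bsub>k\<nu>\<^esub> \<alpha> q [^]\<^bsub>k\<nu>\<^esub> t) = \<zero>\<^bsub>k\<nu>\<^esub>" by simp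
      have t0: "t0 < T" using T(2) j0 j0_eq by simp
      have nz: "\<beta> t0 \<noteq> \<zero>\<^bsub>k\<nu>\<^esub>"
      proof -
        have "C j0 \<in> Kge (\<nu> (Wt t0))" "C j0 \<notin> Kgt (\<nu> (Wt t0))"
          using IH[OF j0] j0 Cc[OF j0(1)] vWt[of t0] j0_eq by (auto simp: Kge_iff Kgt_iff)
        then show ?thesis using lres_zero_iff[OF Wtc] j0(1) j0_eq by (simp add: \<beta>_def)
      qed
      have A: "rs ` R \<union> \<alpha> ` {1..<q} \<subseteq> carrier k\<nu>" using gens_carr[OF i] by (simp add: q_def)
      have "d q < enat T"
        using kf.relation_imp_field_degree_less[OF A \<alpha>c _ t0 nz rel] \<beta>F U(7)
        by (simp only: FF_gen[symmetric] FF_Suc[OF q(1), symmetric])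
      then show False using T(1) by simp
    qed
  qed
  then show ?thesis using Bge \<phi> by (simp add: B_def q_def)
qed

text \<open>Some coefficient of a nonzero \<open>B\<close> is nonzero, so
  \<open>std_sum_leading\<close> gives the inductive step. Membership in the group of monomial
  values is carried along because it supplies the denominators one level up.\<close>

theorem std_value:
  "enat i \<le> \<Omega> \<Longrightarrow> B \<in> std i \<phi> \<Longrightarrow> B \<noteq> \<zero> \<Longrightarrow> \<nu> B = \<phi> \<and> \<phi> \<in> \<nu> ` mon_group (SS (Suc i))"
proof (induction i arbitrary: \<phi> B)
  case 0
  then obtain c a where *: "B = c \<otimes> x [^] a" "c \<in> CS" "nmul a (\<nu> x) = \<phi>" by auto
  have c: "c \<in> carrier K" "c \<noteq> \<zero>" using * 0(3) CS_R R_carr by auto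
  have "\<nu> B = \<phi>" using * c x_nonzero CS_unit[OF *(2) c(2)] by (simp add: val_mult val_pow)
  moreover have "x [^] a \<in> mon_group (SS 1)"
    using SS_sub[OF 0(1)] mon_group_pow[OF _ mon_group_incl] by (simp add: SS_def P_0)
  moreover have "\<nu> (x [^] a) = \<phi>" using * x_nonzero by (simp add: val_pow)
  ultimately have "\<phi> \<in> \<nu> ` mon_group (SS (Suc 0))" by (metis One_nat_def image_eqI)
  with \<open>\<nu> B = \<phi>\<close> show ?case by blast
next
  case (Suc i)
  obtain C J where B: "B = (\<Oplus>j\<in>{..<J}. C j \<otimes> P (Suc i) [^] j)" and J: "enat J \<le> n (Suc i)"
    and C: "\<And>j. j < J \<Longrightarrow> C j \<in> std i (\<phi> - nmul j (v (Suc i)))" using Suc(3) by auto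
  have i: "enat i \<le> \<Omega>" using enat_le_trans[OF Suc(2), of i] by simp
  have "\<exists>j0<J. C j0 \<noteq> \<zero>"
  proof (rule ccontr)
    assume "\<not> (\<exists>j0<J. C j0 \<noteq> \<zero>)"
    then have "B = (\<Oplus>j\<in>{..<J}. \<zero>)" unfolding B using P_good[OF Suc(2)] by (intro finsum_cong') auto
    then show False using Suc(4) by simp
  qed
  then obtain j0 where j0: "j0 < J" "C j0 \<noteq> \<zero>" by blast
  then show ?case
    using std_sum_leading[OF Suc(2) J C Suc(1)[OF i C] j0] Suc(4) B by (auto simp: Kge_iff Kgt_iff)
qed

lemma std_sum_nonzero:
  fixes J :: nat
  assumes "enat (Suc i) \<le> \<Omega>" "enat J \<le> n (Suc i)"
    and "\<And>j. j < J \<Longrightarrow> C j \<in> std i (\<phi> - nmul j (v (Suc i)))" "j0 < J" "C j0 \<noteq> \<zero>"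
  shows "(\<Oplus>j\<in>{..<J}. C j \<otimes> P (Suc i) [^] j) \<noteq> \<zero>"
  using std_sum_leading[OF assms(1,2,3) std_value[OF enat_le_trans[OF assms(1)] assms(3)] assms(4,5)]
  by auto

end

section \<open>Expansion in reduced monomials\<close>

lemma (in abelian_group) finsum_minus:
  "finite A \<Longrightarrow> f \<in> A \<rightarrow> carrier G \<Longrightarrow> g \<in> A \<rightarrow> carrier G \<Longrightarrow>
    finsum G f A \<ominus> finsum G g A = (\<Oplus>i\<in>A. f i \<ominus> g i)"
proof (induction A rule: finite_induct)
  case (insert i A)
  then have c: "f i \<in> carrier G" "g i \<in> carrier G" "finsum G f A \<in> carrier G" "finsum G g A \<in> carrier G"
    by auto
  have "(\<Oplus>j\<in>insert i A. f j \<ominus> g j) = (f i \<ominus> g i) \<oplus> (finsum G f A \<ominus> finsum G g A)"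
    using insert by (simp add: Pi_def)
  also have "\<dots> = (f i \<oplus> finsum G f A) \<ominus> (g i \<oplus> finsum G g A)"
    using c by (simp add: minus_eq minus_add a_ac)
  finally show ?case using insert c by simp
qed (simp add: minus_eq)

text \<open>Division with remainder by \<open>m\<close>: it separates the leading digit of an
  exponent in the mixed radix system from the others.\<close>

lemma (in abelian_monoid) finsum_nat_group:
  fixes m J :: nat
  assumes "\<And>e. e < m * J \<Longrightarrow> f e \<in> carrier G"
  shows "(\<Oplus>e\<in>{..<m * J}. f e) = (\<Oplus>j\<in>{..<J}. \<Oplus>e\<in>{..<m}. f (j * m + e))"
  using assms
proof (induction J)
  case (Suc J)
  have lt: "J * m + e < m * Suc J" if "e < m" for e using that by (simp add: mult.commute)
  have lt2: "j * m + e < m * Suc J" if "e < m" "j < J" for e j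
  proof -
    have "j * m + e < Suc j * m" using that by simp
    also have "\<dots> \<le> Suc J * m" using that by (intro mult_le_mono1) simp
    finally show ?thesis by (simp add: mult.commute)
  qed
  have eq: "{..<m * Suc J} = {..<m * J} \<union> (\<lambda>e. J * m + e) ` {..<m}"
  proof (intro subset_antisym subsetI)
    fix k assume "k \<in> {..<m * Suc J}"
    then have "k < m * J \<or> (k - J * m < m \<and> k = J * m + (k - J * m))" by (auto simp: mult.commute)
    then show "k \<in> {..<m * J} \<union> (\<lambda>e. J * m + e) ` {..<m}" by blast
  next
    fix k assume "k \<in> {..<m * J} \<union> (\<lambda>e. J * m + e) ` {..<m}"
    then show "k \<in> {..<m * Suc J}" using lt by auto
  qed
  have "(\<Oplus>e\<in>{..<m * Suc J}. f e) = (\<Oplus>e\<in>{..<m * J}. f e) \<oplus> (\<Oplus>e\<in>(\<lambda>e. J * m + e) ` {..<m}. f e)"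
    unfolding eq using Suc(2) lt by (intro finsum_Un_disjoint) (auto simp: mult.commute)
  also have "(\<Oplus>e\<in>(\<lambda>e. J * m + e) ` {..<m}. f e) = (\<Oplus>e\<in>{..<m}. f (J * m + e))"
    using Suc(2) lt by (intro finsum_reindex) auto
  also have "(\<Oplus>e\<in>{..<m * J}. f e) = (\<Oplus>j\<in>{..<J}. \<Oplus>e\<in>{..<m}. f (j * m + e))"
    using Suc by simp
  finally show ?case
    unfolding lessThan_Suc[of J] using Suc(2) lt lt2
    by (subst finsum_insert) (auto simp: Pi_def a_comm intro!: finsum_closed a_comm)
qed simp

context generating_sequence_setup
begin

lemma v_0: "v 0 = \<nu> x" and v_1: "v 1 = \<nu> y"
  by (simp_all add: v_def P_0 P_1)

section \<open>Growth of the values in the sequence\<close>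

lemma archimedean: assumes "\<phi> \<in> value_group K \<nu>" "enat k \<le> \<Omega>" shows "\<exists>N. \<phi> < nmul N (v k)"
proof (rule rank_one_archimedean[OF rank _ _ assms(1)])
  show "v k \<in> value_group K \<nu>" "0 < v k" using P_good[OF assms(2)] by (auto simp: value_group_def v_def)
qed

text \<open>Starts from \<nu>(x) \<le> \<nu>(y); from \<open>l\<close> to \<open>Suc l\<close> the
  left side is multiplied by \<open>nn l\<close>, and the right side grows even more. Bounded values
  therefore force bounded degrees.\<close>

lemma dg_bound: "1 \<le> l \<Longrightarrow> enat l \<le> \<Omega> \<Longrightarrow> 1 \<le> dg l \<and> nmul (dg l) (v 0) \<le> v l"
proof (induction l)
  case (Suc l)
  show ?case
  proof (cases "l = 0")
    case True
    then show ?thesis using val_x_le_y v_0 v_1 by simp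
  next
    case False
    have l: "enat l < \<Omega>" using Suc(3) by (simp add: Suc_ile_eq)
    note st = step_good[OF _ l]
    have IH: "1 \<le> dg l" "nmul (dg l) (v 0) \<le> v l" using Suc(1) False l by auto
    have "nmul (dg (Suc l)) (v 0) = nmul (nn l) (nmul (dg l) (v 0))" using False by (simp add: nmul_mult)
    also have "\<dots> \<le> nmul (nn l) (v l)" using IH by (intro nmul_mono_right)
    also have "\<dots> \<le> v (Suc l)" using st False by simp
    finally show ?thesis using IH st False by simp
  qed
qed simp

lemma SS_1: "SS (Suc 0) = {x}"
  by (simp add: SS_def P_0)

lemma gen_x: assumes "g \<in> generate add_group (\<nu> ` SS 1)" shows "\<exists>k. g = nmul k (v 0) \<or> - g = nmul k (v 0)"
proof -
  have S: "insert x {} \<subseteq> carrier K - {\<zero>}" using x_nonzero by simp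
  have "g \<in> \<nu> ` mon_group {x}" using assms val_mon_group[OF S] by (simp add: SS_1)
  then obtain z where z: "z \<in> mon_group {x}" "g = \<nu> z" by blast
  have m0: "z \<in> mon_group {} \<Longrightarrow> z = \<one>" for z by (induction rule: mon_group.induct) auto
  obtain w k where wk: "w \<in> mon_group {}" "z = w \<otimes> x [^] (k::nat) \<or> inv z = w \<otimes> x [^] k"
    using mon_group_insertE[OF S z(1)] by blast
  have zc: "z \<in> carrier K" "z \<noteq> \<zero>" using mon_group_carrier[OF S z(1)] by auto
  have "\<nu> (w \<otimes> x [^] k) = nmul k (v 0)" using m0[OF wk(1)] x_nonzero by (simp add: val_pow v_0)
  then show ?thesis using wk(2) z(2) zc by (metis val_inv)
qed

text \<open>\<open>dg l\<close> is the product of the \<open>nn k\<close> for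
  \<open>1 \<le> k < l\<close>, each a multiple of the index \<open>nb k\<close>. So it annihilates
  the successive quotients from the group generated by \<open>v 0\<close> up to the one generated by
  \<open>v 0, \<dots>, v (l - 1)\<close>.\<close>

lemma gen_index:
  assumes "1 \<le> l" "enat l \<le> \<Omega>" "g \<in> generate add_group (\<nu> ` SS l)"
  shows "nmul (dg l) g \<in> generate add_group (\<nu> ` SS 1)"
  using assms
proof (induction l arbitrary: g)
  case (Suc l)
  let ?Z = "generate add_group (\<nu> ` SS 1)"
  have Z: "subgroup ?Z add_group" by (rule generate_add_subgroup)
  show ?case
  proof (cases "l = 0")
    case True
    then show ?thesis using Suc(4) by simp
  next
    case False
    then have l: "1 \<le> l" "enat l \<le> \<Omega>" "enat l < \<Omega>" using Suc(3) enat_le_trans[OF Suc(3), of l] by (auto simp: Suc_ile_eq)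
    note IH = Suc(1)[OF l(1,2)]
    have nbf: "nb l \<noteq> \<infinity>" using step_infinite[OF l(1,2)] l(3) by auto
    then obtain e where e: "nb l = enat e" by (cases "nb l") auto
    obtain w U where U: "U \<in> mon_group (SS l)" "\<nu> U = nmul e (v l)" "n l = nb l * d l"
      using step_U[OF l(1,2) e] by metis
    have "n l \<noteq> \<infinity>" using step_good[OF l(1,3)] by simp
    then obtain D where D: "nn l = D * e"
    proof (cases "d l")
      case (enat D)
      then have "nn l = D * e" using U(3) e by (simp add: nn_def)
      then show thesis using that by blast
    next
      case infinity
      then show thesis using U(3) e step_index(1)[OF l(1,2) e] \<open>n l \<noteq> \<infinity>\<close>
        by (simp add: times_enat_def zero_enat_def split: if_splits)
    qed
    have S: "SS l \<subseteq> carrier K - {\<zero>}" using SS_sub[of "l - 1"] l enat_le_trans[of l "l - 1"] by simp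
    have "\<nu> U \<in> generate add_group (\<nu> ` SS l)" using U(1) val_mon_group[OF S] by blast
    then have "nmul (dg l) (nmul e (v l)) \<in> ?Z" using IH U(2) by simp
    then have "nmul D (nmul (dg l) (nmul e (v l))) \<in> ?Z" by (rule subgroup_nmul[OF Z])
    then have vl: "nmul (dg (Suc l)) (v l) \<in> ?Z" using False D by (simp add: nmul_mult[symmetric] mult_ac)
    let ?H = "{g. nmul (dg (Suc l)) g \<in> ?Z}"
    have "subgroup ?H add_group"
      using Z unfolding subgroup_add_group_iff by (auto simp: nmul_plus nmul_uminus)
    moreover have "\<nu> ` SS (Suc l) \<subseteq> ?H"
    proof -
      have "nmul (dg (Suc l)) g \<in> ?Z" if "g \<in> \<nu> ` SS l" for g
        using subgroup_nmul[OF Z IH[of g], of "nn l"] that False by (simp add: nmul_mult generate.incl)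
      then show ?thesis using vl by (auto simp: SS_Suc v_def)
    qed
    ultimately have "generate add_group (\<nu> ` SS (Suc l)) \<subseteq> ?H"
      using group.generate_subgroup_incl[OF group_add_group] by blast
    then show ?thesis using Suc(4) by auto
  qed
qed simp

text \<open>
  If the values stayed bounded, the degrees \<open>dg l\<close> would be bounded too, so all values would lie in
  a fixed cyclic group, where a strictly increasing sequence is unbounded.
\<close>

lemma v_unbounded:
  assumes \<Omega>: "\<Omega> = \<infinity>" and \<phi>: "\<phi> \<in> value_group K \<nu>"
  obtains l where "1 \<le> l" "\<phi> < v l"
proof (rule ccontr)
  assume "\<not> thesis"
  then have bd: "v l \<le> \<phi>" if "1 \<le> l" for l using that \<open>\<And>l. \<lbrakk>1 \<le> l; \<phi> < v l\<rbrakk> \<Longrightarrow> thesis\<close> by fastforce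
  have le: "enat l \<le> \<Omega>" "enat l < \<Omega>" for l by (auto simp: \<Omega>)
  have v0: "0 < v 0" using P_good[OF le(1)] by blast
  obtain B where B: "\<phi> < nmul B (v 0)" using archimedean[OF \<phi> le(1)] by blast
  have dgB: "dg l < B" if "1 \<le> l" for l
  proof -
    have "nmul (dg l) (v 0) < nmul B (v 0)"
      using dg_bound[OF that le(1)] bd[OF that] B by (meson le_less_trans)
    then show ?thesis using nmul_less_iff[OF v0] by simp
  qed
  let ?Z = "generate add_group (\<nu> ` SS 1)"
  \<comment> \<open>A common multiple of all degrees, as they are less than \<open>B\<close>; it
    carries every value into the multiples of \<open>v 0\<close>.\<close>
  let ?f = "fact B :: nat"
  have mem: "\<exists>k. nmul ?f (v l) = nmul k (v 0)" if l: "1 \<le> l" for l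
  proof -
    have "v l \<in> generate add_group (\<nu> ` SS (Suc l))" by (auto simp: SS_Suc v_def intro: generate.incl)
    then have 1: "nmul (dg (Suc l)) (v l) \<in> ?Z" using gen_index[OF _ le(1), of "Suc l"] by simp
    have "dg (Suc l) dvd ?f"
      using dg_bound[OF _ le(1), of "Suc l"] dgB[of "Suc l"] by (intro dvd_fact) (simp_all add: less_imp_le)
    then obtain q where "?f = q * dg (Suc l)" by (metis dvd_def mult.commute)
    then have "nmul ?f (v l) = nmul q (nmul (dg (Suc l)) (v l))" by (simp only: nmul_mult)
    then have "nmul ?f (v l) \<in> ?Z" using subgroup_nmul[OF generate_add_subgroup 1] by simp
    then obtain k where k: "nmul ?f (v l) = nmul k (v 0) \<or> - nmul ?f (v l) = nmul k (v 0)" using gen_x by blast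
    have "0 < v l" using P_good[OF le(1)] by blast
    then have "0 < nmul ?f (v l)" using nmul_strict_mono_left[of "v l" 0 ?f] by simp
    moreover have "0 \<le> nmul k (v 0)" using v0 by (intro nmul_nonneg) simp
    ultimately have "- nmul ?f (v l) \<noteq> nmul k (v 0)" by (metis neg_0_le_iff_le not_le)
    then show ?thesis using k by blast
  qed
  have inc: "v l < v (Suc l)" if l: "1 \<le> l" for l
  proof -
    have "0 < v l" using P_good[OF le(1)] by blast
    then have "v l \<le> nmul (nn l) (v l)" using nmul_mono_left[of "v l" 1 "nn l"] step_good(3)[OF l le(2)] by simp
    then show ?thesis using step_good(1)[OF l le(2)] by simp
  qed
  \<comment> \<open>A strictly increasing sequence of natural multiples of \<open>v 0\<close> gains
    at least \<open>v 0\<close> at each step.\<close>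
  have grow: "nmul l (v 0) \<le> nmul ?f (v (Suc l))" for l
  proof (induction l)
    case 0
    have "0 < v 1" using P_good[OF le(1)] by blast
    then show ?case by (simp add: nmul_nonneg)
  next
    case (Suc l)
    obtain k where k: "nmul ?f (v (Suc (Suc l))) = nmul k (v 0)" using mem[of "Suc (Suc l)"] by auto
    have "nmul l (v 0) < nmul k (v 0)"
      using Suc nmul_strict_mono_right[OF inc[of "Suc l"], of ?f] k by simp
    then have "Suc l \<le> k" using nmul_less_iff[OF v0] by simp
    then show ?case unfolding k using v0 by (intro nmul_mono_left) simp_all
  qed
  have "nmul ?f \<phi> \<in> value_group K \<nu>" using subgroup_nmul[OF value_group_subgroup \<phi>] .
  then obtain N where N: "nmul ?f \<phi> < nmul N (v 0)" using archimedean[OF _ le(1)] by blast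
  have "nmul N (v 0) \<le> nmul ?f \<phi>"
    using grow[of N] nmul_mono_right[OF bd[of "Suc N"], of ?f] by simp
  then show False using N by simp
qed

lemma last_step: assumes "\<Omega> = enat l" shows "n l = \<infinity>"
proof -
  have l: "1 \<le> l" "enat l \<le> \<Omega>" using \<Omega>_ge_1 assms by (auto simp: one_enat_def)
  show ?thesis
  proof (cases "nb l")
    case (enat e)
    show ?thesis
    proof (rule step_finite[OF l good_all[OF l] enat], goal_cases)
      case (1 w U)
      then show ?case using assms by (cases "d l = \<infinity>") auto
    qed
  next
    case infinity
    then show ?thesis using step_infinite[OF l] by simp
  qed
qed

text \<open>The bound by \<open>n l\<close> keeps the remainders of division by
  \<open>P l [^] q\<close> reduced. If the sequence stops, the last \<open>n l\<close> is
  \<infinity> and a large \<open>q\<close> serves; otherwise \<open>q = 1\<close> with a large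
  \<open>l\<close>.\<close>

lemma high_power:
  assumes \<phi>: "\<phi> \<in> value_group K \<nu>"
  obtains l q where "1 \<le> l" "enat l \<le> \<Omega>" "\<phi> < nmul q (v l)" "enat q \<le> n l"
proof (cases \<Omega>)
  case (enat l)
  have l: "1 \<le> l" "enat l \<le> \<Omega>" using \<Omega>_ge_1 enat by (auto simp: one_enat_def)
  obtain q where "\<phi> < nmul q (v l)" using archimedean[OF \<phi> l(2)] by blast
  then show thesis using that[OF l] last_step[OF enat] by simp
next
  case infinity
  then obtain l where l: "1 \<le> l" "\<phi> < v l" using v_unbounded[OF _ \<phi>] by blast
  have "enat l < \<Omega>" using infinity by simp
  then show thesis using that[of l 1] l step_good(2,3)[OF l(1)] by simp
qed

text \<open>
  The reduced monomial in \<open>P 1, \<dots>, P i\<close> that is congruent to \<open>y ^ e\<close> modulo \<open>x\<close>: its exponents are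
  the digits of \<open>e\<close> in the mixed radix system with bases \<open>n 1, n 2, \<dots>\<close>.
\<close>

primrec Qm :: "nat \<Rightarrow> nat \<Rightarrow> 'a" where
  "Qm 0 e = \<one>"
| "Qm (Suc i) e = Qm i (e mod dg (Suc i)) \<otimes> P (Suc i) [^] (e div dg (Suc i))"

lemma Qm_R: "enat i \<le> \<Omega> \<Longrightarrow> Qm i e \<in> R"
proof (induction i arbitrary: e)
  case (Suc i)
  have "Qm i (e mod dg (Suc i)) \<in> R" using Suc enat_le_trans[of "Suc i" i] by simp
  moreover have "P (Suc i) [^] (e div dg (Suc i)) \<in> R" using P_good[OF Suc(2)] R_pow by blast
  ultimately show ?case using R_ops(4) by simp
qed (simp add: R_ops)

lemma P_mod_x: assumes "1 \<le> k" "enat k \<le> \<Omega>" shows "\<exists>h\<in>R. P k [^] (q::nat) = y [^] (q * dg k) \<oplus> h \<otimes> x"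
proof -
  have "k \<in> {1..k}" using assms by simp
  then obtain h where "h \<in> R" "P k = y [^] dg k \<oplus> h \<otimes> x"
    using good_all[OF assms] unfolding good_def by blast
  then show ?thesis using pow_mod_x by metis
qed

lemma Qm_mod_x: "enat i \<le> \<Omega> \<Longrightarrow> (i = 0 \<Longrightarrow> e = 0) \<Longrightarrow> \<exists>h\<in>R. Qm i e = y [^] e \<oplus> h \<otimes> x"
proof (induction i arbitrary: e)
  case 0
  then have "Qm 0 e = y [^] e \<oplus> \<zero> \<otimes> x" by simp
  then show ?case using R_ops(1) by blast
next
  case (Suc i)
  let ?m = "dg (Suc i)"
  have i: "enat i \<le> \<Omega>" using Suc(2) enat_le_trans[of "Suc i" i] by simp
  \<comment> \<open>For \<open>i = 0\<close> the modulus is 1 and the remainder 0, as the induction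
    hypothesis demands at that level.\<close>
  obtain h where h: "h \<in> R" "Qm i (e mod ?m) = y [^] (e mod ?m) \<oplus> h \<otimes> x"
    using Suc(1)[OF i, of "e mod ?m"] by auto
  obtain h' where h': "h' \<in> R" "P (Suc i) [^] (e div ?m) = y [^] (e div ?m * ?m) \<oplus> h' \<otimes> x"
    using P_mod_x[OF _ Suc(2), of "e div ?m"] by auto
  define a where "a = y [^] (e mod ?m)" define b where "b = y [^] (e div ?m * ?m)"
  have ab: "a \<in> R" "b \<in> R" using R_pow[OF yR] by (auto simp: a_def b_def)
  have c: "h \<in> carrier K" "h' \<in> carrier K" "a \<in> carrier K" "b \<in> carrier K" using h h' ab R_carr by auto
  have "Qm (Suc i) e = (a \<oplus> h \<otimes> x) \<otimes> (b \<oplus> h' \<otimes> x)" by (simp only: Qm.simps h h' a_def b_def)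
  also have "\<dots> = a \<otimes> b \<oplus> (a \<otimes> h' \<oplus> h \<otimes> (b \<oplus> h' \<otimes> x)) \<otimes> x" using c xy_carr(1) by algebra
  also have "a \<otimes> b = y [^] (e mod ?m + e div ?m * ?m)" by (simp only: a_def b_def nat_pow_mult xy_carr)
  also have "e mod ?m + e div ?m * ?m = e" by (simp only: mod_div_mult_eq)
  finally have "Qm (Suc i) e = y [^] e \<oplus> (a \<otimes> h' \<oplus> h \<otimes> (b \<oplus> h' \<otimes> x)) \<otimes> x" .
  moreover have "a \<otimes> h' \<oplus> h \<otimes> (b \<oplus> h' \<otimes> x) \<in> R" by (intro R_ops(4,5) h(1) h'(1) ab xR)
  ultimately show ?case by (rule bexI)
qed

text \<open>A \<open>y\<close>-adic expansion modulo \<open>x\<close> in which \<open>Qm l e\<close>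
  replaces \<open>y [^] e\<close>, to which it is congruent. The next coefficient represents the
  cofactor of \<open>y [^] N\<close> modulo \<open>m\<close>; what is left over is a combination of
  \<open>x\<close> and \<open>y\<close>.\<close>

lemma expand_y:
  assumes "1 \<le> l" "enat l \<le> \<Omega>" "f \<in> R"
  shows "\<exists>c g h. (\<forall>e. c e \<in> CS) \<and> g \<in> R \<and> h \<in> R \<and>
    f = (\<Oplus>e\<in>{..<N}. c e \<otimes> Qm l e) \<oplus> y [^] N \<otimes> g \<oplus> x \<otimes> h"
proof (induction N)
  case 0
  show ?case using CS_zero assms(3) R_ops(1) R_carr[OF assms(3)]
    by (intro exI[of _ "\<lambda>_. \<zero>"] exI[of _ f] exI[of _ \<zero>]) simp
next
  case (Suc N)
  then obtain c g h where *: "\<And>e. c e \<in> CS" "g \<in> R" "h \<in> R"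
    "f = (\<Oplus>e\<in>{..<N}. c e \<otimes> Qm l e) \<oplus> y [^] N \<otimes> g \<oplus> x \<otimes> h" by blast
  obtain cN where cN: "cN \<in> CS" "g \<ominus> cN \<in> m" using CS_approx[OF *(2)] by blast
  then obtain a b where ab: "a \<in> R" "b \<in> R" "g \<ominus> cN = a \<otimes> x \<oplus> b \<otimes> y" unfolding m_set by blast
  obtain k where k: "k \<in> R" "Qm l N = y [^] N \<oplus> k \<otimes> x" using Qm_mod_x[OF assms(2)] assms(1) by auto
  define c' where "c' = c(N := cN)"
  define \<Sigma> where "\<Sigma> = (\<Oplus>e\<in>{..<N}. c e \<otimes> Qm l e)"
  have QR: "Qm l e \<in> carrier K" for e using Qm_R[OF assms(2)] R_carr by blast
  have cc: "c e \<in> carrier K" for e using *(1) CS_R R_carr by blast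
  have car: "g \<in> carrier K" "h \<in> carrier K" "cN \<in> carrier K" "a \<in> carrier K" "b \<in> carrier K" "k \<in> carrier K"
    "\<Sigma> \<in> carrier K" "y [^] N \<in> carrier K"
    using *(2,3) cN CS_R R_carr ab k QR cc by (auto simp: \<Sigma>_def)
  have "(\<Oplus>e\<in>{..<N}. c' e \<otimes> Qm l e) = \<Sigma>"
    unfolding \<Sigma>_def c'_def using cc QR by (intro finsum_cong') auto
  then have sum: "(\<Oplus>e\<in>{..<Suc N}. c' e \<otimes> Qm l e) = cN \<otimes> (y [^] N \<oplus> k \<otimes> x) \<oplus> \<Sigma>"
    unfolding lessThan_Suc using QR cc car k(2)[symmetric] by (subst finsum_insert) (auto simp: c'_def)
  have "g = cN \<oplus> (g \<ominus> cN)" using car by algebra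
  then have g: "g = cN \<oplus> (a \<otimes> x \<oplus> b \<otimes> y)" using ab(3) by simp
  have "f = \<Sigma> \<oplus> y [^] N \<otimes> (cN \<oplus> (a \<otimes> x \<oplus> b \<otimes> y)) \<oplus> x \<otimes> h"
    using *(4) g by (simp add: \<Sigma>_def)
  also have "\<dots> = (cN \<otimes> (y [^] N \<oplus> k \<otimes> x) \<oplus> \<Sigma>) \<oplus> (y [^] N \<otimes> y) \<otimes> b \<oplus> x \<otimes> (h \<oplus> y [^] N \<otimes> a \<ominus> cN \<otimes> k)"
    using car xy_carr by algebra
  finally have "f = (\<Oplus>e\<in>{..<Suc N}. c' e \<otimes> Qm l e) \<oplus> y [^] Suc N \<otimes> b \<oplus> x \<otimes> (h \<oplus> y [^] N \<otimes> a \<ominus> cN \<otimes> k)"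
    unfolding sum by simp
  moreover have "h \<oplus> y [^] N \<otimes> a \<ominus> cN \<otimes> k \<in> R"
    by (intro R_ops(4,5) R_minus R_pow yR *(3) ab(1) CS_R cN(1) k(1))
  moreover have "\<forall>e. c' e \<in> CS" using *(1) cN by (simp add: c'_def)
  ultimately show ?case using ab(2) by blast
qed

text \<open>\<open>expand_y\<close> is applied to the cofactor of \<open>x [^] N\<close>, up to the
  exponent \<open>dg l * q\<close>. There \<open>y [^] (dg l * q)\<close> is exchanged for
  \<open>P l [^] q\<close>, congruent to it modulo \<open>x\<close>, and the error is pushed into
  the next power of \<open>x\<close>. The exponents of \<open>P l\<close> that occur are less than
  \<open>q\<close>.\<close>

lemma expand:
  fixes q N :: nat
  assumes l: "1 \<le> l" "enat l \<le> \<Omega>" and f: "f \<in> R"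
  shows "\<exists>c g h. (\<forall>a e. c a e \<in> CS) \<and> g \<in> R \<and> h \<in> R \<and>
    f = (\<Oplus>e\<in>{..<dg l * q}. (\<Oplus>a\<in>{..<N}. c a e \<otimes> x [^] a) \<otimes> Qm l e) \<oplus> P l [^] q \<otimes> g \<oplus> x [^] N \<otimes> h"
proof (induction N)
  case 0
  have "(\<Oplus>e\<in>{..<dg l * q}. (\<Oplus>a\<in>{..<0::nat}. \<zero> \<otimes> x [^] a) \<otimes> Qm l e) = (\<Oplus>e\<in>{..<dg l * q}. \<zero>)"
    using Qm_R[OF l(2)] R_carr by (intro finsum_cong') auto
  then have "f = (\<Oplus>e\<in>{..<dg l * q}. (\<Oplus>a\<in>{..<0::nat}. \<zero> \<otimes> x [^] a) \<otimes> Qm l e) \<oplus> P l [^] q \<otimes> \<zero> \<oplus> x [^] (0::nat) \<otimes> f"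
    using R_carr[OF f] P_good[OF l(2)] by simp
  then show ?case using CS_zero f R_ops(1) by (intro exI[of _ "\<lambda>_ _. \<zero>"] exI[of _ \<zero>] exI[of _ f]) simp
next
  case (Suc N)
  then obtain c g h where *: "\<And>a e. c a e \<in> CS" "g \<in> R" "h \<in> R"
    "f = (\<Oplus>e\<in>{..<dg l * q}. (\<Oplus>a\<in>{..<N}. c a e \<otimes> x [^] a) \<otimes> Qm l e) \<oplus> P l [^] q \<otimes> g \<oplus> x [^] N \<otimes> h" by blast
  obtain b g' h' where b: "\<And>e. b e \<in> CS" "g' \<in> R" "h' \<in> R"
    "h = (\<Oplus>e\<in>{..<dg l * q}. b e \<otimes> Qm l e) \<oplus> y [^] (dg l * q) \<otimes> g' \<oplus> x \<otimes> h'"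
    using expand_y[OF l *(3), of "dg l * q"] by blast
  obtain k where k: "k \<in> R" "P l [^] q = y [^] (dg l * q) \<oplus> k \<otimes> x"
    using P_mod_x[OF l, of q] by (auto simp: mult.commute)
  let ?E = "dg l * q"
  define c' where "c' = c(N := b)"
  have QR: "Qm l e \<in> carrier K" for e using Qm_R[OF l(2)] R_carr by blast
  have bc: "b e \<in> carrier K" "c a e \<in> carrier K" for a e using *(1) b(1) CS_R R_carr by blast+
  have s1: "(\<Oplus>a\<in>{..<Suc N}. c' a e \<otimes> x [^] a) = (\<Oplus>a\<in>{..<N}. c a e \<otimes> x [^] a) \<oplus> b e \<otimes> x [^] N" for e
  proof -
    have "(\<Oplus>a\<in>{..<N}. c' a e \<otimes> x [^] a) = (\<Oplus>a\<in>{..<N}. c a e \<otimes> x [^] a)"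
      unfolding c'_def using bc by (intro finsum_cong') auto
    then show ?thesis
      unfolding lessThan_Suc using bc by (subst finsum_insert) (auto simp: c'_def a_comm)
  qed
  define \<Sigma>1 where "\<Sigma>1 = (\<Oplus>e\<in>{..<?E}. (\<Oplus>a\<in>{..<N}. c a e \<otimes> x [^] a) \<otimes> Qm l e)"
  define \<Sigma>2 where "\<Sigma>2 = (\<Oplus>e\<in>{..<?E}. b e \<otimes> Qm l e)"
  have "(\<Oplus>e\<in>{..<?E}. (\<Oplus>a\<in>{..<Suc N}. c' a e \<otimes> x [^] a) \<otimes> Qm l e)
    = (\<Oplus>e\<in>{..<?E}. (\<Oplus>a\<in>{..<N}. c a e \<otimes> x [^] a) \<otimes> Qm l e \<oplus> x [^] N \<otimes> (b e \<otimes> Qm l e))"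
  proof (rule finsum_cong')
    fix e
    have alg: "(u \<oplus> b e \<otimes> z) \<otimes> Qm l e = u \<otimes> Qm l e \<oplus> z \<otimes> (b e \<otimes> Qm l e)"
      if "u \<in> carrier K" "z \<in> carrier K" for u z using that bc(1)[of e] QR[of e] by algebra
    have "(\<Oplus>a\<in>{..<N}. c a e \<otimes> x [^] a) \<in> carrier K" using bc by auto
    then show "(\<Oplus>a\<in>{..<Suc N}. c' a e \<otimes> x [^] a) \<otimes> Qm l e = (\<Oplus>a\<in>{..<N}. c a e \<otimes> x [^] a) \<otimes> Qm l e \<oplus> x [^] N \<otimes> (b e \<otimes> Qm l e)"
      unfolding s1 by (rule alg) simp
  qed (use bc QR in auto)
  also have "\<dots> = \<Sigma>1 \<oplus> (\<Oplus>e\<in>{..<?E}. x [^] N \<otimes> (b e \<otimes> Qm l e))"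
    unfolding \<Sigma>1_def using bc QR by (intro finsum_addf) auto
  also have "(\<Oplus>e\<in>{..<?E}. x [^] N \<otimes> (b e \<otimes> Qm l e)) = x [^] N \<otimes> \<Sigma>2"
    unfolding \<Sigma>2_def using bc QR by (intro finsum_rdistr[symmetric]) auto
  finally have sum: "(\<Oplus>e\<in>{..<?E}. (\<Oplus>a\<in>{..<Suc N}. c' a e \<otimes> x [^] a) \<otimes> Qm l e) = \<Sigma>1 \<oplus> x [^] N \<otimes> \<Sigma>2" .
  define Y where "Y = y [^] ?E"
  define z where "z = x [^] N"
  have car: "g \<in> carrier K" "h \<in> carrier K" "g' \<in> carrier K" "h' \<in> carrier K" "k \<in> carrier K"
    "\<Sigma>1 \<in> carrier K" "\<Sigma>2 \<in> carrier K" "Y \<in> carrier K" "z \<in> carrier K" "P l [^] q \<in> carrier K"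
    using * b k R_carr bc QR P_good[OF l(2)] by (auto simp: \<Sigma>1_def \<Sigma>2_def Y_def z_def)
  have "f = \<Sigma>1 \<oplus> P l [^] q \<otimes> g \<oplus> z \<otimes> (\<Sigma>2 \<oplus> Y \<otimes> g' \<oplus> x \<otimes> h')"
    using *(4) b(4) by (simp add: \<Sigma>1_def \<Sigma>2_def Y_def z_def)
  also have "\<dots> = (\<Sigma>1 \<oplus> z \<otimes> \<Sigma>2) \<oplus> (P l [^] q \<otimes> g \<oplus> (Y \<oplus> k \<otimes> x) \<otimes> (z \<otimes> g')) \<oplus> (z \<otimes> x) \<otimes> (h' \<ominus> k \<otimes> g')"
    using car xy_carr by algebra
  also have "P l [^] q \<otimes> g \<oplus> (Y \<oplus> k \<otimes> x) \<otimes> (z \<otimes> g') = P l [^] q \<otimes> (g \<oplus> z \<otimes> g')"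
    using k(2) car by (simp add: Y_def r_distr)
  also have "z \<otimes> x = x [^] Suc N" by (simp add: z_def)
  finally have "f = (\<Oplus>e\<in>{..<?E}. (\<Oplus>a\<in>{..<Suc N}. c' a e \<otimes> x [^] a) \<otimes> Qm l e)
     \<oplus> P l [^] q \<otimes> (g \<oplus> z \<otimes> g') \<oplus> x [^] Suc N \<otimes> (h' \<ominus> k \<otimes> g')"
    unfolding sum z_def .
  moreover have "g \<oplus> z \<otimes> g' \<in> R" unfolding z_def by (intro R_ops(4,5) R_pow xR *(2) b(2))
  moreover have "h' \<ominus> k \<otimes> g' \<in> R" by (intro R_ops(4) R_minus k(1) b(2,3))
  moreover have "\<forall>a e. c' a e \<in> CS" using *(1) b(1) by (simp add: c'_def)
  ultimately show ?case by blast
qed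

end

section \<open>Leading forms, the value semigroup and the residue field\<close>

lemma nat_combinations_zero: "0 \<in> nat_combinations G"
  unfolding nat_combinations_def by (auto intro!: exI[of _ "{}"])

lemma nat_combinations_incl: "g \<in> G \<Longrightarrow> g \<in> nat_combinations G"
  unfolding nat_combinations_def by (auto intro!: exI[of _ "{g}"] exI[of _ "\<lambda>_. 1"])

lemma nat_combinations_add:
  assumes "a \<in> nat_combinations G" "b \<in> nat_combinations G" shows "a + b \<in> nat_combinations G"
proof -
  obtain S c T d where *: "finite S" "S \<subseteq> G" "a = (\<Sum>g\<in>S. nmul (c g) g)" "finite T" "T \<subseteq> G" "b = (\<Sum>g\<in>T. nmul (d g) g)"
    using assms by (auto simp: nat_combinations_def)
  let ?c = "\<lambda>g. if g \<in> S then c g else 0" and ?d = "\<lambda>g. if g \<in> T then d g else 0"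
  have "a = (\<Sum>g\<in>S \<union> T. nmul (?c g) g)" unfolding *(3)
    by (rule sum.mono_neutral_cong_left) (use *(1,4) in auto)
  moreover have "b = (\<Sum>g\<in>S \<union> T. nmul (?d g) g)" unfolding *(6)
    by (rule sum.mono_neutral_cong_left) (use *(1,4) in auto)
  ultimately have "a + b = (\<Sum>g\<in>S \<union> T. nmul (?c g + ?d g) g)"
    by (simp add: sum.distrib nmul_add)
  then show ?thesis unfolding nat_combinations_def using *
    by (intro CollectI exI[of _ "S \<union> T"] exI[of _ "\<lambda>g. ?c g + ?d g"]) simp
qed

lemma nat_combinations_nmul: "a \<in> nat_combinations G \<Longrightarrow> nmul k a \<in> nat_combinations G"
  by (induction k) (simp_all add: nat_combinations_zero nmul_Suc nat_combinations_add)

lemma nat_combinations_sum: "(\<And>i. i \<in> A \<Longrightarrow> f i \<in> nat_combinations G) \<Longrightarrow> sum f A \<in> nat_combinations G"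
  by (induction A rule: infinite_finite_induct) (simp_all add: nat_combinations_zero nat_combinations_add)

text \<open>Because all generators are positive, those that occur in \<open>b\<close> with a
  positive coefficient are at most \<open>b\<close>. In the proof of minimality this discards the
  generators of larger value.\<close>

lemma nat_combinations_subgroup:
  assumes "subgroup H add_group" "\<And>g. g \<in> G \<Longrightarrow> g \<le> b \<Longrightarrow> g \<in> H" "\<And>g. g \<in> G \<Longrightarrow> (0::'g::linordered_ab_group_add) < g"
    and "b \<in> nat_combinations G"
  shows "b \<in> H"
proof -
  obtain T c where T: "finite T" "T \<subseteq> G" "b = (\<Sum>g\<in>T. nmul (c g) g)" using assms(4) by (auto simp: nat_combinations_def)
  have nn: "0 \<le> nmul (c g) g" if "g \<in> T" for g using assms(3)[of g] that T(2) by (intro nmul_nonneg) auto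
  have "nmul (c g) g \<in> H" if g: "g \<in> T" for g
  proof (cases "c g = 0")
    case True
    then show ?thesis using assms(1) by (simp add: subgroup_add_group_iff)
  next
    case False
    have gpos: "0 < g" using assms(3) g T(2) by blast
    then have "g \<le> nmul (c g) g" using nmul_mono_left[of g 1 "c g"] False by simp
    also have "\<dots> \<le> b" unfolding T(3) using sum_mono2[of T "{g}" "\<lambda>g. nmul (c g) g"] T(1) g nn by auto
    finally show ?thesis using subgroup_nmul[OF assms(1) assms(2)] g T(2) by blast
  qed
  then show ?thesis unfolding T(3) by (rule subgroup_sum[OF assms(1)])
qed

context generating_sequence_setup
begin

text \<open>Nonzero elements have the same initial form as a reduced combination from levels up to
  \<open>i\<close>; the degree \<open>\<psi>\<close> is then necessarily the value.\<close>

definition Lead :: "nat \<Rightarrow> 'a \<Rightarrow> bool" where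
  "Lead i f \<longleftrightarrow> f = \<zero> \<or> (\<exists>\<psi>. \<exists>B\<in>std i \<psi>. B \<noteq> \<zero> \<and> f \<ominus> B \<in> Kgt \<psi>)"

lemma leading_value:
  assumes "enat i \<le> \<Omega>" "f \<in> carrier K" "B \<in> std i \<psi>" "B \<noteq> \<zero>" "f \<ominus> B \<in> Kgt \<psi>"
  shows "f \<noteq> \<zero>" "\<nu> f = \<psi>"
proof -
  have B: "B \<in> carrier K" "\<nu> B = \<psi>" using std_R[OF assms(1,3)] R_carr std_value[OF assms(1,3,4)] by auto
  have "B \<oplus> (f \<ominus> B) = f" using B(1) assms(2) by algebra
  then show "f \<noteq> \<zero>" "\<nu> f = \<psi>" using val_add_gt[OF B(1) assms(4), of "f \<ominus> B"] assms(5) B(2) by auto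
qed

lemma zero_std: "\<zero> \<in> std i \<phi>"
proof (cases i)
  case (Suc k)
  have "enat 0 \<le> n (Suc k)" by (simp add: zero_enat_def[symmetric])
  then have "\<exists>B J. \<zero> = (\<Oplus>j\<in>{..<J::nat}. B j \<otimes> P (Suc k) [^] j) \<and> enat J \<le> n (Suc k) \<and> (\<forall>j<J. B j \<in> std k (\<phi> - nmul j (v (Suc k))))"
    by (intro exI[of _ "\<lambda>_. \<zero>"] exI[of _ 0]) simp
  then show ?thesis by (simp add: Suc)
qed simp

lemma Lead_0:
  fixes N :: nat
  assumes c: "\<And>a. c a \<in> CS" shows "Lead 0 (\<Oplus>a\<in>{..<N}. c a \<otimes> x [^] a)"
proof (cases "\<exists>a<N. c a \<noteq> \<zero>")
  case False
  have "(\<Oplus>a\<in>{..<N}. c a \<otimes> x [^] a) = (\<Oplus>a\<in>{..<N}. \<zero>)"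
    using False by (intro finsum_cong') auto
  then show ?thesis by (simp add: Lead_def)
next
  case True
  define a0 where "a0 = (LEAST a. a < N \<and> c a \<noteq> \<zero>)"
  have a0: "a0 < N" "c a0 \<noteq> \<zero>" using LeastI_ex[OF True] by (auto simp: a0_def)
  have least: "c a = \<zero>" if "a < a0" for a
    using that not_less_Least[of a "\<lambda>a. a < N \<and> c a \<noteq> \<zero>"] a0(1) by (auto simp: a0_def[symmetric])
  have cc: "c a \<in> carrier K" for a using c CS_R R_carr by blast
  let ?\<psi> = "nmul a0 (\<nu> x)"
  let ?B = "c a0 \<otimes> x [^] a0"
  have B: "?B \<in> std 0 ?\<psi>" "?B \<noteq> \<zero>" using c a0 cc x_nonzero by auto
  have eqB: "(\<Oplus>a\<in>{..<N}. if a0 = a then c a \<otimes> x [^] a else \<zero>) = ?B"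
    using a0 cc by (intro finsum_singleton) auto
  have "(\<Oplus>a\<in>{..<N}. c a \<otimes> x [^] a) \<ominus> ?B = (\<Oplus>a\<in>{..<N}. c a \<otimes> x [^] a \<ominus> (if a0 = a then c a \<otimes> x [^] a else \<zero>))"
    unfolding eqB[symmetric] using cc by (intro finsum_minus) auto
  also have "\<dots> \<in> Kgt ?\<psi>"
  proof (rule Kgt_finsum)
    fix a assume "a \<in> {..<N}"
    consider "a < a0" | "a = a0" | "a0 < a" by linarith
    then show "c a \<otimes> x [^] a \<ominus> (if a0 = a then c a \<otimes> x [^] a else \<zero>) \<in> Kgt ?\<psi>"
    proof cases
      case 1
      then show ?thesis using least by (simp add: minus_eq)
    next
      case 2
      then show ?thesis using cc[of a] by (simp add: minus_eq r_neg)
    next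
      case 3
      have "x [^] a \<in> Kgt ?\<psi>" using x_nonzero nmul_strict_mono_left[OF val_x_pos 3] by (simp add: Kgt_iff val_pow)
      then have "c a \<otimes> x [^] a \<in> Kgt (0 + ?\<psi>)" using R_Kge[OF CS_R[OF c]] by (intro Kgt_mult')
      then show ?thesis using 3 cc[of a] by (simp add: minus_eq)
    qed
  qed simp
  finally show ?thesis using B unfolding Lead_def by blast
qed

text \<open>Only terms of least value \<open>\<phi>\<close> matter. Their leading forms assemble to
  an element of \<open>std (Suc i) \<phi>\<close>, and \<open>std_sum_nonzero\<close> prevents it
  from vanishing.\<close>

lemma Lead_sum:
  fixes J :: nat
  assumes i: "enat (Suc i) \<le> \<Omega>" and J: "enat J \<le> n (Suc i)"
    and F: "\<And>j. j < J \<Longrightarrow> F j \<in> carrier K" "\<And>j. j < J \<Longrightarrow> Lead i (F j)"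
  shows "Lead (Suc i) (\<Oplus>j\<in>{..<J}. F j \<otimes> P (Suc i) [^] j)"
proof (cases "\<exists>j<J. F j \<noteq> \<zero>")
  case False
  have "(\<Oplus>j\<in>{..<J}. F j \<otimes> P (Suc i) [^] j) = (\<Oplus>j\<in>{..<J}. \<zero>)"
    using False P_good[OF i] by (intro finsum_cong') auto
  then show ?thesis by (simp add: Lead_def)
next
  case True
  have i': "enat i \<le> \<Omega>" using enat_le_trans[OF i, of i] by simp
  let ?v = "v (Suc i)"
  have Pq: "P (Suc i) \<in> carrier K" "P (Suc i) \<noteq> \<zero>" using P_good[OF i] by auto
  have "\<exists>B. B \<in> std i (\<nu> (F j)) \<and> B \<noteq> \<zero> \<and> F j \<ominus> B \<in> Kgt (\<nu> (F j))" if "j < J" "F j \<noteq> \<zero>" for j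
    using F(2)[OF that(1)] that(2) leading_value[OF i' F(1)[OF that(1)]] unfolding Lead_def by metis
  then obtain B where B: "\<And>j. j < J \<Longrightarrow> F j \<noteq> \<zero> \<Longrightarrow> B j \<in> std i (\<nu> (F j)) \<and> B j \<noteq> \<zero> \<and> F j \<ominus> B j \<in> Kgt (\<nu> (F j))"
    by metis
  define \<chi> where "\<chi> j = \<nu> (F j) + nmul j ?v" for j
  define A where "A = {j. j < J \<and> F j \<noteq> \<zero>}"
  have A: "finite A" "A \<noteq> {}" using True by (auto simp: A_def)
  define \<phi> where "\<phi> = Min (\<chi> ` A)"
  have min: "\<phi> \<le> \<chi> j" if "j < J" "F j \<noteq> \<zero>" for j
    unfolding \<phi>_def using A that by (intro Min_le) (auto simp: A_def)
  have "\<phi> \<in> \<chi> ` A" unfolding \<phi>_def using A by (intro Min_in) auto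
  then obtain j0 where j0: "j0 < J" "F j0 \<noteq> \<zero>" "\<chi> j0 = \<phi>" by (auto simp: A_def)
  define C where "C j = (if F j \<noteq> \<zero> \<and> \<chi> j = \<phi> then B j else \<zero>)" for j
  have Cstd: "C j \<in> std i (\<phi> - nmul j ?v)" if "j < J" for j
  proof (cases "F j \<noteq> \<zero> \<and> \<chi> j = \<phi>")
    case True
    then have "\<nu> (F j) = \<phi> - nmul j ?v" by (auto simp: \<chi>_def)
    then show ?thesis using B[OF that] True by (simp add: C_def)
  next
    case False
    then have "C j = \<zero>" by (auto simp: C_def)
    then show ?thesis by (simp add: zero_std)
  qed
  have Cc: "C j \<in> carrier K" if "j < J" for j using std_R[OF i' Cstd[OF that]] R_carr by blast
  let ?B = "\<Oplus>j\<in>{..<J}. C j \<otimes> P (Suc i) [^] j"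
  have "?B \<in> std (Suc i) \<phi>" using J Cstd by auto
  moreover have "?B \<noteq> \<zero>"
    using std_sum_nonzero[OF i J Cstd, of j0] j0 B[OF j0(1,2)] by (simp add: C_def)
  moreover have "(\<Oplus>j\<in>{..<J}. F j \<otimes> P (Suc i) [^] j) \<ominus> ?B \<in> Kgt \<phi>"
  proof -
    have "(\<Oplus>j\<in>{..<J}. F j \<otimes> P (Suc i) [^] j) \<ominus> ?B = (\<Oplus>j\<in>{..<J}. F j \<otimes> P (Suc i) [^] j \<ominus> C j \<otimes> P (Suc i) [^] j)"
      using F(1) Cc Pq by (intro finsum_minus) auto
    also have "\<dots> \<in> Kgt \<phi>"
    proof (rule Kgt_finsum)
      fix j assume "j \<in> {..<J}"
      then have j: "j < J" by simp
      have Pj: "P (Suc i) [^] j \<in> Kge (nmul j ?v)" "P (Suc i) [^] j \<in> carrier K" using Pq by (auto simp: Kge_iff val_pow v_def)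
      have d: "F j \<otimes> P (Suc i) [^] j \<ominus> C j \<otimes> P (Suc i) [^] j = (F j \<ominus> C j) \<otimes> P (Suc i) [^] j"
        using F(1)[OF j] Cc[OF j] Pj(2) by algebra
      show "F j \<otimes> P (Suc i) [^] j \<ominus> C j \<otimes> P (Suc i) [^] j \<in> Kgt \<phi>"
      proof (cases "F j = \<zero>")
        case True
        then have "F j \<ominus> C j = \<zero>" by (simp add: C_def minus_eq)
        then show ?thesis using Pj unfolding d by simp
      next
        case False
        show ?thesis
        proof (cases "\<chi> j = \<phi>")
          case True
          have "(F j \<ominus> C j) \<otimes> P (Suc i) [^] j \<in> Kgt (\<nu> (F j) + nmul j ?v)"
            using B[OF j False] True False Pj by (intro Kgt_mult) (simp_all add: C_def)
          then show ?thesis unfolding d using True by (simp add: \<chi>_def)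
        next
          case ne: False
          then have "\<phi> < \<chi> j" using min[OF j False] by simp
          then have "F j \<in> Kgt (\<phi> - nmul j ?v)" using F(1)[OF j] by (simp add: Kgt_iff \<chi>_def algebra_simps)
          then have "F j \<otimes> P (Suc i) [^] j \<in> Kgt (\<phi> - nmul j ?v + nmul j ?v)" using Pj by (intro Kgt_mult)
          moreover have "F j \<ominus> C j = F j" using ne F(1)[OF j] by (simp add: C_def minus_eq)
          ultimately show ?thesis unfolding d by simp
        qed
      qed
    qed simp
    finally show ?thesis .
  qed
  ultimately show ?thesis unfolding Lead_def by blast
qed

text \<open>Grouping exponents by their leading digit turns the sum into a polynomial in
  \<open>P (Suc i)\<close> whose coefficients are sums of the same kind one level lower. The lower
  digits are below their bases by construction; the leading one is limited by \<open>q\<close>. At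
  the lowest level the base is 1 and the sum is a polynomial in \<open>y\<close>.\<close>

lemma Lead_Qm:
  assumes "enat (Suc i) \<le> \<Omega>" "enat q \<le> n (Suc i)" "\<And>e. g e \<in> carrier K" "\<And>e. Lead 0 (g e)"
  shows "Lead (Suc i) (\<Oplus>e\<in>{..<dg (Suc i) * q}. g e \<otimes> Qm (Suc i) e)"
  using assms
proof (induction i arbitrary: q g)
  case (0 q g)
  have y: "y [^] e \<in> carrier K" for e :: nat by simp
  have "(\<Oplus>e\<in>{..<dg (Suc 0) * q}. g e \<otimes> Qm (Suc 0) e) = (\<Oplus>e\<in>{..<q}. g e \<otimes> P (Suc 0) [^] e)"
    using 0 by (intro finsum_cong') (auto simp: P_1)
  then show ?case using Lead_sum[OF 0(1,2), of g] 0(3,4) by simp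
next
  case (Suc i q g)
  let ?k = "Suc i" and ?m = "dg (Suc (Suc i))" and ?p = "P (Suc (Suc i))"
  have k: "enat ?k \<le> \<Omega>" "enat ?k < \<Omega>" using Suc(2) enat_le_trans[of "Suc ?k" ?k] by (auto simp: Suc_ile_eq)
  have pc: "?p \<in> carrier K" using P_good[OF Suc(2)] by blast
  have QR: "Qm ?k e \<in> carrier K" for e using Qm_R[OF k(1)] R_carr by blast
  have QR2: "Qm (Suc ?k) e \<in> carrier K" for e using Qm_R[OF Suc(2)] R_carr by blast
  have m: "?m = dg ?k * nn ?k" by simp
  have m0: "0 < ?m" using dg_bound[OF _ Suc(2)] by linarith
  define F where "F j = (\<Oplus>e\<in>{..<?m}. g (j * ?m + e) \<otimes> Qm ?k e)" for j
  have Fc: "F j \<in> carrier K" for j unfolding F_def using Suc(4) QR by auto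
  have "Lead ?k (F j)" for j
    unfolding F_def m using Suc(1)[OF k(1), of "nn ?k" "\<lambda>e. g (j * (dg ?k * nn ?k) + e)"] step_good(2)[OF _ k(2)] Suc(4,5) by simp
  then have L: "Lead (Suc ?k) (\<Oplus>j\<in>{..<q}. F j \<otimes> ?p [^] j)" using Lead_sum[OF Suc(2,3)] Fc by blast
  have "(\<Oplus>e\<in>{..<?m * q}. g e \<otimes> Qm (Suc ?k) e) = (\<Oplus>j\<in>{..<q}. \<Oplus>e\<in>{..<?m}. g (j * ?m + e) \<otimes> Qm (Suc ?k) (j * ?m + e))"
    using Suc(4) QR2 by (intro finsum_nat_group) simp
  also have "\<dots> = (\<Oplus>j\<in>{..<q}. F j \<otimes> ?p [^] j)"
  proof (rule finsum_cong')
    fix j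
    have "(\<Oplus>e\<in>{..<?m}. g (j * ?m + e) \<otimes> Qm (Suc ?k) (j * ?m + e)) = (\<Oplus>e\<in>{..<?m}. (g (j * ?m + e) \<otimes> Qm ?k e) \<otimes> ?p [^] j)"
    proof (rule finsum_cong')
      fix e assume "e \<in> {..<?m}"
      then have e: "e < ?m" by simp
      have "(j * ?m + e) mod ?m = e" "(j * ?m + e) div ?m = j" using e m0 by (simp_all del: dg.simps)
      then have "Qm (Suc ?k) (j * ?m + e) = Qm ?k e \<otimes> ?p [^] j" by (simp only: Qm.simps(2))
      then show "g (j * ?m + e) \<otimes> Qm (Suc ?k) (j * ?m + e) = (g (j * ?m + e) \<otimes> Qm ?k e) \<otimes> ?p [^] j"
        using Suc(4) QR pc m_assoc by (simp del: Qm.simps dg.simps)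
    qed (use Suc(4) QR pc in auto)
    also have "\<dots> = F j \<otimes> ?p [^] j"
      unfolding F_def using Suc(4) QR pc by (intro finsum_ldistr[symmetric]) auto
    finally show "(\<Oplus>e\<in>{..<?m}. g (j * ?m + e) \<otimes> Qm (Suc ?k) (j * ?m + e)) = F j \<otimes> ?p [^] j" .
  qed (use Fc pc in auto)
  finally show ?case using L by (simp only:)
qed

text \<open>With both remainders of \<open>expand\<close> chosen of value above \<nu>(f), the
  element and the main sum have the same value and the same leading form, and \<open>Lead_Qm\<close>
  describes the latter.\<close>

theorem leading_form:
  assumes f: "f \<in> R" "f \<noteq> \<zero>"
  obtains l B where "enat l \<le> \<Omega>" "B \<in> std l (\<nu> f)" "B \<noteq> \<zero>" "f \<ominus> B \<in> Kgt (\<nu> f)"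
proof -
  have fc: "f \<in> carrier K" using f R_carr by blast
  let ?\<phi> = "\<nu> f"
  have \<phi>: "?\<phi> \<in> value_group K \<nu>" using fc f by (auto simp: value_group_def)
  obtain l q where l: "1 \<le> l" "enat l \<le> \<Omega>" "?\<phi> < nmul q (v l)" "enat q \<le> n l" using high_power[OF \<phi>] by blast
  obtain N where N: "?\<phi> < nmul N (v 0)" using archimedean[OF \<phi>, of 0] by (auto simp: zero_enat_def[symmetric])
  obtain c g h where *: "\<forall>a e. c a e \<in> CS" "g \<in> R" "h \<in> R"
    "f = (\<Oplus>e\<in>{..<dg l * q}. (\<Oplus>a\<in>{..<N}. c a e \<otimes> x [^] a) \<otimes> Qm l e) \<oplus> P l [^] q \<otimes> g \<oplus> x [^] N \<otimes> h"
    using expand[OF l(1,2) f(1), where q = q and N = N] by (elim exE conjE) (rule that, assumption+)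
  define s where "s = (\<Oplus>e\<in>{..<dg l * q}. (\<Oplus>a\<in>{..<N}. c a e \<otimes> x [^] a) \<otimes> Qm l e)"
  have cc: "c a e \<in> carrier K" for a e using *(1) CS_R R_carr by blast
  have gc: "(\<Oplus>a\<in>{..<N}. c a e \<otimes> x [^] a) \<in> carrier K" for e using cc by auto
  have sc: "s \<in> carrier K" unfolding s_def using gc Qm_R[OF l(2)] R_carr by auto
  obtain k where k: "l = Suc k" using l(1) by (cases l) auto
  have "Lead l s" unfolding s_def k
    using Lead_Qm[of k q "\<lambda>e. \<Oplus>a\<in>{..<N}. c a e \<otimes> x [^] a"] l(2,4) gc Lead_0[of "\<lambda>a. c a _"] *(1) by (simp only: k)
  have Pl: "P l \<in> carrier K" "P l \<noteq> \<zero>" using P_good[OF l(2)] by auto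
  have "P l [^] q \<in> Kgt ?\<phi>" "x [^] N \<in> Kgt ?\<phi>" using Pl l(3) N x_nonzero by (auto simp: Kgt_iff val_pow v_def P_0)
  from Kgt_mult[OF this(1) R_Kge[OF *(2)]] Kgt_mult[OF this(2) R_Kge[OF *(3)]]
  have hi: "P l [^] q \<otimes> g \<oplus> x [^] N \<otimes> h \<in> Kgt ?\<phi>" by (simp add: Kgt_add)
  let ?r = "P l [^] q \<otimes> g \<oplus> x [^] N \<otimes> h"
  have rc: "?r \<in> carrier K" using hi Kgt_carr by blast
  have gh: "g \<in> carrier K" "h \<in> carrier K" using *(2,3) R_carr by auto
  have fs: "f = s \<oplus> ?r" using *(4) sc gh Pl by (simp add: s_def[symmetric] a_assoc)
  have "s = f \<oplus> \<ominus> ?r" unfolding fs using sc rc by algebra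
  then have s: "s \<noteq> \<zero>" "\<nu> s = ?\<phi>" using val_add_gt[OF fc f(2) Kgt_uminus[OF hi]] by auto
  then obtain \<psi> B where B: "B \<in> std l \<psi>" "B \<noteq> \<zero>" "s \<ominus> B \<in> Kgt \<psi>" using \<open>Lead l s\<close> by (auto simp: Lead_def)
  have \<psi>: "\<psi> = ?\<phi>" using leading_value[OF l(2) sc B] s by simp
  have Bc: "B \<in> carrier K" using std_R[OF l(2) B(1)] R_carr by blast
  have "f \<ominus> B = (s \<ominus> B) \<oplus> ?r" unfolding fs using sc rc Bc by algebra
  then have "f \<ominus> B \<in> Kgt ?\<phi>" using Kgt_add[OF _ hi] B(3) \<psi> by simp
  then show thesis using that[OF l(2)] B \<psi> by simp
qed

lemma leading_homog:
  assumes "f \<in> R" "f \<noteq> \<zero>"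
  obtains l where "enat l \<le> \<Omega>" "f \<in> homog (SS (Suc l)) (FF (Suc l)) (\<nu> f)" "\<nu> f \<in> \<nu> ` mon_group (SS (Suc l))"
proof -
  obtain l B where l: "enat l \<le> \<Omega>" and B: "B \<in> std l (\<nu> f)" "B \<noteq> \<zero>" "f \<ominus> B \<in> Kgt (\<nu> f)"
    using leading_form[OF assms] by blast
  have c: "B \<in> carrier K" "f \<in> carrier K" using std_R[OF l B(1)] assms R_carr by auto
  have "B \<oplus> (f \<ominus> B) \<in> homog (SS (Suc l)) (FF (Suc l)) (\<nu> f)"
    by (rule homog_add[OF adm[OF l] std_homog[OF l B(1)] homog_Kgt[OF B(3)]])
  moreover have "B \<oplus> (f \<ominus> B) = f" using c by algebra
  ultimately show thesis using that[OF l] std_value[OF l B(1,2)] by simp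
qed

section \<open>The value semigroup\<close>

definition value_gens :: "'g set" where
  "value_gens = {\<nu> x} \<union> {\<nu> (P i) | i. 1 \<le> i \<and> enat i \<le> \<Omega> \<and> nb i > 1}"

lemma nb_pos: assumes "1 \<le> i" "enat i \<le> \<Omega>" shows "nb i \<noteq> 0"
  using step_index(1)[OF assms, of 0] by (auto simp: zero_enat_def)

text \<open>If the index is 1, then \<open>v k\<close> is the value of \<open>U\<close>, a monomial
  with natural exponents in earlier elements; so such values are redundant as generators.\<close>

lemma v_nat_combination: "enat k \<le> \<Omega> \<Longrightarrow> v k \<in> nat_combinations value_gens"
proof (induction k rule: less_induct)
  case (less k)
  show ?case
  proof (cases "k = 0 \<or> 1 < nb k")
    case True
    then have "v k \<in> value_gens"
      using less(2) by (cases "k = 0") (auto simp: value_gens_def v_def P_0)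
    then show ?thesis by (rule nat_combinations_incl)
  next
    case False
    then have k: "1 \<le> k" "nb k = enat 1"
      using nb_pos[of k] less(2) by (cases "nb k"; auto simp: one_enat_def zero_enat_def)+
    obtain w U where U: "U = power_product K P k w" "\<nu> U = nmul 1 (v k)"
      using step_U[OF k(1) less(2) k(2)] by metis
    have Pk: "P j \<in> R \<and> P j \<noteq> \<zero>" if "j < k" for j using P_good[of j] enat_le_trans[OF less(2), of j] that by auto
    have "v k = (\<Sum>j<k. nmul (w j) (v j))" using power_product_facts(4)[of k w] Pk U by simp
    also have "\<dots> \<in> nat_combinations value_gens"
      using less(1) enat_le_trans[OF less(2)] by (intro nat_combinations_sum nat_combinations_nmul) auto
    finally show ?thesis .
  qed
qed

lemma std_nat_combination:
  "enat i \<le> \<Omega> \<Longrightarrow> B \<in> std i \<phi> \<Longrightarrow> B \<noteq> \<zero> \<Longrightarrow> \<phi> \<in> nat_combinations value_gens"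
proof (induction i arbitrary: \<phi> B)
  case 0
  then obtain a where "\<phi> = nmul a (v 0)" by (auto simp: v_0)
  then show ?case using v_nat_combination[OF 0(1)] by (simp add: nat_combinations_nmul)
next
  case (Suc i)
  obtain C J where B: "B = (\<Oplus>j\<in>{..<J}. C j \<otimes> P (Suc i) [^] j)"
    and C: "\<And>j. j < J \<Longrightarrow> C j \<in> std i (\<phi> - nmul j (v (Suc i)))" using Suc(3) by auto
  have "\<exists>j<J. C j \<noteq> \<zero>"
  proof (rule ccontr)
    assume "\<not> (\<exists>j<J. C j \<noteq> \<zero>)"
    then have "B = (\<Oplus>j\<in>{..<J}. \<zero>)" unfolding B using P_good[OF Suc(2)] by (intro finsum_cong') auto
    then show False using Suc(4) by simp
  qed
  then obtain j where j: "j < J" "C j \<noteq> \<zero>" by blast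
  have "\<phi> - nmul j (v (Suc i)) \<in> nat_combinations value_gens"
    using Suc(1)[OF _ C[OF j(1)] j(2)] enat_le_trans[OF Suc(2), of i] by simp
  from nat_combinations_add[OF this nat_combinations_nmul[OF v_nat_combination[OF Suc(2)], of j]]
  show ?case by simp
qed

text \<open>Follows from \<open>v j \<le> nmul (nn j) (v j) < v (Suc j)\<close>. It starts at index
  1 because \<open>v 0 = v 1\<close> can happen; hence the separate treatment of \<open>x\<close> in
  the minimality arguments.\<close>

lemma v_less: assumes "1 \<le> i" "i < j" "enat j \<le> \<Omega>" shows "v i < v j"
  using assms(2,3)
proof (induction j)
  case (Suc j)
  have j: "1 \<le> j" "enat j < \<Omega>" "enat j \<le> \<Omega>" using Suc(2,3) assms(1) enat_le_trans[OF Suc(3), of j] by (auto simp: Suc_ile_eq)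
  have "0 \<le> v j" using P_good[OF j(3)] less_imp_le by blast
  then have "v j \<le> nmul (nn j) (v j)" using nmul_mono_left[of "v j" 1 "nn j"] step_good(3)[OF j(1,2)] by simp
  also have "\<dots> < v (Suc j)" using step_good(1)[OF j(1,2)] .
  finally have "v j < v (Suc j)" .
  then show ?case using Suc j(3) by (cases "i = j") auto
qed simp

lemma nb_eq_1I:
  assumes "1 \<le> i" "enat i \<le> \<Omega>" "v i \<in> \<nu> ` mon_group (SS i)" shows "nb i = 1"
proof (cases "nb i")
  case (enat e)
  then show ?thesis using step_index(1)[OF assms(1,2), of e] assms(3) by (metis One_nat_def nat_dvd_1_iff_1 nmul_1 one_enat_def)
next
  case infinity
  then show ?thesis using step_index(2)[OF assms(1,2), of 1] assms(3) by simp
qed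

theorem semigroup_generation: "minimally_generates nat_combinations value_gens (value_semigroup K \<nu> R)"
  unfolding minimally_generates_def
proof (intro conjI allI impI)
  show "nat_combinations value_gens = value_semigroup K \<nu> R"
  proof (intro subset_antisym subsetI)
    fix a assume "a \<in> value_semigroup K \<nu> R"
    then obtain f where f: "f \<in> R" "f \<noteq> \<zero>" "a = \<nu> f" by (auto simp: value_semigroup_def)
    show "a \<in> nat_combinations value_gens"
      using leading_form[OF f(1,2)] std_nat_combination f(3) by metis
  next
    fix a assume "a \<in> nat_combinations value_gens"
    then obtain T c where T: "finite T" "T \<subseteq> value_gens" "a = (\<Sum>g\<in>T. nmul (c g) g)" by (auto simp: nat_combinations_def)
    have "value_gens \<subseteq> value_semigroup K \<nu> R"
      unfolding value_gens_def value_semigroup_def using P_good xR x_nonzero by auto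
    with T(2) have "T \<subseteq> value_semigroup K \<nu> R" by blast
    with T(1) have "\<exists>f\<in>R - {\<zero>}. (\<Sum>g\<in>T. nmul (c g) g) = \<nu> f"
    proof (induction T rule: finite_induct)
      case empty
      then show ?case using R_ops by (auto intro!: bexI[of _ \<one>])
    next
      case (insert g T)
      then obtain f h where *: "f \<in> R" "f \<noteq> \<zero>" "(\<Sum>g\<in>T. nmul (c g) g) = \<nu> f" "h \<in> R" "h \<noteq> \<zero>" "g = \<nu> h"
        by (auto simp: value_semigroup_def)
      have "h [^] c g \<otimes> f \<in> R - {\<zero>}" using * R_carr R_pow R_ops(4) by simp
      moreover have "\<nu> (h [^] c g \<otimes> f) = (\<Sum>g\<in>insert g T. nmul (c g) g)"
        using * R_carr insert(1,2) by (simp add: val_mult val_pow)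
      ultimately show ?case by metis
    qed
    then show "a \<in> value_semigroup K \<nu> R" using T(3) by (auto simp: value_semigroup_def)
  qed
  fix G' assume G': "G' \<subset> value_gens"
  show "nat_combinations G' \<noteq> value_semigroup K \<nu> R"
  proof
    assume eq: "nat_combinations G' = value_semigroup K \<nu> R"
    obtain g where g: "g \<in> value_gens" "g \<notin> G'" using G' by blast
    then have "\<exists>i. enat i \<le> \<Omega> \<and> g = v i \<and> (i = 0 \<or> 1 < nb i)"
      by (auto simp: value_gens_def v_def P_0 zero_enat_def[symmetric] intro: exI[of _ 0])
    then obtain i where i: "enat i \<le> \<Omega>" "g = v i" "i = 0 \<or> 1 < nb i" by blast
    have mem: "v i \<in> nat_combinations G'"
      unfolding eq value_semigroup_def using P_good[OF i(1)] by (auto simp: v_def)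
    have G'v: "\<exists>j. enat j \<le> \<Omega> \<and> h = v j \<and> j \<noteq> i \<and> (j = 0 \<or> 1 < nb j)" if "h \<in> G'" for h
    proof -
      have "h \<in> value_gens" "h \<noteq> v i" using that G' g i by auto
      then show ?thesis by (auto simp: value_gens_def v_def P_0 zero_enat_def[symmetric] intro: exI[of _ 0])
    qed
    have pos: "0 < h" if "h \<in> G'" for h using G'v[OF that] P_good by auto
    show False
    proof (cases "i = 0")
      case True
      \<comment> \<open>No remaining generator has value at most \<open>v 0\<close>: only
        \<open>v 1 = v 0\<close> could occur, but then \<open>nb 1 = 1\<close> and \<open>y\<close>
        contributes no generator. So \<open>v 0\<close> would be the empty combination.\<close>
      have "v i \<in> {0}"
      proof (rule nat_combinations_subgroup[OF _ _ pos mem])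
        show "subgroup {0} (add_group :: 'g monoid)" by (simp add: subgroup_add_group_iff)
        fix h assume h: "h \<in> G'" "h \<le> v i"
        obtain j where j: "enat j \<le> \<Omega>" "h = v j" "1 \<le> j" "1 < nb j" using G'v[OF h(1)] True by (auto simp: Suc_le_eq)
        have "v 0 = v 1"
        proof (cases "j = 1")
          case False
          then have "v 1 < v j" using v_less[of 1 j] j by simp
          then show ?thesis using h(2) j(2) True val_x_le_y v_0 v_1 by simp
        qed (use h(2) j(2) True val_x_le_y v_0 v_1 in simp)
        then have "j = 1" using h(2) j v_less[of 1 j] True by fastforce
        have "P 0 \<in> SS 1" by (simp add: SS_def)
        then have "P 0 \<in> mon_group (SS 1)" using SS_sub[of 0] mon_group_incl[of "SS 1"] by (simp add: zero_enat_def[symmetric])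
        then have "v 1 \<in> \<nu> ` mon_group (SS 1)" using \<open>v 0 = v 1\<close> by (metis v_def imageI)
        then have "nb 1 = 1" using nb_eq_1I[of 1] j(1) \<open>j = 1\<close> by simp
        then show "h \<in> {0}" using j(4) \<open>j = 1\<close> by simp
      qed
      then show False using P_good[OF i(1)] by simp
    next
      case False
      have S: "SS i \<subseteq> carrier K - {\<zero>}" using SS_sub[of "i - 1"] False enat_le_trans[OF i(1), of "i - 1"] by simp
      have "v i \<in> \<nu> ` mon_group (SS i)"
      proof (rule nat_combinations_subgroup[OF _ _ pos mem])
        show "subgroup (\<nu> ` mon_group (SS i)) add_group" unfolding val_mon_group[OF S] by (rule generate_add_subgroup)
        fix h assume h: "h \<in> G'" "h \<le> v i"
        obtain j where j: "enat j \<le> \<Omega>" "h = v j" "j \<noteq> i" using G'v[OF h(1)] by auto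
        have "j < i" using v_less[of i j] False j h(2) by (cases "i < j") auto
        then have "P j \<in> SS i" by (simp add: SS_def)
        then show "h \<in> \<nu> ` mon_group (SS i)" using mon_group_incl[OF S] j(2) by (auto simp: v_def)
      qed
      then have "nb i = 1" using nb_eq_1I[of i] i(1) False by simp
      then show False using i(3) False by simp
    qed
  qed
qed

section \<open>The residue field\<close>

lemma d_field_degree: assumes "1 \<le> i" "enat i \<le> \<Omega>"
  shows "d i = field_degree k\<nu> (FF (Suc i)) (FF i) \<or> (d i = 1 \<and> \<alpha> i \<in> FF i)"
proof (cases "nb i")
  case (enat e)
  then show ?thesis using step_U[OF assms enat] by metis
next
  \<comment> \<open>Here \<open>d i = 1\<close> and \<open>\<alpha> i = 1\<close> are conventions of
    the algorithm, not a computed degree.\<close>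
  case infinity
  then show ?thesis using step_infinite[OF assms infinity] rsR_FF[OF R_ops(2), of i] by (simp add: rs_one)
qed

lemma d_eq_1_iff: assumes "1 \<le> i" "enat i \<le> \<Omega>" shows "d i = 1 \<longleftrightarrow> \<alpha> i \<in> FF i" "1 \<le> d i"
proof -
  have A: "rs ` R \<union> \<alpha> ` {1..<i} \<subseteq> carrier k\<nu>" using gens_carr[of "i - 1"] assms enat_le_trans[OF assms(2), of "i - 1"] by simp
  note c = \<alpha>_carr[OF assms]
  show "d i = 1 \<longleftrightarrow> \<alpha> i \<in> FF i"
    using d_field_degree[OF assms] kf.field_degree_eq_1_iff[OF A c, folded FF_gen FF_Suc[OF assms(1)]] by auto
  show "1 \<le> d i"
    using d_field_degree[OF assms] kf.field_degree_ge_1[OF A c, folded FF_gen FF_Suc[OF assms(1)]] by auto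
qed

text \<open>An element of value zero is a quotient of two elements of \<open>R\<close> of equal
  value. Dividing both by one monomial \<open>W\<close> presents its residue as a quotient of two
  elements of some \<open>FF (Suc l)\<close>. Steps with \<open>d i = 1\<close> do not enlarge the
  field, since \<open>\<alpha> i\<close> already lies in it.\<close>

theorem residue_field_generation:
  "carrier k\<nu> = adjoined K \<nu> R {\<alpha> i | i. 1 \<le> i \<and> enat i \<le> \<Omega> \<and> d i > 1}" (is "_ = ?F")
proof
  have Fc: "rs ` R \<union> {\<alpha> i | i. 1 \<le> i \<and> enat i \<le> \<Omega> \<and> d i > 1} \<subseteq> carrier k\<nu>"
    using rsR_sub \<alpha>_carr by auto
  then have F: "subfield ?F k\<nu>" unfolding adjoined_def by (rule kf.generate_field_is_subfield)
  show "?F \<subseteq> carrier k\<nu>" using subfieldE(3)[OF F] .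
  have FFF: "FF (Suc i) \<subseteq> ?F" if "enat i \<le> \<Omega>" for i
    using that
  proof (induction i)
    case 0
    show ?case unfolding FF_gen
      by (rule kf.generate_field_min_subfield1[OF _ F]) (use rsR_sub in \<open>auto simp: adjoined_def intro: generate_field.incl\<close>)
  next
    case (Suc i)
    have i: "enat i \<le> \<Omega>" using enat_le_trans[OF Suc(2), of i] by simp
    have "\<alpha> (Suc i) \<in> ?F"
    proof (cases "d (Suc i) > 1")
      case True
      then show ?thesis unfolding adjoined_def using Suc(2) by (intro generate_field.incl) auto
    next
      case False
      then have "d (Suc i) = 1" using d_eq_1_iff(2)[OF _ Suc(2)] by simp
      then show ?thesis using d_eq_1_iff(1)[OF _ Suc(2)] Suc(1)[OF i] by auto
    qed
    moreover have "rs ` R \<union> \<alpha> ` {1..<Suc i} \<subseteq> ?F"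
      using Suc(1)[OF i] unfolding FF_gen by (auto intro: generate_field.incl)
    ultimately show ?case unfolding FF_Suc[of "Suc i", simplified]
      using gens_carr[OF i] \<alpha>_carr[OF _ Suc(2)] by (intro kf.generate_field_min_subfield1[OF _ F]) auto
  qed
  show "carrier k\<nu> \<subseteq> ?F"
  proof
    fix r assume "r \<in> carrier k\<nu>"
    then obtain z where z: "z \<in> Kge 0" "r = rs z" using rs_surj by blast
    show "r \<in> ?F"
    proof (cases "z \<in> Kgt 0")
      case True
      then show ?thesis using rs_zero_iff[OF z(1)] z(2) subringE(2)[OF subfieldE(1)[OF F]] by simp
    next
      case False
      then have zz: "z \<in> carrier K" "z \<noteq> \<zero>" "\<nu> z = 0" using z(1) by (auto simp: Kge_iff Kgt_iff)
      obtain a b where ab: "a \<in> R" "b \<in> R" "b \<noteq> \<zero>" "z = a \<otimes> inv b" using qf zz unfolding quotient_field_def by blast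
      have c: "a \<in> carrier K" "b \<in> carrier K" using ab R_carr by auto
      have a0: "a \<noteq> \<zero>" using zz(2) ab(3,4) c by auto
      have "z \<otimes> b = a \<otimes> (inv b \<otimes> b)" using ab c unfolding ab(4) by (simp add: m_assoc)
      then have azb: "a = z \<otimes> b" using ab c by simp
      have vab: "\<nu> a = \<nu> b" using val_mult[OF zz(1) c(2) zz(2) ab(3)] zz(3) azb by simp
      obtain l1 where l1: "enat l1 \<le> \<Omega>" "a \<in> homog (SS (Suc l1)) (FF (Suc l1)) (\<nu> a)" "\<nu> a \<in> \<nu> ` mon_group (SS (Suc l1))"
        using leading_homog[OF ab(1) a0] by blast
      obtain l2 where l2: "enat l2 \<le> \<Omega>" "b \<in> homog (SS (Suc l2)) (FF (Suc l2)) (\<nu> b)"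
        using leading_homog[OF ab(2,3)] by blast
      define l where "l = max l1 l2"
      have l: "enat l \<le> \<Omega>" "l1 \<le> l" "l2 \<le> l" using l1 l2 by (auto simp: l_def max_def)
      let ?S = "SS (Suc l)" and ?E = "FF (Suc l)"
      have ha: "a \<in> homog ?S ?E (\<nu> a)" using homog_mono[OF SS_mono FF_le[OF l(2,1)], of "Suc l1" "Suc l"] l1(2) l(2) by auto
      have hb: "b \<in> homog ?S ?E (\<nu> b)" using homog_mono[OF SS_mono FF_le[OF l(3,1)], of "Suc l2" "Suc l"] l2(2) l(3) by auto
      obtain W where W: "W \<in> mon_group ?S" "\<nu> W = \<nu> a"
        using l1(3) mon_group_mono[OF SS_mono, of "Suc l1" "Suc l"] l(2) by (metis Suc_le_mono imageE)
      have Wc: "W \<in> carrier K" "W \<noteq> \<zero>" using mon_group_carrier[OF SS_sub[OF l(1)] W(1)] by auto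
      have E: "subfield ?E k\<nu>" using FF_sf[OF l(1)] .
      have la: "lres W a \<in> ?E" using homog_lres[OF adm[OF l(1)] ha W] .
      have lb: "lres W b \<in> ?E" using homog_lres[OF adm[OF l(1)] hb W(1)] W(2) vab by simp
      have bge: "b \<in> Kge (\<nu> W)" using c W(2) vab by (simp add: Kge_iff)
      have lbn: "lres W b \<noteq> \<zero>\<^bsub>k\<nu>\<^esub>" using lres_zero_iff[OF Wc bge] ab(3) W(2) vab by (simp add: Kgt_iff)
      have lbc: "lres W b \<in> carrier k\<nu>" using lres_closed[OF Wc bge] .
      have "lres W a = r \<otimes>\<^bsub>k\<nu>\<^esub> lres W b"
        using lres_mult[of \<one> W z b] Wc z(1) bge zz by (simp add: azb[symmetric] lres_one z(2))
      then have "lres W a \<otimes>\<^bsub>k\<nu>\<^esub> inv\<^bsub>k\<nu>\<^esub> (lres W b) = r \<otimes>\<^bsub>k\<nu>\<^esub> (lres W b \<otimes>\<^bsub>k\<nu>\<^esub> inv\<^bsub>k\<nu>\<^esub> (lres W b))"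
        using lbc lbn \<open>r \<in> carrier k\<nu>\<close> kf.field_Units by (simp add: kf.m_assoc)
      also have "\<dots> = r" using lbc lbn \<open>r \<in> carrier k\<nu>\<close> kf.field_Units by simp
      finally have "r = lres W a \<otimes>\<^bsub>k\<nu>\<^esub> inv\<^bsub>k\<nu>\<^esub> (lres W b)" by simp
      also have "\<dots> \<in> ?E"
        using la kf.subfield_m_inv(1)[OF E, of "lres W b"] lb lbn subringE(6)[OF subfieldE(1)[OF E]] by auto
      finally show ?thesis using FFF[OF l(1)] by blast
    qed
  qed
qed

section \<open>The associated graded ring\<close>

abbreviation "\<Gamma> \<equiv> value_group K \<nu>"
abbreviation "Pge \<equiv> P_ge K \<nu> R"
abbreviation "Pgt \<equiv> P_gt K \<nu> R"
abbreviation "gr \<equiv> gr_ring K \<nu> R"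

definition cs :: "'g \<Rightarrow> 'a \<Rightarrow> 'a set" where "cs \<phi> f = Pgt \<phi> +>\<^bsub>S\<^esub> f"

lemma Pge_iff: "f \<in> Pge \<phi> \<longleftrightarrow> f \<in> R \<and> f \<in> Kge \<phi>"
  and Pgt_iff: "f \<in> Pgt \<phi> \<longleftrightarrow> f \<in> R \<and> f \<in> Kgt \<phi>"
  using R_carr by (auto simp: P_ge_def P_gt_def)

lemma Pgt_ideal: "ideal (Pgt \<phi>) S"
proof -
  interpret Sr: cring S by (rule S_cring)
  show ?thesis
  proof (rule idealI[OF Sr.ring_axioms])
    have neg: "\<ominus>\<^bsub>S\<^esub> a = \<ominus> a" if "a \<in> R" for a
      using Sr.minus_equality[of "\<ominus> a" a] that R_ops(3)[OF that] R_carr[OF that] by (simp add: l_neg)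
    show "subgroup (Pgt \<phi>) (add_monoid S)"
    proof
      show "inv\<^bsub>add_monoid S\<^esub> a \<in> Pgt \<phi>" if a: "a \<in> Pgt \<phi>" for a
      proof -
        have aR: "a \<in> R" "a \<in> Kgt \<phi>" using a by (auto simp: Pgt_iff)
        have "\<ominus> a \<in> Pgt \<phi>" using aR by (simp add: Pgt_iff R_ops Kgt_uminus)
        then show ?thesis unfolding a_inv_def[symmetric] neg[OF aR(1)] .
      qed
    qed (auto simp: Pgt_iff R_ops Kgt_add)
  next
    fix a b assume a: "a \<in> Pgt \<phi>" and b: "b \<in> carrier S"
    then have "b \<otimes> a \<in> Kgt \<phi>" "a \<otimes> b \<in> Kgt \<phi>"
      using Kgt_mult'[OF R_Kge, of b a \<phi>] Kgt_mult[OF _ R_Kge, of a \<phi> b] by (auto simp: Pgt_iff)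
    then show "b \<otimes>\<^bsub>S\<^esub> a \<in> Pgt \<phi>" "a \<otimes>\<^bsub>S\<^esub> b \<in> Pgt \<phi>" using a b by (auto simp: Pgt_iff R_ops)
  qed
qed

lemma cs_eq: assumes "f \<in> R" shows "cs \<phi> f = {h \<in> R. h \<ominus> f \<in> Kgt \<phi>}"
proof (intro subset_antisym subsetI)
  fix h assume "h \<in> cs \<phi> f"
  then obtain g where g: "g \<in> Pgt \<phi>" "h = g \<oplus> f" by (auto simp: cs_def a_r_coset_def')
  have c: "g \<in> carrier K" "f \<in> carrier K" using g assms R_carr by (auto simp: Pgt_iff)
  have "h \<ominus> f = g" unfolding g(2) using c by algebra
  then show "h \<in> {h \<in> R. h \<ominus> f \<in> Kgt \<phi>}" using g assms R_ops by (auto simp: Pgt_iff)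
next
  fix h assume h: "h \<in> {h \<in> R. h \<ominus> f \<in> Kgt \<phi>}"
  have c: "h \<in> carrier K" "f \<in> carrier K" using h assms R_carr by auto
  have "h = (h \<ominus> f) \<oplus> f" using c by algebra
  moreover have "h \<ominus> f \<in> Pgt \<phi>" using h assms by (simp add: Pgt_iff R_minus)
  ultimately show "h \<in> cs \<phi> f" by (auto simp: cs_def a_r_coset_def')
qed

lemma cs_eq_iff: assumes "f \<in> R" "g \<in> R" shows "cs \<phi> f = cs \<phi> g \<longleftrightarrow> f \<ominus> g \<in> Kgt \<phi>"
proof
  have c: "f \<in> carrier K" "g \<in> carrier K" using assms R_carr by auto
  assume "cs \<phi> f = cs \<phi> g"
  moreover have "f \<in> cs \<phi> f" using assms c by (simp add: cs_eq minus_eq r_neg)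
  ultimately show "f \<ominus> g \<in> Kgt \<phi>" using assms by (simp add: cs_eq)
next
  have c: "f \<in> carrier K" "g \<in> carrier K" using assms R_carr by auto
  assume *: "f \<ominus> g \<in> Kgt \<phi>"
  have "h \<ominus> f \<in> Kgt \<phi> \<longleftrightarrow> h \<ominus> g \<in> Kgt \<phi>" if "h \<in> R" for h
  proof -
    have hc: "h \<in> carrier K" using that R_carr by blast
    have "h \<ominus> f = (h \<ominus> g) \<ominus> (f \<ominus> g)" "h \<ominus> g = (h \<ominus> f) \<oplus> (f \<ominus> g)" using c hc by algebra+
    then show ?thesis using Kgt_minus[OF _ *] Kgt_add[OF _ *] by metis
  qed
  then show "cs \<phi> f = cs \<phi> g" using assms by (auto simp: cs_eq)
qed

lemma cs_zero: "cs \<phi> \<zero> = Pgt \<phi>"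
proof -
  have "h \<ominus> \<zero> = h" if "h \<in> R" for h using R_carr[OF that] by algebra
  then show ?thesis by (auto simp: cs_eq R_ops Pgt_iff)
qed

lemma cs_eq_zero_iff: "f \<in> R \<Longrightarrow> cs \<phi> f = Pgt \<phi> \<longleftrightarrow> f \<in> Kgt \<phi>"
  using cs_eq_iff[of f \<zero> \<phi>] R_carr[of f] by (simp add: R_ops cs_zero minus_eq)

lemma cs_add: "f \<in> R \<Longrightarrow> g \<in> R \<Longrightarrow> cs \<phi> f <+>\<^bsub>S\<^esub> cs \<phi> g = cs \<phi> (f \<oplus> g)"
  unfolding cs_def using abelian_subgroup.a_rcos_sum[OF abelian_subgroupI3] ideal.a_rcos_sum[OF Pgt_ideal, of f g \<phi>] by simp

text \<open>\<open>rcoset_mult\<close> is a union over all pairs of representatives, here from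
  cosets of two ideals and with values in cosets of a third. It collapses because
  \<open>a b - f g = (a - f) b + f (b - g)\<close> has value above
  \<open>\<psi> + \<chi>\<close>.\<close>

lemma cs_mult:
  assumes "f \<in> Pge \<psi>" "g \<in> Pge \<chi>" "\<psi> + \<chi> = \<phi>"
  shows "rcoset_mult S (Pgt \<phi>) (cs \<psi> f) (cs \<chi> g) = cs \<phi> (f \<otimes> g)"
proof -
  have fR: "f \<in> R" "g \<in> R" and c: "f \<in> carrier K" "g \<in> carrier K" using assms R_carr by (auto simp: Pge_iff)
  have eq: "cs \<phi> (a \<otimes> b) = cs \<phi> (f \<otimes> g)" if "a \<in> cs \<psi> f" "b \<in> cs \<chi> g" for a b
  proof -
    have ab: "a \<in> R" "b \<in> R" "a \<ominus> f \<in> Kgt \<psi>" "b \<ominus> g \<in> Kgt \<chi>" using that fR by (auto simp: cs_eq)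
    have cc: "a \<in> carrier K" "b \<in> carrier K" using ab R_carr by auto
    have "b = (b \<ominus> g) \<oplus> g" using c cc by algebra
    then have "b \<in> Kge \<chi>" using Kge_add[OF Kgt_Kge[OF ab(4)], of g] assms(2) by (simp add: Pge_iff)
    then have 1: "(a \<ominus> f) \<otimes> b \<in> Kgt \<phi>" using Kgt_mult[OF ab(3)] assms(3) by blast
    have 2: "f \<otimes> (b \<ominus> g) \<in> Kgt \<phi>" using Kgt_mult'[OF _ ab(4), of f \<psi>] assms by (simp add: Pge_iff)
    have "a \<otimes> b \<ominus> f \<otimes> g = (a \<ominus> f) \<otimes> b \<oplus> f \<otimes> (b \<ominus> g)" using c cc by algebra
    then have "a \<otimes> b \<ominus> f \<otimes> g \<in> Kgt \<phi>" using Kgt_add[OF 1 2] by simp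
    then show ?thesis using cs_eq_iff ab(1,2) fR R_ops(4) by simp
  qed
  have mem: "f \<in> cs \<psi> f" "g \<in> cs \<chi> g" using fR c by (auto simp: cs_eq minus_eq r_neg)
  have "rcoset_mult S (Pgt \<phi>) (cs \<psi> f) (cs \<chi> g) = (\<Union>a\<in>cs \<psi> f. \<Union>b\<in>cs \<chi> g. cs \<phi> (a \<otimes> b))"
    by (simp add: rcoset_mult_def cs_def)
  also have "\<dots> = (\<Union>a\<in>cs \<psi> f. \<Union>b\<in>cs \<chi> g. cs \<phi> (f \<otimes> g))"
    by (intro SUP_cong refl eq)
  also have "\<dots> = cs \<phi> (f \<otimes> g)" using mem by blast
  finally show ?thesis .
qed

lemma gq_simps:
  "carrier (gr_quot K \<nu> R \<phi>) = cs \<phi> ` R" "A \<oplus>\<^bsub>gr_quot K \<nu> R \<phi>\<^esub> B = A <+>\<^bsub>S\<^esub> B"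
  "\<zero>\<^bsub>gr_quot K \<nu> R \<phi>\<^esub> = Pgt \<phi>"
  by (auto simp: gr_quot_def FactRing_def A_RCOSETS_def' cs_def a_r_coset_def')

lemma gq_ring: "ring (gr_quot K \<nu> R \<phi>)"
  unfolding gr_quot_def by (rule ideal.quotient_is_ring[OF Pgt_ideal])

lemma cs_finsum:
  assumes "finite A" "\<And>i. i \<in> A \<Longrightarrow> f i \<in> R"
  shows "finsum (gr_quot K \<nu> R \<phi>) (\<lambda>i. cs \<phi> (f i)) A = cs \<phi> (finsum K f A)"
  using assms
proof (induction A rule: finite_induct)
  case empty
  interpret gq: ring "gr_quot K \<nu> R \<phi>" by (rule gq_ring)
  show ?case by (simp add: cs_zero gq_simps)
next
  case (insert i A)
  interpret gq: ring "gr_quot K \<nu> R \<phi>" by (rule gq_ring)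
  have "finsum (gr_quot K \<nu> R \<phi>) (\<lambda>i. cs \<phi> (f i)) (insert i A) = cs \<phi> (f i) <+>\<^bsub>S\<^esub> cs \<phi> (finsum K f A)"
    using insert by (subst gq.finsum_insert) (auto simp: gq_simps)
  also have "\<dots> = cs \<phi> (f i \<oplus> finsum K f A)"
    using insert by (intro cs_add R_finsum) auto
  also have "f i \<oplus> finsum K f A = finsum K f (insert i A)"
    using insert R_carr by (intro finsum_insert[symmetric]) auto
  finally show ?case .
qed

lemmas \<Gamma>_grp = value_group_subgroup

lemma \<Gamma>_diff: "\<phi> \<in> \<Gamma> \<Longrightarrow> \<psi> \<in> \<Gamma> \<Longrightarrow> \<phi> - \<psi> \<in> \<Gamma>"
  and \<Gamma>_zero: "0 \<in> \<Gamma>"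
  and \<Gamma>_nmul: "\<phi> \<in> \<Gamma> \<Longrightarrow> nmul k \<phi> \<in> \<Gamma>"
  using \<Gamma>_grp subgroup_minus[OF \<Gamma>_grp] subgroup_nmul[OF \<Gamma>_grp] unfolding subgroup_add_group_iff by blast+

lemma \<Gamma>_val: "f \<in> carrier K \<Longrightarrow> f \<noteq> \<zero> \<Longrightarrow> \<nu> f \<in> \<Gamma>"
  by (auto simp: value_group_def)

text \<open>
  Elements of the graded ring are handled through families of representatives of their components.
\<close>

definition rep :: "('g \<Rightarrow> 'a) \<Rightarrow> bool" where
  "rep f \<longleftrightarrow> (\<forall>\<psi>\<in>\<Gamma>. f \<psi> \<in> Pge \<psi>) \<and> finite {\<psi> \<in> \<Gamma>. f \<psi> \<notin> Kgt \<psi>}"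

definition mk :: "('g \<Rightarrow> 'a) \<Rightarrow> ('g \<Rightarrow> 'a set)" where
  "mk f = (\<lambda>\<psi>\<in>\<Gamma>. cs \<psi> (f \<psi>))"

lemma rep_Pge: "rep f \<Longrightarrow> \<psi> \<in> \<Gamma> \<Longrightarrow> f \<psi> \<in> R \<and> f \<psi> \<in> Kge \<psi> \<and> f \<psi> \<in> carrier K"
  using R_carr by (auto simp: rep_def Pge_iff)

lemma mk_cong: "(\<And>\<psi>. \<psi> \<in> \<Gamma> \<Longrightarrow> cs \<psi> (f \<psi>) = cs \<psi> (g \<psi>)) \<Longrightarrow> mk f = mk g"
  unfolding mk_def by (rule restrict_ext)

lemma gr_carrier: "carrier gr = {mk f | f. rep f}"
proof (intro subset_antisym subsetI)
  fix F assume "F \<in> carrier gr"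
  then have F: "F \<in> Pi\<^sub>E \<Gamma> (gr_component K \<nu> R)" "finite {\<phi> \<in> \<Gamma>. F \<phi> \<noteq> Pgt \<phi>}" by (simp_all add: gr_ring_def)
  have "\<exists>a. a \<in> Pge \<psi> \<and> F \<psi> = cs \<psi> a" if "\<psi> \<in> \<Gamma>" for \<psi>
    using PiE_mem[OF F(1) that] by (auto simp: gr_component_def cs_def)
  then obtain f where f: "\<And>\<psi>. \<psi> \<in> \<Gamma> \<Longrightarrow> f \<psi> \<in> Pge \<psi> \<and> F \<psi> = cs \<psi> (f \<psi>)" by metis
  have "{\<psi> \<in> \<Gamma>. f \<psi> \<notin> Kgt \<psi>} = {\<phi> \<in> \<Gamma>. F \<phi> \<noteq> Pgt \<phi>}"
    using f by (intro Collect_cong conj_cong refl) (simp add: Pge_iff cs_eq_zero_iff)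
  then have "rep f" unfolding rep_def using f F(2) by simp
  moreover have "F = mk f"
    using f F(1) by (intro extensionalityI[of _ \<Gamma>]) (auto simp: mk_def PiE_def)
  ultimately show "F \<in> {mk f | f. rep f}" by blast
next
  fix F assume "F \<in> {mk f | f. rep f}"
  then obtain f where f: "rep f" "F = mk f" by blast
  have "{\<phi> \<in> \<Gamma>. F \<phi> \<noteq> Pgt \<phi>} = {\<psi> \<in> \<Gamma>. f \<psi> \<notin> Kgt \<psi>}"
    using f(2) rep_Pge[OF f(1)] by (intro Collect_cong conj_cong refl) (simp add: mk_def cs_eq_zero_iff)
  moreover have "F \<in> Pi\<^sub>E \<Gamma> (gr_component K \<nu> R)"
    unfolding f(2) mk_def gr_component_def cs_def using f(1) by (auto simp: rep_def)
  ultimately show "F \<in> carrier gr" using f(1) by (simp add: gr_ring_def rep_def)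
qed

lemma gr_zero: "\<zero>\<^bsub>gr\<^esub> = mk (\<lambda>_. \<zero>)"
  by (simp add: gr_ring_def mk_def cs_zero)

lemma gr_add: assumes "rep f" "rep g" shows "mk f \<oplus>\<^bsub>gr\<^esub> mk g = mk (\<lambda>\<psi>. f \<psi> \<oplus> g \<psi>)"
proof -
  have "mk f \<oplus>\<^bsub>gr\<^esub> mk g = (\<lambda>\<psi>\<in>\<Gamma>. cs \<psi> (f \<psi>) <+>\<^bsub>S\<^esub> cs \<psi> (g \<psi>))"
    by (auto simp: gr_ring_def mk_def gq_simps intro!: restrict_ext)
  also have "\<dots> = mk (\<lambda>\<psi>. f \<psi> \<oplus> g \<psi>)"
    unfolding mk_def using rep_Pge[OF assms(1)] rep_Pge[OF assms(2)] by (intro restrict_ext) (simp add: cs_add)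
  finally show ?thesis .
qed

lemma rep_zero: "rep (\<lambda>_. \<zero>)"
  by (simp add: rep_def Pge_iff R_ops)

lemma rep_add: assumes "rep f" "rep g" shows "rep (\<lambda>\<psi>. f \<psi> \<oplus> g \<psi>)"
proof -
  have "{\<psi> \<in> \<Gamma>. f \<psi> \<oplus> g \<psi> \<notin> Kgt \<psi>} \<subseteq> {\<psi> \<in> \<Gamma>. f \<psi> \<notin> Kgt \<psi>} \<union> {\<psi> \<in> \<Gamma>. g \<psi> \<notin> Kgt \<psi>}"
    using Kgt_add by blast
  then show ?thesis using assms unfolding rep_def
    by (auto simp: Pge_iff R_ops Kge_add intro: finite_subset)
qed

lemma rep_uminus: assumes "rep f" shows "rep (\<lambda>\<psi>. \<ominus> f \<psi>)"
proof -
  have "{\<psi> \<in> \<Gamma>. \<ominus> f \<psi> \<notin> Kgt \<psi>} \<subseteq> {\<psi> \<in> \<Gamma>. f \<psi> \<notin> Kgt \<psi>}"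
    using Kgt_uminus by blast
  then show ?thesis using assms unfolding rep_def
    by (auto simp: Pge_iff R_ops Kge_uminus intro: finite_subset)
qed

text \<open>A representative in \<open>Kgt \<psi>\<close> stands for the zero of degree
  \<open>\<psi>\<close>, so on representatives this is the index set of the sum that defines the
  product of \<open>gr_ring\<close>.\<close>

definition msupp :: "('g \<Rightarrow> 'a) \<Rightarrow> ('g \<Rightarrow> 'a) \<Rightarrow> 'g \<Rightarrow> 'g set" where
  "msupp f g \<phi> = {\<psi> \<in> \<Gamma>. f \<psi> \<notin> Kgt \<psi> \<and> g (\<phi> - \<psi>) \<notin> Kgt (\<phi> - \<psi>)}"

definition mprod :: "('g \<Rightarrow> 'a) \<Rightarrow> ('g \<Rightarrow> 'a) \<Rightarrow> 'g \<Rightarrow> 'a" where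
  "mprod f g \<phi> = (\<Oplus>\<psi>\<in>msupp f g \<phi>. f \<psi> \<otimes> g (\<phi> - \<psi>))"

lemma msupp_finite: "rep f \<Longrightarrow> finite (msupp f g \<phi>)"
  by (rule finite_subset[of _ "{\<psi> \<in> \<Gamma>. f \<psi> \<notin> Kgt \<psi>}"]) (auto simp: msupp_def rep_def)

lemma gr_mult: assumes f: "rep f" and g: "rep g" shows "mk f \<otimes>\<^bsub>gr\<^esub> mk g = mk (mprod f g)"
proof -
  have "finsum (gr_quot K \<nu> R \<phi>) (\<lambda>\<psi>. rcoset_mult S (Pgt \<phi>) (mk f \<psi>) (mk g (\<phi> - \<psi>)))
          {\<psi> \<in> \<Gamma>. mk f \<psi> \<noteq> Pgt \<psi> \<and> mk g (\<phi> - \<psi>) \<noteq> Pgt (\<phi> - \<psi>)} = cs \<phi> (mprod f g \<phi>)"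
    if \<phi>: "\<phi> \<in> \<Gamma>" for \<phi>
  proof -
    interpret gq: ring "gr_quot K \<nu> R \<phi>" by (rule gq_ring)
    have eq: "{\<psi> \<in> \<Gamma>. mk f \<psi> \<noteq> Pgt \<psi> \<and> mk g (\<phi> - \<psi>) \<noteq> Pgt (\<phi> - \<psi>)} = msupp f g \<phi>"
      using rep_Pge[OF f] rep_Pge[OF g] cs_eq_zero_iff \<Gamma>_diff[OF \<phi>] by (auto simp: msupp_def mk_def)
    have "finsum (gr_quot K \<nu> R \<phi>) (\<lambda>\<psi>. rcoset_mult S (Pgt \<phi>) (mk f \<psi>) (mk g (\<phi> - \<psi>))) (msupp f g \<phi>)
      = finsum (gr_quot K \<nu> R \<phi>) (\<lambda>\<psi>. cs \<phi> (f \<psi> \<otimes> g (\<phi> - \<psi>))) (msupp f g \<phi>)"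
    proof (rule gq.finsum_cong')
      fix \<psi> assume "\<psi> \<in> msupp f g \<phi>"
      then have "\<psi> \<in> \<Gamma>" "\<phi> - \<psi> \<in> \<Gamma>" using \<Gamma>_diff[OF \<phi>] by (auto simp: msupp_def)
      then show "rcoset_mult S (Pgt \<phi>) (mk f \<psi>) (mk g (\<phi> - \<psi>)) = cs \<phi> (f \<psi> \<otimes> g (\<phi> - \<psi>))"
        using f g by (simp add: mk_def rep_def cs_mult)
    next
      show "(\<lambda>\<psi>. cs \<phi> (f \<psi> \<otimes> g (\<phi> - \<psi>))) \<in> msupp f g \<phi> \<rightarrow> carrier (gr_quot K \<nu> R \<phi>)"
        using rep_Pge[OF f] rep_Pge[OF g] \<Gamma>_diff[OF \<phi>] R_ops(4) by (auto simp: msupp_def gq_simps)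
    qed simp
    also have "\<dots> = cs \<phi> (mprod f g \<phi>)"
      unfolding mprod_def using rep_Pge[OF f] rep_Pge[OF g] \<Gamma>_diff[OF \<phi>]
      by (intro cs_finsum msupp_finite[OF f] R_ops(4)) (auto simp: msupp_def)
    finally show ?thesis unfolding eq .
  qed
  then show ?thesis by (auto simp: gr_ring_def mk_def[of "mprod f g"] intro!: restrict_ext)
qed

lemma rep_mprod: assumes f: "rep f" and g: "rep g" shows "rep (mprod f g)"
  unfolding rep_def
proof
  show "\<forall>\<phi>\<in>\<Gamma>. mprod f g \<phi> \<in> Pge \<phi>"
  proof
    fix \<phi> assume \<phi>: "\<phi> \<in> \<Gamma>"
    have t: "f \<psi> \<otimes> g (\<phi> - \<psi>) \<in> Kge \<phi> \<and> f \<psi> \<otimes> g (\<phi> - \<psi>) \<in> R" if "\<psi> \<in> msupp f g \<phi>" for \<psi>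
    proof -
      have \<psi>: "\<psi> \<in> \<Gamma>" "\<phi> - \<psi> \<in> \<Gamma>" using that \<Gamma>_diff[OF \<phi>] by (auto simp: msupp_def)
      then show ?thesis using Kge_mult[of "f \<psi>" \<psi> "g (\<phi> - \<psi>)" "\<phi> - \<psi>"] rep_Pge[OF f \<psi>(1)] rep_Pge[OF g \<psi>(2)] R_ops(4) by simp
    qed
    show "mprod f g \<phi> \<in> Pge \<phi>"
      unfolding Pge_iff mprod_def using t msupp_finite[OF f] by (intro conjI R_finsum Kge_finsum) auto
  qed
  have "{\<phi> \<in> \<Gamma>. mprod f g \<phi> \<notin> Kgt \<phi>} \<subseteq> (\<lambda>(\<psi>, \<chi>). \<psi> + \<chi>) ` ({\<psi> \<in> \<Gamma>. f \<psi> \<notin> Kgt \<psi>} \<times> {\<psi> \<in> \<Gamma>. g \<psi> \<notin> Kgt \<psi>})"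
  proof
    fix \<phi> assume "\<phi> \<in> {\<phi> \<in> \<Gamma>. mprod f g \<phi> \<notin> Kgt \<phi>}"
    then have \<phi>: "\<phi> \<in> \<Gamma>" "mprod f g \<phi> \<notin> Kgt \<phi>" by auto
    then have "msupp f g \<phi> \<noteq> {}" by (auto simp: mprod_def)
    then obtain \<psi> where "\<psi> \<in> msupp f g \<phi>" by blast
    then have "(\<psi>, \<phi> - \<psi>) \<in> {\<psi> \<in> \<Gamma>. f \<psi> \<notin> Kgt \<psi>} \<times> {\<psi> \<in> \<Gamma>. g \<psi> \<notin> Kgt \<psi>}"
      using \<Gamma>_diff[OF \<phi>(1)] by (auto simp: msupp_def)
    then show "\<phi> \<in> (\<lambda>(\<psi>, \<chi>). \<psi> + \<chi>) ` ({\<psi> \<in> \<Gamma>. f \<psi> \<notin> Kgt \<psi>} \<times> {\<psi> \<in> \<Gamma>. g \<psi> \<notin> Kgt \<psi>})"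
      by (rule rev_image_eqI) simp
  qed
  then show "finite {\<phi> \<in> \<Gamma>. mprod f g \<phi> \<notin> Kgt \<phi>}"
    by (rule finite_subset) (use f g in \<open>simp add: rep_def\<close>)
qed

text \<open>Provides uniqueness of additive inverses, which identifies the inverse taken by
  \<open>generate_ring\<close> with the one computed on representatives.\<close>

lemma gr_abelian_group: "abelian_group gr"
proof (rule abelian_groupI)
  fix F G H assume "F \<in> carrier gr" "G \<in> carrier gr" "H \<in> carrier gr"
  then obtain f g h where *: "rep f" "rep g" "rep h" "F = mk f" "G = mk g" "H = mk h" unfolding gr_carrier by blast
  note c = rep_Pge[OF *(1)] rep_Pge[OF *(2)] rep_Pge[OF *(3)]
  show "F \<oplus>\<^bsub>gr\<^esub> G \<oplus>\<^bsub>gr\<^esub> H = F \<oplus>\<^bsub>gr\<^esub> (G \<oplus>\<^bsub>gr\<^esub> H)"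
    unfolding * using * c by (simp add: gr_add rep_add) (intro mk_cong, simp add: a_assoc)
next
  fix F G assume "F \<in> carrier gr" "G \<in> carrier gr"
  then obtain f g where *: "rep f" "rep g" "F = mk f" "G = mk g" unfolding gr_carrier by blast
  note c = rep_Pge[OF *(1)] rep_Pge[OF *(2)]
  show "F \<oplus>\<^bsub>gr\<^esub> G \<in> carrier gr" unfolding * using * by (auto simp: gr_add rep_add gr_carrier)
  show "F \<oplus>\<^bsub>gr\<^esub> G = G \<oplus>\<^bsub>gr\<^esub> F"
    unfolding * using * c by (simp add: gr_add) (intro mk_cong, simp add: a_comm)
next
  show "\<zero>\<^bsub>gr\<^esub> \<in> carrier gr" using rep_zero by (auto simp: gr_zero gr_carrier)
next
  fix F assume "F \<in> carrier gr"
  then obtain f where *: "rep f" "F = mk f" unfolding gr_carrier by blast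
  note c = rep_Pge[OF *(1)]
  show "\<zero>\<^bsub>gr\<^esub> \<oplus>\<^bsub>gr\<^esub> F = F"
    unfolding * gr_zero using * c rep_zero by (simp add: gr_add) (intro mk_cong, simp)
  have "mk (\<lambda>\<psi>. \<ominus> f \<psi>) \<oplus>\<^bsub>gr\<^esub> F = \<zero>\<^bsub>gr\<^esub>"
    unfolding * gr_zero using * c by (simp add: gr_add rep_uminus) (intro mk_cong, simp add: l_neg)
  then show "\<exists>G\<in>carrier gr. G \<oplus>\<^bsub>gr\<^esub> F = \<zero>\<^bsub>gr\<^esub>" using rep_uminus[OF *(1)] by (auto simp: gr_carrier)
qed

lemma gr_uminus: assumes "rep f" shows "\<ominus>\<^bsub>gr\<^esub> (mk f) = mk (\<lambda>\<psi>. \<ominus> f \<psi>)"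
proof -
  interpret gr: abelian_group gr by (rule gr_abelian_group)
  have "mk (\<lambda>\<psi>. \<ominus> f \<psi>) \<oplus>\<^bsub>gr\<^esub> mk f = \<zero>\<^bsub>gr\<^esub>"
    unfolding gr_zero using assms rep_Pge[OF assms] by (simp add: gr_add rep_uminus) (intro mk_cong, simp add: l_neg)
  then show ?thesis using gr.minus_equality[of "mk (\<lambda>\<psi>. \<ominus> f \<psi>)" "mk f"] rep_uminus[OF assms] assms by (auto simp: gr_carrier)
qed

definition mono_rep :: "'g \<Rightarrow> 'a \<Rightarrow> 'g \<Rightarrow> 'a" where
  "mono_rep \<phi> f = (\<lambda>\<psi>. if \<psi> = \<phi> then f else \<zero>)"

text \<open>The class of \<open>f\<close> placed in degree \<open>\<phi>\<close>: the initial form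
  of \<open>f\<close> if \<open>\<phi>\<close> is its value, and zero if its value is
  larger.\<close>

definition hom :: "'g \<Rightarrow> 'a \<Rightarrow> ('g \<Rightarrow> 'a set)" where
  "hom \<phi> f = mk (mono_rep \<phi> f)"

lemma rep_mono: "f \<in> Pge \<phi> \<Longrightarrow> rep (mono_rep \<phi> f)"
  unfolding rep_def
  by (auto simp: mono_rep_def Pge_iff R_ops intro!: finite_subset[of _ "{\<phi>}"] split: if_splits)

lemma gr_hom_eq: "f \<in> R \<Longrightarrow> gr_hom K \<nu> R \<phi> (cs \<phi> f) = hom \<phi> f"
  unfolding gr_hom_def hom_def mk_def mono_rep_def by (rule restrict_ext) (simp add: cs_zero)

lemma in_val_eq: "f \<in> R \<Longrightarrow> in_val K \<nu> R f = hom (\<nu> f) f"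
  by (simp add: in_val_def gr_hom_eq cs_def[symmetric])

lemma gr_one: "\<one>\<^bsub>gr\<^esub> = hom 0 \<one>"
  using in_val_eq[OF R_ops(2)] by (simp add: gr_ring_def)

lemma gr_scalars_eq: "gr_scalars K \<nu> R m = hom 0 ` R"
proof -
  have "m = Pgt 0" by (intro subset_antisym subsetI) (simp_all add: Pgt_iff m_iff)
  then have "carrier (S Quot m) = cs 0 ` R"
    by (auto simp: FactRing_def A_RCOSETS_def' cs_def a_r_coset_def')
  then show ?thesis by (auto simp: gr_scalars_def image_image gr_hom_eq)
qed

lemma hom_Kgt: "f \<in> R \<Longrightarrow> f \<in> Kgt \<phi> \<Longrightarrow> hom \<phi> f = \<zero>\<^bsub>gr\<^esub>"
  unfolding hom_def gr_zero by (rule mk_cong) (auto simp: mono_rep_def cs_eq_zero_iff cs_zero)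

lemma hom_cong: "f \<in> R \<Longrightarrow> g \<in> R \<Longrightarrow> f \<ominus> g \<in> Kgt \<phi> \<Longrightarrow> hom \<phi> f = hom \<phi> g"
  unfolding hom_def by (rule mk_cong) (auto simp: mono_rep_def cs_eq_iff)

lemma hom_add: "f \<in> Pge \<phi> \<Longrightarrow> g \<in> Pge \<phi> \<Longrightarrow> hom \<phi> (f \<oplus> g) = hom \<phi> f \<oplus>\<^bsub>gr\<^esub> hom \<phi> g"
  unfolding hom_def by (subst gr_add[OF rep_mono rep_mono]) (auto simp: mono_rep_def intro!: mk_cong)

lemma hom_mult:
  assumes f: "f \<in> Pge \<phi>" and g: "g \<in> Pge \<psi>" and \<phi>: "\<phi> \<in> \<Gamma>" "\<psi> \<in> \<Gamma>"
  shows "hom (\<phi> + \<psi>) (f \<otimes> g) = hom \<phi> f \<otimes>\<^bsub>gr\<^esub> hom \<psi> g"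
proof -
  let ?f = "mono_rep \<phi> f" and ?g = "mono_rep \<psi> g"
  have fg: "f \<in> R" "g \<in> R" "f \<in> carrier K" "g \<in> carrier K" "f \<in> Kge \<phi>" "g \<in> Kge \<psi>" using f g R_carr by (auto simp: Pge_iff)
  have "mk (mprod ?f ?g) = mk (mono_rep (\<phi> + \<psi>) (f \<otimes> g))"
  proof (rule mk_cong)
    fix \<chi> assume \<chi>: "\<chi> \<in> \<Gamma>"
    show "cs \<chi> (mprod ?f ?g \<chi>) = cs \<chi> (mono_rep (\<phi> + \<psi>) (f \<otimes> g) \<chi>)"
    proof (cases "\<chi> = \<phi> + \<psi>")
      case True
      show ?thesis
      proof (cases "f \<in> Kgt \<phi> \<or> g \<in> Kgt \<psi>")
        case gt: True
        then have "msupp ?f ?g \<chi> = {}" using True by (auto simp: msupp_def mono_rep_def split: if_splits)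
        then have "mprod ?f ?g \<chi> = \<zero>" by (simp add: mprod_def)
        moreover have "cs \<chi> (f \<otimes> g) = Pgt \<chi>"
        proof -
          have "f \<otimes> g \<in> Kgt \<chi>" using gt True Kgt_mult[of f \<phi> g \<psi>] Kgt_mult'[of f \<phi> g \<psi>] fg by blast
          then show ?thesis using fg R_ops(4) cs_eq_zero_iff by blast
        qed
        ultimately show ?thesis using True by (simp add: mono_rep_def cs_zero)
      next
        case False
        then have "msupp ?f ?g \<chi> = {\<phi>}" using True \<phi> by (auto simp: msupp_def mono_rep_def split: if_splits)
        then show ?thesis using True fg by (simp add: mprod_def mono_rep_def)
      qed
    next
      case False
      then have "\<psi>' = \<phi> \<Longrightarrow> \<chi> - \<psi>' \<noteq> \<psi>" for \<psi>' by auto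
      then have "msupp ?f ?g \<chi> = {}" by (auto simp: msupp_def mono_rep_def split: if_splits)
      then show ?thesis using False by (simp add: mprod_def mono_rep_def)
    qed
  qed
  then show ?thesis unfolding hom_def by (simp add: gr_mult rep_mono f g)
qed


section \<open>Generators of the graded algebra and their minimality\<close>

definition gr_gens :: "('g \<Rightarrow> 'a set) set" where
  "gr_gens = {in_val K \<nu> R x} \<union> {in_val K \<nu> R (P i) | i. 1 \<le> i \<and> enat i \<le> \<Omega> \<and> n i > 1}"

abbreviation "gr_alg \<equiv> generate_algebra gr (gr_scalars K \<nu> R m)"

lemma gr_alg_add: "F \<in> gr_alg A \<Longrightarrow> G \<in> gr_alg A \<Longrightarrow> F \<oplus>\<^bsub>gr\<^esub> G \<in> gr_alg A"
  and gr_alg_mult: "F \<in> gr_alg A \<Longrightarrow> G \<in> gr_alg A \<Longrightarrow> F \<otimes>\<^bsub>gr\<^esub> G \<in> gr_alg A"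
  by (simp_all add: generate_algebra_def generate_ring.eng_add generate_ring.eng_mult)

lemma gr_alg_scalar: "c \<in> R \<Longrightarrow> hom 0 c \<in> gr_alg A"
  by (auto simp: generate_algebra_def gr_scalars_eq intro: generate_ring.incl)

lemma gr_alg_incl: "g \<in> A \<Longrightarrow> g \<in> gr_alg A"
  by (auto simp: generate_algebra_def intro: generate_ring.incl)

lemma gr_alg_zero: "\<zero>\<^bsub>gr\<^esub> \<in> gr_alg A"
  using gr_alg_scalar[OF R_ops(1)] hom_Kgt[OF R_ops(1), of 0] by simp

lemma gr_alg_pow:
  assumes "f \<in> R" "f \<noteq> \<zero>" "hom (\<nu> f) f \<in> gr_alg A"
  shows "hom (nmul k (\<nu> f)) (f [^] k) \<in> gr_alg A"
proof (induction k)
  case 0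
  show ?case using gr_alg_scalar[OF R_ops(2)] by simp
next
  case (Suc k)
  have fc: "f \<in> carrier K" using assms R_carr by blast
  have "hom (nmul k (\<nu> f) + \<nu> f) (f [^] k \<otimes> f) = hom (nmul k (\<nu> f)) (f [^] k) \<otimes>\<^bsub>gr\<^esub> hom (\<nu> f) f"
    using assms fc R_pow by (intro hom_mult \<Gamma>_nmul \<Gamma>_val) (auto simp: Pge_iff Kge_iff val_pow)
  then show ?case using gr_alg_mult[OF Suc assms(3)] by (simp add: nmul_Suc)
qed

lemma gr_alg_finsum:
  assumes "finite A" "\<And>i. i \<in> A \<Longrightarrow> f i \<in> Pge \<phi> \<and> hom \<phi> (f i) \<in> gr_alg G"
  shows "hom \<phi> (finsum K f A) \<in> gr_alg G \<and> finsum K f A \<in> Pge \<phi>"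
  using assms
proof (induction A rule: finite_induct)
  case empty
  then show ?case using hom_Kgt[OF R_ops(1), of \<phi>] gr_alg_zero by (simp add: Pge_iff R_ops)
next
  case (insert i A)
  then have "finsum K f (insert i A) = f i \<oplus> finsum K f A"
    using R_carr by (intro finsum_insert) (auto simp: Pge_iff)
  then show ?case using insert hom_add[of "f i" \<phi> "finsum K f A"] gr_alg_add
    by (simp add: Pge_iff R_ops Kge_add)
qed

lemma std_gr_alg:
  "enat i \<le> \<Omega> \<Longrightarrow> \<phi> \<in> \<Gamma> \<Longrightarrow> B \<in> std i \<phi> \<Longrightarrow> hom \<phi> B \<in> gr_alg gr_gens"
proof (induction i arbitrary: \<phi> B)
  case 0
  show ?case
  proof (cases "B = \<zero>")
    case True
    then show ?thesis using hom_Kgt[OF R_ops(1), of \<phi>] gr_alg_zero by simp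
  next
    case False
    then obtain c a where B: "B = c \<otimes> x [^] a" "c \<in> CS" "nmul a (\<nu> x) = \<phi>" using 0(3) by auto
    have "hom (\<nu> x) x \<in> gr_alg gr_gens" by (rule gr_alg_incl) (simp add: gr_gens_def in_val_eq xR)
    then have 1: "hom \<phi> (x [^] a) \<in> gr_alg gr_gens" using gr_alg_pow[OF xR x_nonzero] B(3) by blast
    have "hom (0 + \<phi>) (c \<otimes> x [^] a) = hom 0 c \<otimes>\<^bsub>gr\<^esub> hom \<phi> (x [^] a)"
      using CS_R[OF B(2)] R_Kge R_pow[OF xR] B(3) x_nonzero
      by (intro hom_mult \<Gamma>_zero 0(2)) (auto simp: Pge_iff Kge_iff val_pow)
    then show ?thesis using gr_alg_mult[OF gr_alg_scalar[OF CS_R[OF B(2)]] 1] B(1) by simp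
  qed
next
  case (Suc i)
  obtain C J where B: "B = (\<Oplus>j\<in>{..<J}. C j \<otimes> P (Suc i) [^] j)" and J: "enat J \<le> n (Suc i)"
    and C: "\<And>j. j < J \<Longrightarrow> C j \<in> std i (\<phi> - nmul j (v (Suc i)))" using Suc(4) by auto
  have i: "enat i \<le> \<Omega>" using enat_le_trans[OF Suc(2), of i] by simp
  have Pq: "P (Suc i) \<in> R" "P (Suc i) \<in> carrier K" "P (Suc i) \<noteq> \<zero>" using P_good[OF Suc(2)] by auto
  have "C j \<otimes> P (Suc i) [^] j \<in> Pge \<phi> \<and> hom \<phi> (C j \<otimes> P (Suc i) [^] j) \<in> gr_alg gr_gens" if j: "j < J" for j
  proof -
    let ?\<psi> = "nmul j (v (Suc i))"
    have vj: "?\<psi> \<in> \<Gamma>" using \<Gamma>_nmul \<Gamma>_val Pq(2,3) by (simp add: v_def)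
    have \<psi>: "\<phi> - ?\<psi> \<in> \<Gamma>" using \<Gamma>_diff Suc(3) vj by blast
    have Cge: "C j \<in> Pge (\<phi> - ?\<psi>)" using std_R[OF i C[OF j]] homog_Kge[OF std_homog[OF i C[OF j]]] by (simp add: Pge_iff)
    have Pge: "P (Suc i) [^] j \<in> Pge ?\<psi>" using Pq R_pow by (simp add: Pge_iff Kge_iff val_pow v_def)
    have hC: "hom (\<phi> - ?\<psi>) (C j) \<in> gr_alg gr_gens" using Suc(1)[OF i \<psi> C[OF j]] .
    have hP: "hom ?\<psi> (P (Suc i) [^] j) \<in> gr_alg gr_gens"
    proof (cases "j = 0")
      case True
      then show ?thesis using gr_alg_scalar[OF R_ops(2)] by simp
    next
      case False
      \<comment> \<open>A positive exponent can occur only if \<open>n (Suc i) > 1\<close>, and then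
        \<open>P (Suc i)\<close> contributes a generator.\<close>
      then have "1 < enat J" using j by (simp add: one_enat_def)
      then have "1 < n (Suc i)" using J by (rule less_le_trans)
      then have "in_val K \<nu> R (P (Suc i)) \<in> gr_gens" using Suc(2) unfolding gr_gens_def by force
      then have "hom (\<nu> (P (Suc i))) (P (Suc i)) \<in> gr_alg gr_gens" using gr_alg_incl in_val_eq[OF Pq(1)] by metis
      then show ?thesis using gr_alg_pow[OF Pq(1,3)] by (simp add: v_def)
    qed
    have "hom (\<phi> - ?\<psi> + ?\<psi>) (C j \<otimes> P (Suc i) [^] j) = hom (\<phi> - ?\<psi>) (C j) \<otimes>\<^bsub>gr\<^esub> hom ?\<psi> (P (Suc i) [^] j)"
      by (rule hom_mult[OF Cge Pge \<psi> vj])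
    then have "hom \<phi> (C j \<otimes> P (Suc i) [^] j) \<in> gr_alg gr_gens" using gr_alg_mult[OF hC hP] by simp
    moreover have "C j \<otimes> P (Suc i) [^] j \<in> Kge (\<phi> - ?\<psi> + ?\<psi>)"
      using Cge Pge by (intro Kge_mult) (simp_all add: Pge_iff)
    ultimately show ?thesis using Cge Pge R_ops(4) by (simp add: Pge_iff)
  qed
  then show ?case unfolding B using gr_alg_finsum[of "{..<J}" "\<lambda>j. C j \<otimes> P (Suc i) [^] j"] by simp
qed

lemma hom_gr_alg:
  assumes "\<phi> \<in> \<Gamma>" "f \<in> Pge \<phi>" shows "hom \<phi> f \<in> gr_alg gr_gens"
proof (cases "f \<in> Kgt \<phi>")
  case True
  then show ?thesis using hom_Kgt assms gr_alg_zero by (simp add: Pge_iff)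
next
  case False
  then have f: "f \<in> R" "f \<noteq> \<zero>" "\<nu> f = \<phi>" using assms R_carr by (auto simp: Pge_iff Kge_iff Kgt_iff)
  obtain l B where l: "enat l \<le> \<Omega>" "B \<in> std l \<phi>" "f \<ominus> B \<in> Kgt \<phi>" using leading_form[OF f(1,2)] f(3) by metis
  then have "hom \<phi> f = hom \<phi> B" using hom_cong f(1) std_R by blast
  then show ?thesis using std_gr_alg[OF l(1) assms(1) l(2)] by simp
qed

lemma carrier_gr_alg: "carrier gr \<subseteq> gr_alg gr_gens"
proof
  fix F assume "F \<in> carrier gr"
  then obtain f where f: "rep f" "F = mk f" by (auto simp: gr_carrier)
  define A where "A = {\<psi> \<in> \<Gamma>. f \<psi> \<notin> Kgt \<psi>}"
  have A: "finite A" "A \<subseteq> \<Gamma>" using f by (auto simp: A_def rep_def)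
  \<comment> \<open>Representatives outside \<open>A\<close> are zero in their degree and may be
    replaced by \<open>\<zero>\<close>; the induction adds one homogeneous component at a
    time.\<close>
  have "rep (\<lambda>\<psi>. if \<psi> \<in> A then f \<psi> else \<zero>) \<and> mk (\<lambda>\<psi>. if \<psi> \<in> A then f \<psi> else \<zero>) \<in> gr_alg gr_gens"
    using A
  proof (induction A rule: finite_induct)
    case empty
    then show ?case using rep_zero gr_alg_zero by (simp add: gr_zero)
  next
    case (insert \<phi> A)
    let ?g = "\<lambda>\<psi>. if \<psi> \<in> A then f \<psi> else \<zero>"
    have \<phi>: "\<phi> \<in> \<Gamma>" "f \<phi> \<in> Pge \<phi>" using insert f by (auto simp: rep_def)
    have fc: "f \<psi> \<in> carrier K" if "\<psi> \<in> insert \<phi> A" for \<psi> using rep_Pge[OF f(1)] insert that by blast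
    have eq: "(\<lambda>\<psi>. if \<psi> \<in> insert \<phi> A then f \<psi> else \<zero>) = (\<lambda>\<psi>. ?g \<psi> \<oplus> mono_rep \<phi> (f \<phi>) \<psi>)"
      using fc insert(2) by (auto simp: mono_rep_def fun_eq_iff)
    have g: "rep ?g" "mk ?g \<in> gr_alg gr_gens" using insert by auto
    have "mk ?g \<oplus>\<^bsub>gr\<^esub> hom \<phi> (f \<phi>) \<in> gr_alg gr_gens" using gr_alg_add[OF g(2) hom_gr_alg[OF \<phi>]] .
    then show ?case unfolding eq using rep_add[OF g(1) rep_mono[OF \<phi>(2)]] gr_add[OF g(1) rep_mono[OF \<phi>(2)]]
      by (simp add: hom_def)
  qed
  moreover have "mk (\<lambda>\<psi>. if \<psi> \<in> A then f \<psi> else \<zero>) = mk f"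
  proof (rule mk_cong)
    fix \<psi> assume \<psi>: "\<psi> \<in> \<Gamma>"
    then show "cs \<psi> (if \<psi> \<in> A then f \<psi> else \<zero>) = cs \<psi> (f \<psi>)"
      using rep_Pge[OF f(1) \<psi>] cs_eq_zero_iff[of "f \<psi>" \<psi>] by (auto simp: A_def cs_zero)
  qed
  ultimately show "F \<in> gr_alg gr_gens" using f(2) by simp
qed

lemma in_val_carrier: "f \<in> R \<Longrightarrow> f \<noteq> \<zero> \<Longrightarrow> in_val K \<nu> R f \<in> carrier gr"
  using rep_mono[of f "\<nu> f"] R_carr by (auto simp: in_val_eq hom_def gr_carrier Pge_iff Kge_iff)

lemma hom_homog_rep:
  assumes "f \<in> Pge \<phi>" "\<phi> \<le> \<phi>0 \<Longrightarrow> f \<in> homog T E \<phi>"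
  shows "\<exists>g. rep g \<and> hom \<phi> f = mk g \<and> (\<forall>\<psi>\<in>\<Gamma>. \<psi> \<le> \<phi>0 \<longrightarrow> g \<psi> \<in> homog T E \<psi>)"
proof (intro exI conjI)
  show "rep (mono_rep \<phi> f)" using rep_mono[OF assms(1)] .
  show "hom \<phi> f = mk (mono_rep \<phi> f)" by (simp add: hom_def)
  show "\<forall>\<psi>\<in>\<Gamma>. \<psi> \<le> \<phi>0 \<longrightarrow> mono_rep \<phi> f \<psi> \<in> homog T E \<psi>" using assms(2) by (simp add: mono_rep_def)
qed

text \<open>
  In degrees at most \<open>\<phi>0\<close> the algebra generated by initial forms only sees the generators lying in
  \<open>T\<close>: the homogeneous components have their residues in \<open>E\<close>.
\<close>

lemma gr_alg_homog:
  assumes adm: "admissible T E" "rs ` R \<subseteq> E"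
    and A: "\<And>h. h \<in> A \<Longrightarrow> \<exists>f\<in>R. f \<noteq> \<zero> \<and> h = in_val K \<nu> R f \<and> (f \<in> T \<or> \<phi>0 < \<nu> f)"
    and F: "F \<in> gr_alg A"
  shows "\<exists>f. rep f \<and> F = mk f \<and> (\<forall>\<psi>\<in>\<Gamma>. \<psi> \<le> \<phi>0 \<longrightarrow> f \<psi> \<in> homog T E \<psi>)"
  using F unfolding generate_algebra_def
proof (induction rule: generate_ring.induct)
  case one
  have "\<one> \<in> Pge 0" using R_ops(2) R_Kge by (simp add: Pge_iff)
  moreover have "\<one> \<in> homog T E 0" using adm(2) R_ops(2) R_Kge by (intro homog_scalar) auto
  ultimately show ?case unfolding gr_one by (intro hom_homog_rep)
next
  case (incl h)
  show ?case
  proof (cases "h \<in> A")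
    case True
    then obtain f where f: "f \<in> R" "f \<noteq> \<zero>" "h = in_val K \<nu> R f" "f \<in> T \<or> \<phi>0 < \<nu> f" using A by blast
    have "f \<in> Pge (\<nu> f)" using f R_carr by (simp add: Pge_iff Kge_iff)
    moreover have "\<nu> f \<le> \<phi>0 \<Longrightarrow> f \<in> homog T E (\<nu> f)" using f(4) homog_gen[OF adm(1)] by auto
    ultimately show ?thesis unfolding f(3) in_val_eq[OF f(1)] by (intro hom_homog_rep)
  next
    case False
    then obtain c where c: "c \<in> R" "h = hom 0 c" using incl by (auto simp: gr_scalars_eq)
    have "c \<in> Pge 0" using c R_Kge by (simp add: Pge_iff)
    moreover have "c \<in> homog T E 0" using adm(2) c R_Kge by (intro homog_scalar) auto
    ultimately show ?thesis unfolding c(2) by (intro hom_homog_rep)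
  qed
next
  case (a_inv h)
  then obtain f where "rep f" "h = mk f" "\<forall>\<psi>\<in>\<Gamma>. \<psi> \<le> \<phi>0 \<longrightarrow> f \<psi> \<in> homog T E \<psi>" by blast
  then show ?case
    by (intro exI[of _ "\<lambda>\<psi>. \<ominus> f \<psi>"]) (auto simp: rep_uminus gr_uminus homog_uminus[OF adm(1)])
next
  case (eng_add h1 h2)
  then obtain f g where "rep f" "h1 = mk f" "\<forall>\<psi>\<in>\<Gamma>. \<psi> \<le> \<phi>0 \<longrightarrow> f \<psi> \<in> homog T E \<psi>"
    "rep g" "h2 = mk g" "\<forall>\<psi>\<in>\<Gamma>. \<psi> \<le> \<phi>0 \<longrightarrow> g \<psi> \<in> homog T E \<psi>" by blast
  then show ?case
    by (intro exI[of _ "\<lambda>\<psi>. f \<psi> \<oplus> g \<psi>"]) (auto simp: rep_add gr_add homog_add[OF adm(1)])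
next
  case (eng_mult h1 h2)
  then obtain f g where *: "rep f" "h1 = mk f" "\<forall>\<psi>\<in>\<Gamma>. \<psi> \<le> \<phi>0 \<longrightarrow> f \<psi> \<in> homog T E \<psi>"
    "rep g" "h2 = mk g" "\<forall>\<psi>\<in>\<Gamma>. \<psi> \<le> \<phi>0 \<longrightarrow> g \<psi> \<in> homog T E \<psi>" by blast
  \<comment> \<open>Nonzero components have nonnegative degree because \<open>R\<close> lies in the
    valuation ring. So the factors contributing to a degree at most \<open>\<phi>0\<close> also have
    degree at most \<open>\<phi>0\<close>, and the induction hypotheses apply to them.\<close>
  have nonneg: "0 \<le> \<psi>" if "rep f" "\<psi> \<in> \<Gamma>" "f \<psi> \<notin> Kgt \<psi>" for f \<psi>
  proof (rule ccontr)
    assume "\<not> 0 \<le> \<psi>"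
    then have "f \<psi> \<in> Kgt \<psi>" using R_Kge[of "f \<psi>"] rep_Pge[OF that(1,2)] by (auto simp: Kge_iff Kgt_iff)
    with that(3) show False by simp
  qed
  have "mprod f g \<phi> \<in> homog T E \<phi>" if \<phi>: "\<phi> \<in> \<Gamma>" "\<phi> \<le> \<phi>0" for \<phi>
    unfolding mprod_def
  proof (rule homog_finsum[OF adm(1) msupp_finite[OF *(1)]])
    fix \<psi> assume "\<psi> \<in> msupp f g \<phi>"
    then have \<psi>: "\<psi> \<in> \<Gamma>" "\<phi> - \<psi> \<in> \<Gamma>" "f \<psi> \<notin> Kgt \<psi>" "g (\<phi> - \<psi>) \<notin> Kgt (\<phi> - \<psi>)"
      using \<Gamma>_diff[OF \<phi>(1)] by (auto simp: msupp_def)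
    have "0 \<le> \<psi>" "0 \<le> \<phi> - \<psi>" using nonneg[OF *(1) \<psi>(1,3)] nonneg[OF *(4) \<psi>(2,4)] by auto
    then have "\<psi> \<le> \<phi>" "\<phi> - \<psi> \<le> \<phi>" by simp_all
    then have le: "\<psi> \<le> \<phi>0" "\<phi> - \<psi> \<le> \<phi>0" using \<phi>(2) order_trans by blast+
    have "f \<psi> \<otimes> g (\<phi> - \<psi>) \<in> homog T E (\<psi> + (\<phi> - \<psi>))"
      using *(3,6) \<psi>(1,2) le by (intro homog_mult[OF adm(1)]) auto
    then show "f \<psi> \<otimes> g (\<phi> - \<psi>) \<in> homog T E \<phi>" by simp
  qed
  then show ?case using * by (intro exI[of _ "mprod f g"]) (auto simp: rep_mprod gr_mult)
qed

text \<open>Reading \<open>gr_alg_homog\<close> in degree \<open>\<nu> p\<close>: the representative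
  there differs from \<open>p\<close> by an element of larger value, and \<open>homog\<close> is
  insensitive to that. As \<open>p\<close> is not in \<open>Kgt (\<nu> p)\<close>, there must be a
  monomial in \<open>T\<close> of its value.\<close>

lemma in_val_gr_alg_homog:
  assumes adm: "admissible T E" "rs ` R \<subseteq> E"
    and A: "\<And>h. h \<in> A \<Longrightarrow> \<exists>f\<in>R. f \<noteq> \<zero> \<and> h = in_val K \<nu> R f \<and> (f \<in> T \<or> \<nu> p < \<nu> f)"
    and p: "p \<in> R" "p \<noteq> \<zero>" "in_val K \<nu> R p \<in> gr_alg A"
  shows "p \<in> homog T E (\<nu> p)" "\<nu> p \<in> \<nu> ` mon_group T"
proof -
  have pc: "p \<in> carrier K" using p R_carr by blast
  have \<Gamma>: "\<nu> p \<in> \<Gamma>" using \<Gamma>_val[OF pc p(2)] .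
  obtain f where f: "rep f" "in_val K \<nu> R p = mk f" "\<forall>\<psi>\<in>\<Gamma>. \<psi> \<le> \<nu> p \<longrightarrow> f \<psi> \<in> homog T E \<psi>"
    using gr_alg_homog[OF adm A p(3)] by blast
  have "cs (\<nu> p) p = cs (\<nu> p) (f (\<nu> p))"
    using fun_cong[OF f(2), of "\<nu> p"] \<Gamma> unfolding in_val_eq[OF p(1)] hom_def mk_def mono_rep_def by simp
  then have "p \<ominus> f (\<nu> p) \<in> Kgt (\<nu> p)" using cs_eq_iff[OF p(1)] rep_Pge[OF f(1) \<Gamma>] by simp
  moreover have "p = f (\<nu> p) \<oplus> (p \<ominus> f (\<nu> p))"
  proof -
    have "f (\<nu> p) \<in> carrier K" using rep_Pge[OF f(1) \<Gamma>] by blast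
    then show ?thesis using pc by algebra
  qed
  ultimately show h: "p \<in> homog T E (\<nu> p)" using homog_add[OF adm(1) _ homog_Kgt] f(3) \<Gamma> by fastforce
  have "p \<notin> Kgt (\<nu> p)" using p(2) by (simp add: Kgt_iff)
  then obtain W where W: "W \<in> mon_group T" "\<nu> W = \<nu> p" using h by (auto simp: homog_def)
  show "\<nu> p \<in> \<nu> ` mon_group T" by (rule image_eqI[OF _ W(1)]) (simp add: W(2))
qed

text \<open>The value gives index 1, so \<open>\<alpha> i\<close> is the residue of
  \<open>P i / U\<close>. Homogeneity puts it into \<open>FF i\<close>, whence the degree is 1
  too.\<close>

lemma homog_imp_n_eq_1:
  assumes i: "1 \<le> i" "enat i \<le> \<Omega>" and h: "P i \<in> homog (SS i) (FF i) (v i)" "v i \<in> \<nu> ` mon_group (SS i)"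
  shows "n i = 1"
proof -
  have adm: "admissible (SS i) (FF i)" using adm[of "i - 1"] i enat_le_trans[OF i(2), of "i - 1"] by simp
  have nb: "nb i = enat 1" using nb_eq_1I[OF i h(2)] by (simp add: one_enat_def)
  obtain w U where U: "U \<in> mon_group (SS i)" "\<nu> U = nmul 1 (v i)" "\<alpha> i = lres U (P i [^] (1::nat))" "n i = nb i * d i"
    using step_U[OF i nb] by metis
  have "lres U (P i) \<in> FF i" using homog_lres[OF adm h(1) U(1)] U(2) by simp
  then have "\<alpha> i \<in> FF i" using U(3) P_good[OF i(2)] by simp
  then have "d i = 1" using d_eq_1_iff(1)[OF i] by simp
  then show ?thesis using U(4) nb by (simp add: one_enat_def)
qed

theorem gr_generation: "minimally_generates gr_alg gr_gens (carrier gr)"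
  unfolding minimally_generates_def
proof (intro conjI allI impI)
  interpret gr: abelian_group gr by (rule gr_abelian_group)
  have gens: "gr_scalars K \<nu> R m \<union> gr_gens \<subseteq> carrier gr"
  proof -
    have "hom 0 c \<in> carrier gr" if "c \<in> R" for c
      using rep_mono[of c 0] that R_Kge by (auto simp: hom_def gr_carrier Pge_iff)
    then show ?thesis using in_val_carrier P_good xR x_nonzero by (auto simp: gr_scalars_eq gr_gens_def)
  qed
  have "F \<in> carrier gr" if "F \<in> gr_alg gr_gens" for F
    using that unfolding generate_algebra_def
  proof (induction rule: generate_ring.induct)
    case one
    then show ?case using in_val_carrier[OF R_ops(2)] by (simp add: gr_one in_val_eq R_ops)
  next
    case (eng_mult h1 h2)
    then show ?case using gr_mult rep_mprod unfolding gr_carrier by blast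
  qed (use gens in auto)
  with carrier_gr_alg show "gr_alg gr_gens = carrier gr" by blast
  fix G' assume G': "G' \<subset> gr_gens"
  show "gr_alg G' \<noteq> carrier gr"
  proof
    assume eq: "gr_alg G' = carrier gr"
    have form: "\<exists>j. enat j \<le> \<Omega> \<and> h = in_val K \<nu> R (P j) \<and> (j = 0 \<or> 1 < n j)" if "h \<in> gr_gens" for h
      using that by (auto simp: gr_gens_def P_0 zero_enat_def[symmetric] intro: exI[of _ 0])
    obtain g where g: "g \<in> gr_gens" "g \<notin> G'" using G' by blast
    obtain i where i: "enat i \<le> \<Omega>" "g = in_val K \<nu> R (P i)" "i = 0 \<or> 1 < n i" using form[OF g(1)] by blast
    have Pi: "P i \<in> R" "P i \<noteq> \<zero>" using P_good[OF i(1)] by auto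
    have mem: "in_val K \<nu> R (P i) \<in> gr_alg G'" unfolding eq using in_val_carrier[OF Pi] .
    have G'f: "\<exists>j. enat j \<le> \<Omega> \<and> h = in_val K \<nu> R (P j) \<and> j \<noteq> i \<and> (j = 0 \<or> 1 < n j)" if "h \<in> G'" for h
      using form[of h] that G' g(2) i(2) by blast
    have rsE: "rs ` R \<subseteq> FF k" for k using rsR_FF by blast
    show False
    proof (cases "i = 0")
      case False
      then have i1: "1 \<le> i" by simp
      have "admissible (SS i) (FF i)" using adm[of "i - 1"] i1 enat_le_trans[OF i(1), of "i - 1"] by simp
      moreover have "\<exists>f\<in>R. f \<noteq> \<zero> \<and> h = in_val K \<nu> R f \<and> (f \<in> SS i \<or> \<nu> (P i) < \<nu> f)" if hG: "h \<in> G'" for h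
      proof -
        obtain j where j: "enat j \<le> \<Omega>" "h = in_val K \<nu> R (P j)" "j \<noteq> i" using G'f[OF hG] by blast
        have "P j \<in> SS i \<or> \<nu> (P i) < \<nu> (P j)"
          using v_less[OF i1 _ j(1)] j(3) by (cases "j < i") (auto simp: SS_def v_def)
        then show ?thesis using P_good[OF j(1)] j(2) by blast
      qed
      ultimately have "n i = 1"
        using in_val_gr_alg_homog[OF _ rsE, of "SS i" i G' "P i"] Pi mem homog_imp_n_eq_1[OF i1 i(1)] by (simp add: v_def)
      then show False using i(3) False by simp
    next
      case True
      have \<Omega>1: "enat 1 \<le> \<Omega>" using \<Omega>_ge_1 by (simp add: one_enat_def)
      have k: "subfield (FF 1) k\<nu>" by (rule FF_subfield) simp
      have m0: "z \<in> mon_group {} \<Longrightarrow> z = \<one>" for z by (induction rule: mon_group.induct) auto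
      have adm0: "admissible {} (FF 1)" unfolding admissible_def using k m0 rsR_FF[of \<one> 1] R_ops by auto
      have G'1: "\<exists>j. enat j \<le> \<Omega> \<and> h = in_val K \<nu> R (P j) \<and> 1 \<le> j \<and> 1 < n j" if "h \<in> G'" for h
        using G'f[OF that] True by (auto simp: Suc_le_eq)
      show False
      \<comment> \<open>Unless \<open>y\<close> is a generator with the value of \<open>x\<close>,
        all other generators have larger value, so only scalars remain in degree \<nu>(x) and
        \<nu>(x) would be 0.\<close>
      proof (cases "v 1 = v 0 \<and> 1 < n 1")
        case False
        have "\<exists>f\<in>R. f \<noteq> \<zero> \<and> h = in_val K \<nu> R f \<and> (f \<in> {} \<or> \<nu> (P i) < \<nu> f)" if hG: "h \<in> G'" for h
        proof -
          obtain j where j: "enat j \<le> \<Omega>" "h = in_val K \<nu> R (P j)" "1 \<le> j" "1 < n j" using G'1[OF hG] by blast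
          have "v 0 < v j"
          proof (cases "j = 1")
            case True
            then show ?thesis using False j(4) val_x_le_y v_0 v_1 by auto
          next
            case False
            then have "v 1 < v j" using v_less[of 1 j] j by simp
            then show ?thesis using val_x_le_y v_0 v_1 by simp
          qed
          then show ?thesis using P_good[OF j(1)] j(2) True by (auto simp: v_def)
        qed
        then have "\<nu> (P i) \<in> \<nu> ` mon_group {}" using in_val_gr_alg_homog(2)[OF adm0 rsE _ Pi mem] by blast
        then obtain z where "z \<in> mon_group {}" "\<nu> (P i) = \<nu> z" by blast
        then have "v i = 0" using m0[of z] by (simp add: v_def)
        then show False using P_good[OF i(1)] by simp
      next
        case v1: True
        \<comment> \<open>In degree \<nu>(x) only \<open>y\<close> can help, so the residue of
          \<open>x / y\<close> would lie in \<open>FF 1\<close>. Then so does its inverse, the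
          residue of \<open>y / x\<close>, which makes \<open>y\<close> homogeneous over
          \<open>x\<close> alone and contradicts \<open>n 1 > 1\<close>.\<close>
        have "admissible {y} (FF 1)"
        proof (rule admissible_insert[OF adm0 k])
          have "k = 0" if "nmul k (\<nu> y) \<in> \<nu> ` mon_group {}" for k
            using that m0 nmul_strict_mono_left[OF val_y_pos, of 0 k] by force
          then show "(\<forall>k. nmul k (\<nu> y) \<in> \<nu> ` mon_group {} \<longrightarrow> k = 0) \<or>
            (\<exists>e U. (\<forall>n. nmul n (\<nu> y) \<in> \<nu> ` mon_group {} \<longrightarrow> e dvd n) \<and> U \<in> mon_group {} \<and> \<nu> U = nmul e (\<nu> y) \<and> lres U (y [^] e) \<in> FF 1)"
            by blast
        qed (use y_nonzero in auto)
        note admy = this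
        have "\<exists>f\<in>R. f \<noteq> \<zero> \<and> h = in_val K \<nu> R f \<and> (f \<in> {y} \<or> \<nu> (P i) < \<nu> f)" if hG: "h \<in> G'" for h
        proof -
          obtain j where j: "enat j \<le> \<Omega>" "h = in_val K \<nu> R (P j)" "1 \<le> j" using G'1[OF hG] by blast
          have "P j \<in> {y} \<or> v i < v j"
          proof (cases "j = 1")
            case False
            then have "v 1 < v j" using v_less[of 1 j] j by simp
            then show ?thesis using v1 True by simp
          qed (simp add: P_1)
          then show ?thesis using P_good[OF j(1)] j(2) by (auto simp: v_def)
        qed
        then have hx: "x \<in> homog {y} (FF 1) (\<nu> x)"
          using in_val_gr_alg_homog(1)[OF admy rsE _ Pi mem] True by (simp add: P_0)
        have vxy: "\<nu> x = \<nu> y" using v1 v_0 v_1 by simp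
        have yS: "y \<in> mon_group {y}" using y_nonzero by (intro mon_group_incl) auto
        have l: "lres y x \<in> FF 1" using homog_lres[OF admy hx yS] vxy by simp
        have xi: "inv x \<in> carrier K" "inv y \<in> carrier K" "inv x \<noteq> \<zero>" "inv y \<noteq> \<zero>" using x_nonzero y_nonzero by auto
        have inv: "inv (x \<otimes> inv y) = y \<otimes> inv x"
          using inv_mult_field[of x "inv y"] xi x_nonzero y_nonzero by (simp add: m_comm)
        have v0: "\<nu> (x \<otimes> inv y) = 0" using xi x_nonzero y_nonzero vxy by (simp add: val_mult val_inv)
        have nz: "x \<otimes> inv y \<noteq> \<zero>" "x \<otimes> inv y \<in> carrier K" using xi x_nonzero by auto
        have "lres x y = inv\<^bsub>k\<nu>\<^esub> (lres y x)" unfolding lres_def inv[symmetric] by (rule rs_inv[OF nz(2,1) v0])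
        moreover have "lres y x \<noteq> \<zero>\<^bsub>k\<nu>\<^esub>"
          using lres_zero_iff[of y x] x_nonzero y_nonzero vxy by (simp add: Kge_iff Kgt_iff)
        ultimately have lxy: "lres x y \<in> FF 1" using kf.subfield_m_inv(1)[OF k, of "lres y x"] l by simp
        have xS: "x \<in> mon_group (SS 1)" using x_nonzero mon_group_incl[of "{x}" x] by (simp add: SS_1)
        have "P 1 \<in> homog (SS 1) (FF 1) (v 1)"
          unfolding homog_def using xS lxy vxy by (auto simp: P_1 v_def Kge_iff)
        moreover have "v 1 \<in> \<nu> ` mon_group (SS 1)" using xS vxy v_1 by (metis imageI)
        ultimately have "n 1 = 1" using homog_imp_n_eq_1[of 1] \<Omega>1 by simp
        then show False using v1 by simp
      qed
    qed
  qed
qed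

end

theorem theorem4p11:
  fixes K :: "('a, 'b) ring_scheme"
    and R m CS :: "'a set"
    and \<nu> :: "'a \<Rightarrow> 'g::linordered_ab_group_add"
    and x y :: 'a
    and \<Omega> :: enat
    and P :: "nat \<Rightarrow> 'a"
    and nb d n :: "nat \<Rightarrow> enat"
    and \<alpha> :: "nat \<Rightarrow> 'a set"
  assumes "quotient_field K R"
    and "regular_local_ring (with_carrier K R) m"
    and "krull_dim (with_carrier K R) = 2"
    and "coefficient_set (with_carrier K R) m CS"
    and "x \<in> R" and "y \<in> R" and "m = genideal (with_carrier K R) {x, y}"
    and "valuation K \<nu>" and "valuation_rank K \<nu> = 1" and "dominates K \<nu> R m"
    and "\<nu> x = ideal_value K \<nu> m"
    and "generating_sequence K \<nu> R CS x y \<Omega> P nb d n \<alpha>"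
  shows "minimally_generates (generate_algebra (gr_ring K \<nu> R) (gr_scalars K \<nu> R m))
           ({in_val K \<nu> R x} \<union> {in_val K \<nu> R (P i) | i. 1 \<le> i \<and> enat i \<le> \<Omega> \<and> n i > 1})
           (carrier (gr_ring K \<nu> R))
       \<and> minimally_generates nat_combinations
           ({\<nu> x} \<union> {\<nu> (P i) | i. 1 \<le> i \<and> enat i \<le> \<Omega> \<and> nb i > 1})
           (value_semigroup K \<nu> R)
       \<and> carrier (res_field K \<nu>) =
           adjoined K \<nu> R {\<alpha> i | i. 1 \<le> i \<and> enat i \<le> \<Omega> \<and> d i > 1}"
proof -
  interpret field K using assms(1) by (simp add: quotient_field_def)
  interpret generating_sequence_setup K \<nu> R m CS x y \<Omega> P nb d n \<alpha>
    by unfold_locales (fact assms)+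
  show ?thesis
    using gr_generation[unfolded gr_gens_def] semigroup_generation[unfolded value_gens_def]
      residue_field_generation by blast
qed

end
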